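(* Let $r\ge 0$, let $h:(\mathbb K^n,0)\to(\mathbb K^k,0)$ be an analytic mapping, let $g$ be its Taylor polynomial of degree $r$ at $0$, and let $f_u=(1-u)h+ug$. If $W$ (respectively $X$) is $(t^r)$ for $\Gamma(h)$, then the family $\Gamma(f_u)$ has Verdier equisingular intersection with $W$ (respectively $X$), i.e. for every $u_0\in[0,1]$ the germ of the family at $u_0$ has Verdier equisingular intersection with $W$ (respectively $X$).
   Context: $\mathbb K$ is $\mathbb R$ or $\mathbb C$. $\mathbb K^{n+k}=\mathbb K^n\times\mathbb K^k$ has coordinates $(x_1,\dots,x_n,y_1,\dots,y_k)$ and $Y=\{0\}\times\mathbb K^k$. $F:(\mathbb K^{n+k},0)\to(\mathbb K^p,0)$ is an analytic map germ, $X=F^{-1}(0)$, $e$ is the codimension of $X\setminus Y$, $W$ is the Zariski open subset of $X\setminus Y$ where $F$ has rank $e$ (a smooth submanifold), $S=X\setminus W$, and $W$ is assumed dense in $X\setminus Y$ in the metric topology. $(t^r)$. Let $P=\Gamma(f)$ be the graph of an analytic $f:(\mathbb K^n,0)\to(\mathbb K^k,0)$. For $r\ge1$, graphs of two $C^r$ map germs vanishing at $0$ satisfy $j^rP=j^rQ$ if the maps have the same $r$-jet at $0$. For $r=0$ one considers map germs vanishing at $0$ of class $C^{0,-1}$, i.e. continuous, $C^1$ except possibly at $0$, with $|g'(x)|=O(|x|^{-1})$; then $j^0\Gamma(f)=j^0\Gamma(g)$ if $|f'(x)-g'(x)|=o(|x|^{-1})$. If $\mathbb K=\mathbb C$, $\mathbb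 C^n,\mathbb C^k$ are regarded as real spaces and the graphs $Q$ are graphs of real $C^r$ (resp. $C^{0,-1}$) maps. $W$ is $(t^r)$ for $P$ if every $Q$ with $j^rQ=j^rP$ is transverse to $W$ at all points near (but not necessarily at) $0$. $X$ is $(t^r)$ for $P$ if in addition every such $Q$ satisfies $Q\cap S=\{0\}$ as germs at $0$. Verdier equisingular intersection. For an analytic family $f(x,u)=f_u(x)$ with $f_u(0)=0$ and parameter $u\in\mathbb K^c$ (here $c=1$), put $\beta(x,u)=(x,f(x,u))$, $\tilde X=\beta^{-1}(X)$, $\tilde S=\beta^{-1}(S)$, $\tilde W=\beta^{-1}(W)$, $\tilde Y=\{0\}\times\mathbb K^c$, as germs at $(0,u_0)$. For linear subspaces $A,B$ of a Euclidean/Hermitian space, $\operatorname{dist}(A,B)=\sup\tan\arcsin\frac{|(u,v)|}{\|u\|\|v\|}$ over nonzero $u\in B^\perp$, $v\in A$. $\tilde W$ is $(w)$ regular over $\tilde Y$ at a point of $\tilde Y$ if it is a smooth submanifold near that point and there is $C>0$ with $\operatorname{dist}(\{0\}\times\mathbb K^c,T_w\tilde W)\le C|x|$ for all $w=(x,u)\in\tilde W$ near that point; $\tilde X$ is $(w)$ regular over $\tilde Y$ at a point if $\tilde W$ is and the germ of $\tilde S$ there is contained in $\tilde Y$. The germ at $u_0$ of the family $\Gamma(f_u)$ has Verdier equisingular intersection with $W$ (resp. $X$) if $\tilde W$ (resp. $\tilde X$) is $(w)$ regular over $\tilde Y$ at each point of $\tilde Y$ near $(0,u_0)$. *)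

theory Defs
  imports "HOL-Analysis.Analysis" "HOL-Library.Landau_Symbols"
begin

text \<open>
  The field \<open>\<bbbK>\<close> is a type \<open>'a\<close> of class \<open>{real_normed_field, euclidean_space}\<close>, i.e. a
  finite-dimensional real normed field whose (multiplicative) norm is Euclidean. Both \<open>real\<close> and
  \<open>complex\<close> are instances, and by the Gelfand--Mazur theorem every such type is isometrically
  isomorphic to one of these two. The space \<open>\<bbbK>\<close>^(n+m) is rendered as \<open>('a^'n) \<times> ('a^'m)\<close>.
  All map germs are represented by total functions of which only the values near the base point
  matter, and a germ of a set by a set of which only the part near the base point matters.
\<close>

text \<open>Reflection of \<open>\<bbbK>\<close> in the real axis, since there is no conjugation on the type class.\<close>

definition conjugate :: "'a::{real_normed_field,euclidean_space} \<Rightarrow> 'a" where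
  "conjugate z = of_real (2 * (z \<bullet> 1)) - z"

lemma conjugate_real: "conjugate (x::real) = x"
  by (simp add: conjugate_def)

lemma conjugate_complex: "conjugate z = cnj z"
  by (simp add: conjugate_def complex_eq_iff inner_complex_def)

definition scaleK ::
    "'a::{real_normed_field,euclidean_space} \<Rightarrow> ('a^'n) \<times> ('a^'m) \<Rightarrow> ('a^'n) \<times> ('a^'m)" where
  "scaleK c z = (c *s fst z, c *s snd z)"

definition hinner :: "('a::{real_normed_field,euclidean_space}^'n) \<times> ('a^'m)
    \<Rightarrow> ('a^'n) \<times> ('a^'m) \<Rightarrow> 'a" where
  "hinner u v = (\<Sum>i\<in>UNIV. fst u $ i * conjugate (fst v $ i))
              + (\<Sum>j\<in>UNIV. snd u $ j * conjugate (snd v $ j))"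

definition hperp :: "(('a::{real_normed_field,euclidean_space}^'n) \<times> ('a^'m)) set
    \<Rightarrow> (('a^'n) \<times> ('a^'m)) set" where
  "hperp B = {u. \<forall>b\<in>B. hinner u b = 0}"

text \<open>\<open>tan (arcsin s)\<close> for \<open>0 \<le> s \<le> 1\<close>. The value at \<open>s = 1\<close> has to be \<open>\<infinity>\<close>, whereas the library
  has \<open>tan (pi / 2) = 0\<close>.\<close>

definition tan_arcsin :: "real \<Rightarrow> ennreal" where
  "tan_arcsin s = (if s < 1 then ennreal (tan (arcsin s)) else \<infinity>)"

text \<open>The supremum is taken in \<open>ennreal\<close>, so it is \<open>0\<close> over the empty set.\<close>

definition subspace_dist :: "(('a::{real_normed_field,euclidean_space}^'n) \<times> ('a^'m)) set
    \<Rightarrow> (('a^'n) \<times> ('a^'m)) set \<Rightarrow> ennreal" where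
  "subspace_dist A B =
     (SUP (u, v) \<in> (hperp B - {0}) \<times> (A - {0}). tan_arcsin (norm (hinner u v) / (norm u * norm v)))"

text \<open>Derivatives are real derivatives, also for \<open>\<bbbK> = \<complex>\<close>.\<close>

fun dir_deriv :: "'b::real_normed_vector list \<Rightarrow> ('b \<Rightarrow> 'c::real_normed_vector) \<Rightarrow> 'b \<Rightarrow> 'c" where
  "dir_deriv [] f = f"
| "dir_deriv (v # vs) f = dir_deriv vs (\<lambda>x. frechet_derivative f (at x) v)"

definition Cr_on :: "nat \<Rightarrow> ('b::euclidean_space \<Rightarrow> 'c::euclidean_space) \<Rightarrow> 'b set \<Rightarrow> bool" where
  "Cr_on r f U \<longleftrightarrow>
     (\<forall>vs. length vs \<le> r \<longrightarrow> continuous_on U (dir_deriv vs f)) \<and>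
     (\<forall>vs. length vs < r \<longrightarrow> (\<forall>x\<in>U. dir_deriv vs f differentiable at x))"

text \<open>For \<open>\<bbbK> = \<real>\<close> these are the \<open>C\<^sup>\<infinity>\<close> functions, for \<open>\<bbbK> = \<complex>\<close> the holomorphic ones.\<close>

definition K_smooth_on :: "(('a::{real_normed_field,euclidean_space}^'n) \<times> ('a^'m) \<Rightarrow> 'a)
    \<Rightarrow> (('a^'n) \<times> ('a^'m)) set \<Rightarrow> bool" where
  "K_smooth_on g U \<longleftrightarrow> (\<forall>r. Cr_on r g U) \<and>
     (\<forall>z\<in>U. \<forall>c v. frechet_derivative g (at z) (scaleK c v) = c * frechet_derivative g (at z) v)"

definition taylor_poly ::
    "nat \<Rightarrow> ('b::real_normed_vector \<Rightarrow> 'c::real_normed_vector) \<Rightarrow> 'b \<Rightarrow> 'c" where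
  "taylor_poly r h x = (\<Sum>j\<le>r. (1 / fact j) *\<^sub>R dir_deriv (replicate j x) h 0)"

definition analytic_germ :: "('a::{real_normed_field,euclidean_space}^'n \<Rightarrow> 'a^'m) \<Rightarrow> bool" where
  "analytic_germ f \<longleftrightarrow> (\<exists>c::('n \<Rightarrow> nat) \<Rightarrow> 'a^'m. \<exists>\<epsilon>>0. \<forall>x\<in>ball 0 \<epsilon>.
     ((\<lambda>\<alpha>. (\<Prod>i\<in>UNIV. x $ i ^ \<alpha> i) *s c \<alpha>) has_sum f x) UNIV)"

definition analytic_germ2 ::
    "(('a::{real_normed_field,euclidean_space}^'n) \<times> ('a^'m) \<Rightarrow> 'a^'p) \<Rightarrow> bool" where
  "analytic_germ2 F \<longleftrightarrow>
     analytic_germ (\<lambda>z::'a^('n + 'm). F (\<chi> i. z $ Inl i, \<chi> j. z $ Inr j))"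

definition rankK ::
    "(('a::{real_normed_field,euclidean_space}^'n) \<times> ('a^'m) \<Rightarrow> 'a^'p)
      \<Rightarrow> ('a^'n) \<times> ('a^'m) \<Rightarrow> nat" where
  "rankK F z = vec.dim (range (frechet_derivative F (at z)))"

definition submanifold_at ::
    "nat \<Rightarrow> (('a::{real_normed_field,euclidean_space}^'n) \<times> ('a^'m)) set
      \<Rightarrow> ('a^'n) \<times> ('a^'m) \<Rightarrow> bool" where
  "submanifold_at d M p \<longleftrightarrow> (\<exists>U g. open U \<and> p \<in> U \<and>
     (\<forall>i<d. K_smooth_on (g i) U) \<and>
     M \<inter> U = {z\<in>U. \<forall>i<d. g i z = 0} \<and>
     (\<forall>c. (\<forall>v. (\<Sum>i<d. c i * frechet_derivative (g i) (at p) v) = 0) \<longrightarrow> (\<forall>i<d. c i = 0)))"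

text \<open>Smooth (for \<open>\<bbbK> = \<complex>\<close>: complex) embedded submanifold, not required to be closed.\<close>

definition submanifold :: "(('a::{real_normed_field,euclidean_space}^'n) \<times> ('a^'m)) set \<Rightarrow> bool"
  where "submanifold M \<longleftrightarrow> (\<forall>p\<in>M. \<exists>d. submanifold_at d M p)"

text \<open>The codimension of the germ of \<open>A\<close> at \<open>0\<close>: the least codimension of a submanifold contained
  in \<open>A\<close> and arbitrarily near \<open>0\<close>. Unspecified if the germ of \<open>A\<close> is empty.\<close>

definition germ_codim :: "(('a::{real_normed_field,euclidean_space}^'n) \<times> ('a^'m)) set \<Rightarrow> nat" where
  "germ_codim A = (LEAST d. \<forall>\<epsilon>>0. \<exists>N. N \<noteq> {} \<and> N \<subseteq> A \<inter> ball 0 \<epsilon> \<and> (\<forall>p\<in>N. submanifold_at d N p))"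

text \<open>Velocity vectors at \<open>p\<close> of curves in \<open>M\<close>; this is the tangent space if \<open>M\<close> is a submanifold
  (or the graph of a \<open>C\<^sup>1\<close> map).\<close>

definition tangent_space :: "'b::real_normed_vector set \<Rightarrow> 'b \<Rightarrow> 'b set" where
  "tangent_space M p = {v. \<exists>\<gamma>::real \<Rightarrow> 'b. \<gamma> 0 = p \<and> (\<gamma> has_vector_derivative v) (at 0) \<and>
     (\<forall>\<^sub>F t in at 0. \<gamma> t \<in> M)}"

definition transverse_at :: "'b::real_normed_vector set \<Rightarrow> 'b set \<Rightarrow> 'b \<Rightarrow> bool" where
  "transverse_at Q M w \<longleftrightarrow> {a + b |a b. a \<in> tangent_space Q w \<and> b \<in> tangent_space M w} = UNIV"

definition graph :: "('b \<Rightarrow> 'c) \<Rightarrow> ('b \<times> 'c) set" where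
  "graph q = {(x, q x) |x. True}"

text \<open>Map germs vanishing at \<open>0\<close>, of class \<open>C\<^sup>r\<close> if \<open>r \<ge> 1\<close> and of class \<open>C\<^sup>0\<^sup>,\<^sup>-\<^sup>1\<close> if \<open>r = 0\<close>.\<close>

definition Cr_germ :: "nat \<Rightarrow> ('b::euclidean_space \<Rightarrow> 'c::euclidean_space) \<Rightarrow> bool" where
  "Cr_germ r q \<longleftrightarrow> q 0 = 0 \<and>
     (if r = 0
      then (\<exists>\<epsilon>>0. continuous_on (ball 0 \<epsilon>) q \<and> Cr_on 1 q (ball 0 \<epsilon> - {0})) \<and>
           (\<lambda>x. onorm (frechet_derivative q (at x))) \<in> O[at 0](\<lambda>x. 1 / norm x)
      else (\<exists>\<epsilon>>0. Cr_on r q (ball 0 \<epsilon>)))"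

definition same_jet ::
    "nat \<Rightarrow> ('b::euclidean_space \<Rightarrow> 'c::euclidean_space) \<Rightarrow> ('b \<Rightarrow> 'c) \<Rightarrow> bool" where
  "same_jet r f q \<longleftrightarrow>
     (if r = 0
      then (\<lambda>x. onorm (\<lambda>v. frechet_derivative f (at x) v - frechet_derivative q (at x) v))
             \<in> o[at 0](\<lambda>x. 1 / norm x)
      else (\<forall>vs. length vs \<le> r \<longrightarrow> dir_deriv vs f 0 = dir_deriv vs q 0))"

definition tr_W :: "nat \<Rightarrow> ('b::euclidean_space \<times> 'c::euclidean_space) set \<Rightarrow> ('b \<Rightarrow> 'c) \<Rightarrow> bool"
  where "tr_W r W f \<longleftrightarrow> (\<forall>q. Cr_germ r q \<and> same_jet r f q \<longrightarrow>
     (\<exists>\<epsilon>>0. \<forall>w\<in>graph q \<inter> W \<inter> ball 0 \<epsilon> - {0}. transverse_at (graph q) W w))"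

definition tr_X :: "nat \<Rightarrow> ('b::euclidean_space \<times> 'c::euclidean_space) set \<Rightarrow> ('b \<times> 'c) set
    \<Rightarrow> ('b \<Rightarrow> 'c) \<Rightarrow> bool" where
  "tr_X r W S f \<longleftrightarrow> tr_W r W f \<and> (\<forall>q. Cr_germ r q \<and> same_jet r f q \<longrightarrow>
     (\<exists>\<epsilon>>0. graph q \<inter> S \<inter> ball 0 \<epsilon> = {0}))"

text \<open>Here \<open>M \<subseteq> \<bbbK>\<^sup>n \<times> \<bbbK>\<^sup>c\<close> and regularity is over \<open>{0} \<times> \<bbbK>\<^sup>c\<close>.\<close>

definition w_regular_at :: "(('a::{real_normed_field,euclidean_space}^'n) \<times> ('a^'c)) set
    \<Rightarrow> ('a^'n) \<times> ('a^'c) \<Rightarrow> bool" where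
  "w_regular_at M p \<longleftrightarrow> (\<exists>\<epsilon>>0. \<exists>C>0. submanifold (M \<inter> ball p \<epsilon>) \<and>
     (\<forall>w\<in>M \<inter> ball p \<epsilon>.
        subspace_dist ({0} \<times> UNIV) (tangent_space M w) \<le> ennreal (C * norm (fst w))))"

definition family_map :: "('b \<Rightarrow> 'u \<Rightarrow> 'c) \<Rightarrow> 'b \<times> 'u \<Rightarrow> 'b \<times> 'c" where
  "family_map f = (\<lambda>(x, u). (x, f x u))"

definition verdier_W :: "(('a::{real_normed_field,euclidean_space}^'n) \<times> ('a^'k)) set
    \<Rightarrow> ('a^'n \<Rightarrow> 'a^'c \<Rightarrow> 'a^'k) \<Rightarrow> 'a^'c \<Rightarrow> bool" where
  "verdier_W W f u0 \<longleftrightarrow> (\<exists>\<delta>>0. \<forall>u\<in>ball u0 \<delta>. w_regular_at (family_map f -` W) (0, u))"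

definition verdier_X :: "(('a::{real_normed_field,euclidean_space}^'n) \<times> ('a^'k)) set
    \<Rightarrow> (('a^'n) \<times> ('a^'k)) set \<Rightarrow> ('a^'n \<Rightarrow> 'a^'c \<Rightarrow> 'a^'k) \<Rightarrow> 'a^'c \<Rightarrow> bool" where
  "verdier_X W S f u0 \<longleftrightarrow> (\<exists>\<delta>>0. \<forall>u\<in>ball u0 \<delta>.
     w_regular_at (family_map f -` W) (0, u) \<and>
     (\<exists>\<epsilon>>0. (family_map f -` S) \<inter> ball (0, u) \<epsilon> \<subseteq> {0} \<times> UNIV))"

end

theory Submission
  imports Defs
begin

text \<open>
  Write \<open>f\<^sub>u = h - u R\<close> with \<open>R = O(|x|\<^sup>r\<^sup>+\<^sup>1)\<close> the Taylor remainder of \<open>h\<close>. A conormal covector \<open>(p, b)\<close> of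
  \<open>W\<close> pulls back to a conormal covector of \<open>\<beta>\<^sup>-\<^sup>1(W)\<close> whose \<open>x\<close>-part is \<open>c = p + b \<circ> f\<^sub>u'(x)\<close> and whose \<open>u\<close>-part
  is \<open>- b(R(x))\<close>. So both smoothness of \<open>\<beta>\<^sup>-\<^sup>1(W)\<close> and the condition \<open>(w)\<close> follow from
  \<open>|x|\<^sup>r |b| \<le> |c|\<close> near \<open>0\<close>, uniformly for bounded \<open>u\<close>. If this estimate failed, it would fail at points
  \<open>x\<^sub>i \<rightarrow> 0\<close> with \<open>|x\<^sub>i\<^sub>+\<^sub>1| < |x\<^sub>i| / 4\<close>. Adding to \<open>h\<close> bumps of radius \<open>|x\<^sub>i| / 4\<close> around the \<open>x\<^sub>i\<close>, which move the
  value to \<open>f\<^sub>u(x\<^sub>i)\<close> and tilt the derivative by \<open>O(|x\<^sub>i|\<^sup>r)\<close>, gives a map with the same \<open>r\<close>-jet as \<open>h\<close> whose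
  graph is not transverse to \<open>W\<close> at any of these points. The same bumps without the tilt take care of \<open>S\<close>.
\<close>

section \<open>Calculus of functions of class \<open>C\<^sup>r\<close>\<close>

text \<open>The condition (t^r) concerns one map at a time and contains no estimate, so a
  quantitative bound can only be extracted by contradiction, from a single admissible map that fails
  at infinitely many points. Sparse points give the bumps disjoint supports, and a radius
  proportional to |x_i| makes them admissible: a bump of height O(|x_i|^(r+1)) and width of order
  |x_i| has k-th derivatives O(|x_i|^(r+1-k)), which tend to 0 for all k \<le> r. For r = 0 the
  first derivatives are merely bounded, but boundedness is o(1/|x|), which is what the jet of class
  C^(0,-1) allows.

  The exponent r in the estimate is matched to the order of R: up to a constant, |b(R(x))| \<le>
  |x|^(r+1) |b| \<le> |x| |c|, and this is the linear bound that (w) demands. To reach the distance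
  of subspaces, every normal vector of the pulled-back manifold must come from a pulled-back
  conormal covector. Tangent vectors are defined as velocities of curves, so the common kernel of
  the differentials has to be shown to consist of such velocities; this is where the inverse
  function theorem enters.\<close>

lemma Cr_on_0: "Cr_on 0 f U \<longleftrightarrow> continuous_on U f"
  by (auto simp: Cr_on_def)

text \<open>\<open>dir_deriv\<close> differentiates along the head of the list first, so splitting a
  list into head and tail removes the innermost derivative. The inductions on \<open>r\<close> below
  run on this recursion.\<close>

lemma Cr_on_Suc:
  "Cr_on (Suc r) f U \<longleftrightarrow> continuous_on U f \<and> (\<forall>x\<in>U. f differentiable at x) \<and>
     (\<forall>v. Cr_on r (\<lambda>x. frechet_derivative f (at x) v) U)"
proof -
  have split: "(\<forall>vs. P vs) \<longleftrightarrow> P [] \<and> (\<forall>v vs. P (v # vs))" for P :: "'z list \<Rightarrow> bool"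
    by (metis list.exhaust)
  show ?thesis
    unfolding Cr_on_def
    by (subst (1) split, subst (2) split) (simp, blast)
qed

lemma Cr_on_imp_continuous_on: "Cr_on r f U \<Longrightarrow> continuous_on U f"
  by (cases r) (auto simp: Cr_on_0 Cr_on_Suc)

lemma Cr_on_imp_has_derivative:
  "Cr_on (Suc r) f U \<Longrightarrow> x \<in> U \<Longrightarrow> (f has_derivative frechet_derivative f (at x)) (at x)"
  by (auto simp: Cr_on_Suc frechet_derivative_works[symmetric])

lemma Cr_on_le: "Cr_on s f U \<Longrightarrow> r \<le> s \<Longrightarrow> Cr_on r f U"
  unfolding Cr_on_def by auto

lemma Cr_on_subset: "Cr_on r f U \<Longrightarrow> V \<subseteq> U \<Longrightarrow> Cr_on r f V"
  unfolding Cr_on_def by (meson continuous_on_subset subsetD)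

text \<open>\<open>frechet_derivative\<close> is a choice from the derivative predicate. The two
  predicates coincide, hence so do the choices, even at points where no derivative exists.\<close>

lemma frechet_derivative_cong_open:
  assumes "open U" "x \<in> U" "\<And>y. y \<in> U \<Longrightarrow> f y = g y"
  shows "frechet_derivative f (at x) = frechet_derivative g (at x)"
proof -
  have "(f has_derivative D) (at x) \<longleftrightarrow> (g has_derivative D) (at x)" for D
    using has_derivative_transform_within_open[OF _ assms(1,2), of f D UNIV g]
      has_derivative_transform_within_open[OF _ assms(1,2), of g D UNIV f] assms(3) by auto
  then show ?thesis by (simp add: frechet_derivative_def)
qed

lemma dir_deriv_cong_open:
  assumes "open U" "x \<in> U" "\<And>y. y \<in> U \<Longrightarrow> f y = g y"
  shows "dir_deriv vs f x = dir_deriv vs g x"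
  using assms(3)
proof (induction vs arbitrary: f g)
  case Nil
  then show ?case using assms by simp
next
  case (Cons v vs)
  have "frechet_derivative f (at y) v = frechet_derivative g (at y) v" if "y \<in> U" for y
    by (rule fun_cong[OF frechet_derivative_cong_open[OF assms(1) that Cons.prems]])
  then show ?case
    unfolding dir_deriv.simps by (rule Cons.IH)
qed

lemma Cr_on_cong:
  assumes "open U" "\<And>y. y \<in> U \<Longrightarrow> f y = g y" "Cr_on r g U"
  shows "Cr_on r f U"
proof -
  have eq: "dir_deriv vs f x = dir_deriv vs g x" if "x \<in> U" for vs x
    by (rule dir_deriv_cong_open[OF assms(1) that assms(2)])
  have "dir_deriv vs f differentiable at x" if "x \<in> U" "dir_deriv vs g differentiable at x" for vs x
  proof -
    from that(2) obtain D where "(dir_deriv vs g has_derivative D) (at x)"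
      by (auto simp: differentiable_def)
    then have "(dir_deriv vs f has_derivative D) (at x)"
      by (rule has_derivative_transform_within_open[OF _ assms(1) that(1)]) (simp add: eq)
    then show ?thesis by (auto simp: differentiable_def)
  qed
  moreover have "continuous_on U (dir_deriv vs f) \<longleftrightarrow> continuous_on U (dir_deriv vs g)" for vs
    by (rule continuous_on_cong) (simp_all add: eq)
  ultimately show ?thesis
    using assms(3) unfolding Cr_on_def by blast
qed

lemma Cr_on_local:
  assumes "\<And>x. x \<in> U \<Longrightarrow> \<exists>V. open V \<and> x \<in> V \<and> Cr_on r f V"
  shows "Cr_on r f U"
  unfolding Cr_on_def
proof (intro conjI allI impI ballI)
  fix vs :: "'a list" assume l: "length vs \<le> r"
  show "continuous_on U (dir_deriv vs f)"
  proof (rule continuous_at_imp_continuous_on, rule ballI)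
    fix x assume "x \<in> U"
    then obtain V where "open V" "x \<in> V" "Cr_on r f V" using assms by blast
    then show "isCont (dir_deriv vs f) x"
      using l unfolding Cr_on_def by (auto simp: continuous_on_eq_continuous_at)
  qed
next
  fix vs :: "'a list" and x assume l: "length vs < r" and "x \<in> U"
  then obtain V where "x \<in> V" "Cr_on r f V" using assms by blast
  then show "dir_deriv vs f differentiable at x"
    using l unfolding Cr_on_def by auto
qed

lemma Cr_on_SucI:
  assumes "open U" "\<And>x. x \<in> U \<Longrightarrow> (f has_derivative f' x) (at x)"
    and "\<And>v. Cr_on r (\<lambda>x. f' x v) U"
  shows "Cr_on (Suc r) f U"
proof -
  have eq: "frechet_derivative f (at x) = f' x" if "x \<in> U" for x
    using assms(2)[OF that] by (rule frechet_derivative_at[symmetric])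
  have "Cr_on r (\<lambda>x. frechet_derivative f (at x) v) U" for v
    by (rule Cr_on_cong[OF assms(1) _ assms(3)[of v]]) (simp add: eq)
  moreover have "continuous_on U f"
    using assms(2) has_derivative_continuous
    by (intro continuous_at_imp_continuous_on) blast
  moreover have "\<forall>x\<in>U. f differentiable at x"
    using assms(2) by (auto simp: differentiable_def)
  ultimately show ?thesis by (simp add: Cr_on_Suc)
qed

lemma Cr_on_const: "Cr_on r (\<lambda>x. c) U"
proof (rule Cr_on_subset[of _ _ UNIV])
  show "Cr_on r (\<lambda>x. c) UNIV"
  proof (induction r arbitrary: c)
    case 0
    then show ?case by (simp add: Cr_on_0)
  next
    case (Suc r)
    show ?case by (rule Cr_on_SucI[where f'="\<lambda>_ _. 0"]) (auto intro: Suc)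
  qed
qed simp

lemma Cr_on_bounded_linear: "bounded_linear L \<Longrightarrow> Cr_on r L U"
proof (rule Cr_on_subset[of _ _ UNIV])
  assume L: "bounded_linear L"
  show "Cr_on r L UNIV"
  proof (cases r)
    case 0
    then show ?thesis using L by (simp add: Cr_on_0 linear_continuous_on)
  next
    case (Suc s)
    show ?thesis
      unfolding Suc
      by (rule Cr_on_SucI[where f' = "\<lambda>_. L"])
         (simp_all add: Cr_on_const bounded_linear_imp_has_derivative[OF L])
  qed
qed simp

lemma Cr_on_add:
  assumes "open U" "Cr_on r f U" "Cr_on r g U"
  shows "Cr_on r (\<lambda>x. f x + g x) U"
  using assms(2,3)
proof (induction r arbitrary: f g)
  case 0
  then show ?case unfolding Cr_on_0 by (rule continuous_on_add)
next
  case (Suc r)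
  show ?case
  proof (rule Cr_on_SucI[OF assms(1), where f' = "\<lambda>x v. frechet_derivative f (at x) v + frechet_derivative g (at x) v"])
    show "((\<lambda>x. f x + g x) has_derivative (\<lambda>v. frechet_derivative f (at x) v + frechet_derivative g (at x) v)) (at x)"
      if "x \<in> U" for x
      by (intro has_derivative_add Cr_on_imp_has_derivative; fact)
    show "Cr_on r (\<lambda>x. frechet_derivative f (at x) v + frechet_derivative g (at x) v) U" for v
      by (rule Suc.IH) (use Suc.prems in \<open>simp_all add: Cr_on_Suc\<close>)
  qed
qed

lemma Cr_on_sum:
  assumes "open U" "\<And>i. i \<in> I \<Longrightarrow> Cr_on r (f i) U"
  shows "Cr_on r (\<lambda>x. \<Sum>i\<in>I. f i x) U"
  using assms(2)
  by (induction I rule: infinite_finite_induct) (auto intro: Cr_on_const Cr_on_add[OF assms(1)])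

lemma Cr_on_bilinear:
  assumes "open U" "bounded_bilinear B" "Cr_on r f U" "Cr_on r g U"
  shows "Cr_on r (\<lambda>x. B (f x) (g x)) U"
  using assms(3,4)
proof (induction r arbitrary: f g)
  case 0
  then show ?case
    unfolding Cr_on_0 by (rule bounded_bilinear.continuous_on[OF assms(2)])
next
  case (Suc r)
  show ?case
  proof (rule Cr_on_SucI[OF assms(1)])
    fix x assume x: "x \<in> U"
    show "((\<lambda>x. B (f x) (g x)) has_derivative
        (\<lambda>v. B (f x) (frechet_derivative g (at x) v) + B (frechet_derivative f (at x) v) (g x))) (at x)"
      by (rule bounded_bilinear.FDERIV[OF assms(2)]; rule Cr_on_imp_has_derivative; fact)
  next
    fix v
    have "Cr_on r f U" "Cr_on r g U"
      by (rule Cr_on_le[OF Suc.prems(1)], simp, rule Cr_on_le[OF Suc.prems(2)], simp)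
    then show "Cr_on r (\<lambda>x. B (f x) (frechet_derivative g (at x) v) +
        B (frechet_derivative f (at x) v) (g x)) U"
      using Suc.prems by (intro Cr_on_add[OF assms(1)] Suc.IH) (auto simp: Cr_on_Suc)
  qed
qed

lemma Cr_on_linear_comp:
  assumes "open U" "bounded_linear L" "Cr_on r f U"
  shows "Cr_on r (\<lambda>x. L (f x)) U"
  using assms(3)
proof (induction r arbitrary: f)
  case 0
  then show ?case
    unfolding Cr_on_0 by (rule bounded_linear.continuous_on[OF assms(2)])
next
  case (Suc r)
  show ?case
  proof (rule Cr_on_SucI[OF assms(1), where f' = "\<lambda>x v. L (frechet_derivative f (at x) v)"])
    show "((\<lambda>x. L (f x)) has_derivative (\<lambda>v. L (frechet_derivative f (at x) v))) (at x)"
      if "x \<in> U" for x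
      using bounded_linear.has_derivative[OF assms(2) Cr_on_imp_has_derivative[OF Suc.prems that]] .
    show "Cr_on r (\<lambda>x. L (frechet_derivative f (at x) v)) U" for v
      by (rule Suc.IH) (use Suc.prems in \<open>simp add: Cr_on_Suc\<close>)
  qed
qed

lemma bounded_linear_sum_Basis:
  fixes L :: "'b::euclidean_space \<Rightarrow> 'c::real_normed_vector"
  assumes "bounded_linear L"
  shows "L v = (\<Sum>b\<in>Basis. (v \<bullet> b) *\<^sub>R L b)"
proof -
  interpret bounded_linear L by fact
  have "L v = L (\<Sum>b\<in>Basis. (v \<bullet> b) *\<^sub>R b)" by (simp add: euclidean_representation)
  also have "\<dots> = (\<Sum>b\<in>Basis. (v \<bullet> b) *\<^sub>R L b)" by (simp add: sum scaleR)
  finally show ?thesis .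
qed

text \<open>The chain rule produces a direction that varies with \<open>x\<close>, while the
  induction hypothesis concerns derivatives of \<open>g\<close> in fixed directions. Expanding the
  direction in the standard basis gives a finite sum of products: a coordinate of the derivative of
  \<open>f\<close> times a derivative of \<open>g\<close> along a basis vector.\<close>

lemma Cr_on_compose:
  fixes g :: "'b::euclidean_space \<Rightarrow> 'c::euclidean_space"
    and f :: "'a::euclidean_space \<Rightarrow> 'b"
  assumes "open U" "open V" "Cr_on r f U" "Cr_on r g V" "f ` U \<subseteq> V"
  shows "Cr_on r (\<lambda>x. g (f x)) U"
  using assms(3,4)
proof (induction r arbitrary: g)
  case 0
  then show ?case
    unfolding Cr_on_0 using continuous_on_compose2[OF _ _ assms(5)] by blast
next
  case (Suc r)
  show ?case
  proof (rule Cr_on_SucI[OF assms(1)])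
    fix x assume x: "x \<in> U"
    have gd: "(g has_derivative frechet_derivative g (at (f x))) (at (f x))"
      using Suc.prems x assms(5) by (intro Cr_on_imp_has_derivative) auto
    then have bl: "bounded_linear (frechet_derivative g (at (f x)))"
      by (rule has_derivative_bounded_linear)
    have "((\<lambda>x. g (f x)) has_derivative
        (\<lambda>v. frechet_derivative g (at (f x)) (frechet_derivative f (at x) v))) (at x)"
      using has_derivative_compose[OF Cr_on_imp_has_derivative[OF Suc.prems(1) x] gd] .
    moreover have "frechet_derivative g (at (f x)) (frechet_derivative f (at x) v) =
      (\<Sum>b\<in>Basis. (frechet_derivative f (at x) v \<bullet> b) *\<^sub>R frechet_derivative g (at (f x)) b)" for v
      by (rule bounded_linear_sum_Basis[OF bl])
    ultimately show "((\<lambda>x. g (f x)) has_derivative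
      (\<lambda>v. \<Sum>b\<in>Basis. (frechet_derivative f (at x) v \<bullet> b) *\<^sub>R frechet_derivative g (at (f x)) b)) (at x)"
      by simp
  next
    fix v
    have f: "Cr_on r f U"
      by (rule Cr_on_le[OF Suc.prems(1)]) simp
    show "Cr_on r (\<lambda>x. \<Sum>b\<in>Basis. (frechet_derivative f (at x) v \<bullet> b) *\<^sub>R frechet_derivative g (at (f x)) b) U"
    proof (rule Cr_on_sum[OF assms(1)], rule Cr_on_bilinear[OF assms(1) bounded_bilinear_scaleR])
      fix b :: 'b
      show "Cr_on r (\<lambda>x. frechet_derivative f (at x) v \<bullet> b) U"
        by (rule Cr_on_linear_comp[OF assms(1) bounded_linear_inner_left])
           (use Suc.prems in \<open>auto simp: Cr_on_Suc\<close>)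
      show "Cr_on r (\<lambda>x. frechet_derivative g (at (f x)) b) U"
        by (rule Suc.IH[OF f]) (use Suc.prems in \<open>auto simp: Cr_on_Suc\<close>)
    qed
  qed
qed

section \<open>Iterated derivatives of sums, and extension across a flat point\<close>

lemma dir_deriv_const: "dir_deriv vs (\<lambda>x. 0) (x :: 'b::real_normed_vector) = 0"
proof (induction vs)
  case (Cons v vs)
  have "frechet_derivative (\<lambda>x. 0) (at y) v = 0" for y :: 'b
    by (rule fun_cong[OF frechet_derivative_at[OF has_derivative_const, symmetric]])
  with Cons show ?case by simp
qed simp

lemma dir_deriv_add:
  assumes "open U" "x \<in> U" "Cr_on r f U" "Cr_on r g U" "length vs \<le> r"
  shows "dir_deriv vs (\<lambda>y. f y + g y) x = dir_deriv vs f x + dir_deriv vs g x"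
  using assms(3-5)
proof (induction vs arbitrary: f g r)
  case Nil
  then show ?case by simp
next
  case (Cons v vs)
  then obtain s where s: "r = Suc s" by (cases r) auto
  have "dir_deriv (v # vs) (\<lambda>y. f y + g y) x =
     dir_deriv vs (\<lambda>y. frechet_derivative f (at y) v + frechet_derivative g (at y) v) x"
    unfolding dir_deriv.simps
  proof (rule dir_deriv_cong_open[OF assms(1,2)])
    fix y assume "y \<in> U"
    then have "((\<lambda>y. f y + g y) has_derivative (\<lambda>v. frechet_derivative f (at y) v + frechet_derivative g (at y) v)) (at y)"
      using Cons.prems unfolding s by (intro has_derivative_add Cr_on_imp_has_derivative)
    then show "frechet_derivative (\<lambda>y. f y + g y) (at y) v = frechet_derivative f (at y) v + frechet_derivative g (at y) v"
      by (rule fun_cong[OF frechet_derivative_at[symmetric]])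
  qed
  also have "\<dots> = dir_deriv (v # vs) f x + dir_deriv (v # vs) g x"
    unfolding dir_deriv.simps
    by (rule Cons.IH[where r=s]) (use Cons.prems s in \<open>auto simp: Cr_on_Suc\<close>)
  finally show ?case .
qed

lemma dir_deriv_sum:
  assumes "open U" "x \<in> U" "\<And>i. i \<in> I \<Longrightarrow> Cr_on r (f i) U" "length vs \<le> r"
  shows "dir_deriv vs (\<lambda>y. \<Sum>i\<in>I. f i y) x = (\<Sum>i\<in>I. dir_deriv vs (f i) x)"
  using assms(3)
proof (induction I rule: infinite_finite_induct)
  case (insert i I)
  have "dir_deriv vs (\<lambda>y. f i y + (\<Sum>i\<in>I. f i y)) x = dir_deriv vs (f i) x + dir_deriv vs (\<lambda>y. \<Sum>i\<in>I. f i y) x"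
    by (rule dir_deriv_add[OF assms(1,2) _ _ assms(4)]) (use insert in \<open>auto intro: Cr_on_sum[OF assms(1)]\<close>)
  with insert show ?case by simp
qed (simp_all add: dir_deriv_const)

text \<open>The exponent \<open>Suc r - length vs\<close> is at least 1 for
  \<open>length vs \<le> r\<close>, so every derivative up to order \<open>r\<close> tends to 0 at
  the origin. The induction passes to the first derivatives, where the number of derivatives and the
  exponent both drop by one.\<close>

lemma flat_extension:
  fixes P :: "'b::euclidean_space \<Rightarrow> 'c::euclidean_space"
  assumes "open U" "0 \<in> U" "Cr_on r P (U - {0})" "P 0 = 0"
    and "\<And>vs. length vs \<le> r \<Longrightarrow> \<exists>K. \<forall>x\<in>U - {0}. norm (dir_deriv vs P x) \<le> K * norm x ^ (Suc r - length vs)"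
  shows "Cr_on r P U \<and> (\<forall>vs. length vs \<le> r \<longrightarrow> dir_deriv vs P 0 = 0)"
  using assms(3-5)
proof (induction r arbitrary: P)
  case 0
  from 0(3)[of "[]"] obtain K where K: "\<forall>x\<in>U - {0}. norm (P x) \<le> K * norm x" by auto
  have "isCont P x" if "x \<in> U" for x
  proof (cases "x = 0")
    case True
    have "((\<lambda>x. K * norm x) \<longlongrightarrow> 0) (at (0::'b))"
      by (intro tendsto_mult_right_zero tendsto_norm_zero tendsto_ident_at)
    moreover have "eventually (\<lambda>x. norm (P x) \<le> K * norm x) (at 0)"
      using K that True assms(1) unfolding eventually_at_topological by blast
    ultimately have "(P \<longlongrightarrow> 0) (at 0)"
      by (rule Lim_null_comparison[rotated])
    then show ?thesis using True 0 by (simp add: isCont_def)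
  next
    case False
    then show ?thesis
      using 0(1) that continuous_on_eq_continuous_at[OF open_delete[OF assms(1)], of 0 P]
      by (auto simp: Cr_on_0)
  qed
  then show ?case using 0 by (auto simp: Cr_on_0 intro: continuous_at_imp_continuous_on)
next
  case (Suc r)
  from Suc.prems(3)[of "[]"] obtain K where K: "\<forall>x\<in>U - {0}. norm (P x) \<le> K * norm x ^ (Suc (Suc r))" by auto
  \<comment> \<open>An exponent of at least 2 forces the difference quotient at the origin to tend
    to 0.\<close>
  have der0: "(P has_derivative (\<lambda>v. 0)) (at 0)"
    unfolding has_derivative_at
  proof (intro conjI)
    show "((\<lambda>h. norm (P (0 + h) - P 0 - 0) / norm h) \<longlongrightarrow> 0) (at 0)"
    proof (rule Lim_null_comparison)
      show "\<forall>\<^sub>F h in at 0. norm (norm (P (0 + h) - P 0 - 0) / norm h) \<le> K * norm h ^ Suc r"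
        unfolding eventually_at_topological
      proof (intro exI conjI ballI impI)
        show "open U" by fact
        show "0 \<in> U" by fact
        fix h :: 'b assume "h \<in> U" "h \<noteq> 0"
        then show "norm (norm (P (0 + h) - P 0 - 0) / norm h) \<le> K * norm h ^ Suc r"
          using K Suc.prems(2) by (auto simp: field_simps)
      qed
      have "((\<lambda>h. norm h ^ Suc r) \<longlongrightarrow> 0) (at (0::'b))"
        using tendsto_power[OF tendsto_norm_zero[OF tendsto_ident_at], of "Suc r"] by simp
      then show "((\<lambda>h. K * norm h ^ Suc r) \<longlongrightarrow> 0) (at (0::'b))"
        by (rule tendsto_mult_right_zero)
    qed
  qed (rule bounded_linear_zero)
  have op: "open (U - {0})" using assms(1) by auto
  \<comment> \<open>The value at the origin is set to 0 so that the induction hypothesis applies;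
    \<open>der0\<close> confirms that this is the true derivative there.\<close>
  let ?D = "\<lambda>v x. if x = 0 then 0 else frechet_derivative P (at x) v"
  have D: "Cr_on r (?D v) U \<and> (\<forall>vs. length vs \<le> r \<longrightarrow> dir_deriv vs (?D v) 0 = 0)" for v
  proof (rule Suc.IH)
    show "Cr_on r (?D v) (U - {0})"
      by (rule Cr_on_cong[OF op, of _ "\<lambda>x. frechet_derivative P (at x) v"]) (use Suc.prems in \<open>auto simp: Cr_on_Suc\<close>)
    show "?D v 0 = 0" by simp
    fix vs :: "'b list" assume "length vs \<le> r"
    then obtain K where K: "\<forall>x\<in>U - {0}. norm (dir_deriv (v # vs) P x) \<le> K * norm x ^ (Suc r - length vs)"
      using Suc.prems(3)[of "v # vs"] by auto
    have "dir_deriv vs (?D v) x = dir_deriv (v # vs) P x" if "x \<in> U - {0}" for x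
      unfolding dir_deriv.simps by (rule dir_deriv_cong_open[OF op that]) auto
    with K show "\<exists>K. \<forall>x\<in>U - {0}. norm (dir_deriv vs (?D v) x) \<le> K * norm x ^ (Suc r - length vs)"
      by (intro exI[of _ K]) simp
  qed
  have der: "(P has_derivative (\<lambda>v. ?D v x)) (at x)" if "x \<in> U" for x
  proof (cases "x = 0")
    case True
    then show ?thesis using der0 by simp
  next
    case False
    then show ?thesis using Cr_on_imp_has_derivative[OF Suc.prems(1), of x] that by auto
  qed
  have "dir_deriv vs P 0 = 0" if "length vs \<le> Suc r" for vs
  proof (cases vs)
    case Nil
    then show ?thesis using Suc.prems(2) by simp
  next
    case (Cons v ws)
    have "dir_deriv vs P 0 = dir_deriv ws (?D v) 0"
      unfolding Cons dir_deriv.simps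
    proof (rule dir_deriv_cong_open[OF assms(1,2)])
      fix y assume "y \<in> U"
      then show "frechet_derivative P (at y) v = ?D v y"
        using fun_cong[OF frechet_derivative_at[OF der], of y v] by simp
    qed
    then show ?thesis using D that Cons by auto
  qed
  moreover have "Cr_on (Suc r) P U"
    by (rule Cr_on_SucI[OF assms(1) der]) (use D in auto)
  ultimately show ?case by blast
qed

section \<open>Power series in several variables\<close>

lemma norm_vector_smult:
  fixes v :: "'a::{real_normed_field,euclidean_space}^'m"
  shows "norm (a *s v) = norm a * norm v"
  by (simp add: norm_vec_def norm_mult L2_set_right_distrib)

lemma bounded_bilinear_vector_smult:
  "bounded_bilinear ((*s) :: 'a::{real_normed_field,euclidean_space} \<Rightarrow> 'a^'m \<Rightarrow> 'a^'m)"
  by (rule bounded_bilinear.intro)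
     (auto simp: vec_eq_iff algebra_simps norm_vector_smult intro!: exI[of _ 1])

definition monomial :: "('n::finite \<Rightarrow> nat) \<Rightarrow> 'a::comm_ring_1^'n \<Rightarrow> 'a" where
  "monomial a x = (\<Prod>i\<in>UNIV. x $ i ^ a i)"

text \<open>If \<open>a i = 0\<close>, the truncated subtraction leaves the exponent unchanged. This
  is harmless because a differentiated monomial always carries the factor
  \<open>a i\<close>.\<close>

definition lower :: "'n \<Rightarrow> ('n \<Rightarrow> nat) \<Rightarrow> 'n \<Rightarrow> nat" where
  "lower i a = a(i := a i - 1)"

lemma norm_monomial:
  "norm (monomial a x) = (\<Prod>i\<in>UNIV. norm (x $ i) ^ a i)"
  for x :: "'a::{real_normed_field,euclidean_space}^'n"
  by (simp add: monomial_def norm_power flip: prod_norm)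

lemma prod_lower:
  fixes b :: "'n::finite \<Rightarrow> 'b::comm_ring_1"
  shows "(\<Prod>j\<in>UNIV. b j ^ lower i a j) = b i ^ (a i - 1) * (\<Prod>j\<in>UNIV - {i}. b j ^ a j)"
  by (subst prod.remove[of _ i]) (auto simp: lower_def intro!: prod.cong)

lemma has_derivative_monomial:
  fixes x :: "'a::{real_normed_field,euclidean_space}^'n"
  shows "(monomial a has_derivative (\<lambda>v. \<Sum>i\<in>UNIV. v $ i * (of_nat (a i) * monomial (lower i a) x))) (at x)"
proof -
  have "((\<lambda>x::'a^'n. \<Prod>i\<in>UNIV. x $ i ^ a i) has_derivative
     (\<lambda>v. \<Sum>i\<in>UNIV. (of_nat (a i) * v $ i * x $ i ^ (a i - 1)) * (\<Prod>j\<in>UNIV - {i}. x $ j ^ a j))) (at x)"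
    by (rule has_derivative_prod, rule has_derivative_power,
        rule bounded_linear.has_derivative[OF bounded_linear_vec_nth has_derivative_ident])
  then show ?thesis
    unfolding monomial_def prod_lower by (simp add: mult_ac)
qed

text \<open>The left side is the term linear in \<open>d\<close> of the binomial expansion. In place
  of a Cauchy estimate, it dominates a differentiated monomial by the monomial itself at a slightly
  larger point.\<close>

lemma power_slope_le:
  fixes b d :: real
  assumes "0 \<le> b" "0 \<le> d"
  shows "real n * b ^ (n - 1) * d \<le> (b + d) ^ n"
proof (induction n)
  case (Suc n)
  have "real (Suc n) * b ^ n * d = (real n * b ^ (n - 1) * d) * b + b ^ n * d"
    by (cases n) (auto simp: algebra_simps)
  also have "\<dots> \<le> (b + d) ^ n * b + (b + d) ^ n * d"
    using assms by (intro add_mono mult_right_mono Suc.IH power_mono) auto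
  finally show ?case by (simp add: algebra_simps)
qed simp

lemma prod_lower_le:
  fixes b :: "'n::finite \<Rightarrow> real"
  assumes "\<And>j. 0 \<le> b j" "0 \<le> d"
  shows "real (a i) * (\<Prod>j\<in>UNIV. b j ^ lower i a j) * d \<le> (\<Prod>j\<in>UNIV. (b j + d) ^ a j)"
proof -
  have "real (a i) * (\<Prod>j\<in>UNIV. b j ^ lower i a j) * d
      = (real (a i) * b i ^ (a i - 1) * d) * (\<Prod>j\<in>UNIV - {i}. b j ^ a j)"
    by (simp add: prod_lower mult_ac)
  also have "\<dots> \<le> (b i + d) ^ a i * (\<Prod>j\<in>UNIV - {i}. (b j + d) ^ a j)"
    using assms by (intro mult_mono power_slope_le prod_mono conjI power_mono prod_nonneg) auto
  also have "\<dots> = (\<Prod>j\<in>UNIV. (b j + d) ^ a j)"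
    by (subst (2) prod.remove[of _ i]) auto
  finally show ?thesis .
qed

section \<open>Convergent power series and termwise differentiation\<close>

definition has_series ::
  "(nat \<Rightarrow> 'n::finite \<Rightarrow> nat) \<Rightarrow> (nat \<Rightarrow> 'a::{real_normed_field,euclidean_space}^'m) \<Rightarrow> real
    \<Rightarrow> ('a^'n \<Rightarrow> 'a^'m) \<Rightarrow> bool" where
  "has_series \<alpha> c \<epsilon> f \<longleftrightarrow> (\<forall>x\<in>ball 0 \<epsilon>.
     summable (\<lambda>n. norm (monomial (\<alpha> n) x) * norm (c n)) \<and> f x = (\<Sum>n. monomial (\<alpha> n) x *s c n))"

lemma has_series_summable:
  fixes f :: "'a::{real_normed_field,euclidean_space}^'n \<Rightarrow> 'a^'m" and x :: "'a^'n"
  shows "has_series \<alpha> c \<epsilon> f \<Longrightarrow> norm x < \<epsilon> \<Longrightarrow> summable (\<lambda>n. norm (monomial (\<alpha> n) x) * norm (c n))"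
  by (auto simp: has_series_def)

lemma has_series_eq:
  fixes f :: "'a::{real_normed_field,euclidean_space}^'n \<Rightarrow> 'a^'m" and x :: "'a^'n"
  shows "has_series \<alpha> c \<epsilon> f \<Longrightarrow> norm x < \<epsilon> \<Longrightarrow> f x = (\<Sum>n. monomial (\<alpha> n) x *s c n)"
  by (auto simp: has_series_def)

definition partial_series ::
  "(nat \<Rightarrow> 'n::finite \<Rightarrow> nat) \<Rightarrow> (nat \<Rightarrow> 'a::{real_normed_field,euclidean_space}^'m) \<Rightarrow> 'n
    \<Rightarrow> 'a^'n \<Rightarrow> 'a^'m" where
  "partial_series \<alpha> c i x = (\<Sum>n. monomial (lower i (\<alpha> n)) x *s (real (\<alpha> n i) *\<^sub>R c n))"

text \<open>\<open>has_sum\<close> is unconditional convergence, which for real families is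
  absolute. Coordinates carry this over to vectors, because the norm is at most the sum of the
  absolute coordinates.\<close>

lemma analytic_germ_has_series:
  fixes f :: "'a::{real_normed_field,euclidean_space}^'n \<Rightarrow> 'a^'m"
  assumes "analytic_germ f"
  obtains \<alpha> c \<epsilon> where "\<epsilon> > 0" "has_series \<alpha> c \<epsilon> f"
proof -
  from assms obtain c0 \<epsilon> where \<epsilon>: "\<epsilon> > 0"
    and S: "\<And>x. x \<in> ball 0 \<epsilon> \<Longrightarrow> ((\<lambda>\<alpha>. monomial \<alpha> x *s c0 \<alpha>) has_sum f x) UNIV"
    unfolding analytic_germ_def monomial_def by blast
  \<comment> \<open>The constant exponent vectors already form an infinite set, so the enumeration
    \<open>e\<close> is a bijection.\<close>
  have "inj (\<lambda>k::nat. \<lambda>_::'n. k)" by (auto simp: inj_on_def fun_eq_iff)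
  then have inf: "infinite (UNIV :: ('n \<Rightarrow> nat) set)"
    using infinite_iff_countable_subset by blast
  define e where "e = from_nat_into (UNIV :: ('n \<Rightarrow> nat) set)"
  have e: "bij_betw e UNIV UNIV"
    unfolding e_def by (rule bij_betw_from_nat_into) (auto simp: inf)
  have "has_series e (\<lambda>n. c0 (e n)) \<epsilon> f"
    unfolding has_series_def
  proof (intro ballI conjI)
    fix x :: "'a^'n" assume x: "x \<in> ball 0 \<epsilon>"
    let ?t = "\<lambda>n. monomial (e n) x *s c0 (e n)"
    have hs: "(?t has_sum f x) UNIV"
      using has_sum_reindex_bij_betw[OF e, of "\<lambda>\<alpha>. monomial \<alpha> x *s c0 \<alpha>"] S[OF x] by simp
    then show "f x = suminf ?t"
      using has_sum_imp_sums sums_unique by blast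
    have "summable (\<lambda>n. \<bar>?t n \<bullet> b\<bar>)" for b
    proof -
      have "(\<lambda>n. ?t n \<bullet> b) summable_on UNIV"
        using has_sum_bounded_linear[OF bounded_linear_inner_left hs, of b]
        unfolding summable_on_def o_def by blast
      then have "(\<lambda>n. norm (?t n \<bullet> b)) summable_on UNIV"
        by (rule summable_on_iff_abs_summable_on_real[THEN iffD1])
      then show ?thesis using summable_on_imp_summable by (simp only: real_norm_def)
    qed
    then have "summable (\<lambda>n. \<Sum>b\<in>Basis. \<bar>?t n \<bullet> b\<bar>)" by (intro summable_sum)
    then have "summable (\<lambda>n. norm (?t n))"
      by (rule summable_comparison_test[rotated]) (auto intro: norm_le_l1)
    then show "summable (\<lambda>n. norm (monomial (e n) x) * norm (c0 (e n)))"
      by (simp add: norm_vector_smult)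
  qed
  with \<epsilon> that show ?thesis by blast
qed

text \<open>All terms of the differentiated series are compared with the series at one point
  \<open>X\<close>, whose coordinates exceed those of \<open>x0\<close> in norm by
  \<open>2 * d\<close>: one \<open>d\<close> covers the ball around \<open>x0\<close>, the other
  pays for the derivative.\<close>

lemma series_majorant:
  fixes x0 :: "'a::{real_normed_field,euclidean_space}^'n"
    and f :: "'a^'n \<Rightarrow> 'a^'m"
  assumes "has_series \<alpha> c \<epsilon> f" "x0 \<in> ball 0 \<epsilon>"
  obtains d M where "d > 0" "ball x0 d \<subseteq> ball 0 \<epsilon>" "summable M"
    "\<And>i n x. x \<in> ball x0 d \<Longrightarrow> norm (monomial (lower i (\<alpha> n)) x) * (real (\<alpha> n i) * norm (c n)) \<le> M n"
proof -
  define N where "N = norm ((\<chi> i. 1) :: 'a^'n)"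
  \<comment> \<open>As \<open>N\<close> is the norm of the all-ones vector,
    \<open>norm X \<le> norm x0 + 2 * d * N\<close>. The 2 in \<open>N + 2\<close> leaves a margin
    of \<open>4 * d\<close> below \<open>\<epsilon>\<close>, which also keeps the ball
    inside.\<close>
  define d where "d = (\<epsilon> - norm x0) / (2 * (N + 2))"
  have N: "N \<ge> 0" by (simp add: N_def)
  have x0: "norm x0 < \<epsilon>" using assms(2) by simp
  then have d: "d > 0" using N by (simp add: d_def)
  have "d * (2 * (N + 2)) = \<epsilon> - norm x0"
    unfolding d_def using N by (intro nonzero_eq_divide_eq[THEN iffD1]) auto
  then have dN: "2 * d * (N + 2) = \<epsilon> - norm x0" by (simp add: mult_ac)
  define X :: "'a^'n" where "X = (\<chi> i. of_real (norm (x0 $ i) + 2 * d))"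
  have "X = (\<chi> i. of_real (norm (x0 $ i))) + (2 * d) *\<^sub>R (\<chi> i. 1)"
    by (simp add: X_def vec_eq_iff scaleR_conv_of_real[where 'a='a])
  then have "norm X \<le> norm (\<chi> i. of_real (norm (x0 $ i)) :: 'a^'n) + (2 * d) * N"
    using norm_triangle_ineq[of "\<chi> i. of_real (norm (x0 $ i)) :: 'a^'n" "(2 * d) *\<^sub>R (\<chi> i. 1)"] d
    by (simp add: N_def)
  moreover have "norm (\<chi> i. of_real (norm (x0 $ i)) :: 'a^'n) = norm x0"
    by (simp add: norm_vec_def)
  moreover have "2 * d * (N + 2) = 2 * d * N + 4 * d" by (simp add: algebra_simps)
  ultimately have X: "norm X < \<epsilon>" using dN d by linarith
  define M where "M = (\<lambda>n. norm (monomial (\<alpha> n) X) * norm (c n) / d)"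
  have "d * N \<ge> 0" using d N by simp
  then have dlt: "d < \<epsilon> - norm x0" using dN d by (simp add: algebra_simps)
  show ?thesis
  proof
    show "d > 0" by fact
    show "ball x0 d \<subseteq> ball 0 \<epsilon>"
    proof
      fix y assume "y \<in> ball x0 d"
      then have "norm (y - x0) < d" by (simp add: dist_norm norm_minus_commute)
      then show "y \<in> ball 0 \<epsilon>" using norm_triangle_sub[of y x0] dlt by simp
    qed
    show "summable M"
      unfolding M_def by (rule summable_divide[OF has_series_summable[OF assms(1) X]])
    fix i n and x :: "'a^'n"
    assume x: "x \<in> ball x0 d"
    have le: "norm (x $ j) \<le> norm (x0 $ j) + d" for j
    proof -
      have "norm ((x - x0) $ j) \<le> norm (x - x0)" by (rule Finite_Cartesian_Product.norm_nth_le)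
      with x show ?thesis
        using norm_triangle_sub[of "x $ j" "x0 $ j"] by (simp add: dist_norm norm_minus_commute)
    qed
    have "norm (monomial (lower i (\<alpha> n)) x) * real (\<alpha> n i) * d
        \<le> real (\<alpha> n i) * (\<Prod>j\<in>UNIV. (norm (x0 $ j) + d) ^ lower i (\<alpha> n) j) * d"
      unfolding norm_monomial using le d
      by (simp add: mult.commute, intro mult_left_mono prod_mono conjI power_mono) auto
    also have "\<dots> \<le> (\<Prod>j\<in>UNIV. ((norm (x0 $ j) + d) + d) ^ \<alpha> n j)"
      using d by (intro prod_lower_le) auto
    also have "\<dots> = norm (monomial (\<alpha> n) X)"
      unfolding norm_monomial using d by (simp add: X_def algebra_simps del: of_real_add of_real_mult)
    finally have "norm (monomial (lower i (\<alpha> n)) x) * real (\<alpha> n i) * d * norm (c n) \<le> norm (monomial (\<alpha> n) X) * norm (c n)"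
      by (rule mult_right_mono) simp
    then show "norm (monomial (lower i (\<alpha> n)) x) * (real (\<alpha> n i) * norm (c n)) \<le> M n"
      using d by (simp add: M_def field_simps)
  qed
qed

text \<open>Lowering is not injective on exponents, so distinct indices may now carry the same
  monomial. \<open>has_series\<close> admits repetitions and is therefore closed under partial
  derivatives without regrouping.\<close>

lemma has_series_partial:
  fixes f :: "'a::{real_normed_field,euclidean_space}^'n \<Rightarrow> 'a^'m"
  assumes "has_series \<alpha> c \<epsilon> f"
  shows "has_series (\<lambda>n. lower i (\<alpha> n)) (\<lambda>n. real (\<alpha> n i) *\<^sub>R c n) \<epsilon> (partial_series \<alpha> c i)"
  unfolding has_series_def
proof (intro ballI conjI)
  fix x :: "'a^'n"
  assume "x \<in> ball 0 \<epsilon>"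
  then obtain d M where "d > 0" "summable M"
    and M: "\<And>i n y. y \<in> ball x d \<Longrightarrow> norm (monomial (lower i (\<alpha> n)) y) * (real (\<alpha> n i) * norm (c n)) \<le> M n"
    using series_majorant[OF assms] by metis
  then show "summable (\<lambda>n. norm (monomial (lower i (\<alpha> n)) x) * norm (real (\<alpha> n i) *\<^sub>R c n))"
    by (intro summable_comparison_test[OF _ \<open>summable M\<close>]) auto
qed (simp add: partial_series_def)

text \<open>The summable majorant bounds the differentiated terms on a whole ball, so their series
  converge uniformly there and term-by-term differentiation is justified.\<close>

lemma has_series_has_derivative:
  fixes f :: "'a::{real_normed_field,euclidean_space}^'n \<Rightarrow> 'a^'m"
  assumes "has_series \<alpha> c \<epsilon> f" "x0 \<in> ball 0 \<epsilon>"
  shows "(f has_derivative (\<lambda>v. \<Sum>i\<in>UNIV. v $ i *s partial_series \<alpha> c i x0)) (at x0)"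
proof -
  obtain d M where d: "d > 0" and sub: "ball x0 d \<subseteq> ball 0 \<epsilon>" and sM: "summable M"
    and M: "\<And>i n y. y \<in> ball x0 d \<Longrightarrow> norm (monomial (lower i (\<alpha> n)) y) * (real (\<alpha> n i) * norm (c n)) \<le> M n"
    using series_majorant[OF assms] by metis
  let ?p = "\<lambda>i n x. monomial (lower i (\<alpha> n)) x *s (real (\<alpha> n i) *\<^sub>R c n)"
  let ?f' = "\<lambda>n x v. \<Sum>i\<in>UNIV. v $ i *s ?p i n x"
  let ?g' = "\<lambda>x v. \<Sum>i\<in>UNIV. v $ i *s partial_series \<alpha> c i x"
  define T where "T = (\<lambda>n. \<Sum>k. M (k + n))"
  have T: "T \<longlonglongrightarrow> 0" unfolding T_def by (rule suminf_exist_split2[OF sM])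
  have pM: "norm (?p i n x) \<le> M n" if "x \<in> ball x0 d" for i n x
    using M[OF that, of i n] by (simp add: norm_vector_smult)
  have sp: "summable (\<lambda>n. ?p i n x)" if "x \<in> ball x0 d" for i x
    by (rule summable_comparison_test[OF _ sM]) (use pM that in auto)
  have tail: "norm ((\<Sum>j<n. ?p i j x) - partial_series \<alpha> c i x) \<le> T n" if x: "x \<in> ball x0 d" for i n x
  proof -
    have "(\<Sum>j<n. ?p i j x) - partial_series \<alpha> c i x = - (\<Sum>k. ?p i (k + n) x)"
      unfolding partial_series_def using suminf_minus_initial_segment[OF sp[OF x], of i n] by simp
    moreover have "norm (\<Sum>k. ?p i (k + n) x) \<le> T n"
      unfolding T_def using sM pM[OF x] by (intro norm_suminf_le) (auto simp: summable_iff_shift)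
    ultimately show ?thesis by simp
  qed
  have "\<exists>g. \<forall>x\<in>ball x0 d. (\<lambda>n. monomial (\<alpha> n) x *s c n) sums g x \<and>
      (g has_derivative ?g' x) (at x within ball x0 d)"
  proof (rule has_derivative_series[where x = x0])
    fix n x
    have "((\<lambda>x. monomial (\<alpha> n) x *s c n) has_derivative
       (\<lambda>v. (\<Sum>i\<in>UNIV. v $ i * (of_nat (\<alpha> n i) * monomial (lower i (\<alpha> n)) x)) *s c n)) (at x)"
      by (rule bounded_linear.has_derivative[OF bounded_bilinear.bounded_linear_left[OF bounded_bilinear_vector_smult] has_derivative_monomial])
    moreover have "(\<Sum>i\<in>UNIV. v $ i * (of_nat (\<alpha> n i) * monomial (lower i (\<alpha> n)) x)) *s c n = ?f' n x v" for v
      by (simp add: vec_eq_iff sum_distrib_left sum_distrib_right scaleR_conv_of_real[where 'a='a] mult_ac)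
    ultimately have "((\<lambda>x. monomial (\<alpha> n) x *s c n) has_derivative ?f' n x) (at x)"
      by (simp only:)
    then show "((\<lambda>x. monomial (\<alpha> n) x *s c n) has_derivative ?f' n x) (at x within ball x0 d)"
      by (rule has_derivative_at_withinI)
  next
    fix e :: real assume e: "e > 0"
    \<comment> \<open>Each of the \<open>CARD('n)\<close> partial derivatives gets an equal share of
      the error \<open>e\<close>.\<close>
    define C where "C = real CARD('n)"
    have C: "C > 0" by (simp add: C_def)
    have "\<forall>\<^sub>F n in sequentially. T n < e / C"
      using order_tendstoD(2)[OF T, of "e / C"] e C by simp
    then show "\<forall>\<^sub>F n in sequentially. \<forall>x\<in>ball x0 d. \<forall>h. norm (sum (\<lambda>i. ?f' i x h) {..<n} - ?g' x h) \<le> e * norm h"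
    proof (rule eventually_mono, intro ballI allI)
      fix n x and h :: "'a^'n" assume n: "T n < e / C" and x: "x \<in> ball x0 d"
      have "sum (\<lambda>j. ?f' j x h) {..<n} - ?g' x h = (\<Sum>i\<in>UNIV. h $ i *s ((\<Sum>j<n. ?p i j x) - partial_series \<alpha> c i x))"
        by (subst sum.swap) (simp add: vec_eq_iff algebra_simps sum_subtractf sum_distrib_left)
      also have "norm \<dots> \<le> (\<Sum>i\<in>(UNIV::'n set). norm h * (e / C))"
      proof (rule sum_norm_le)
        fix i
        have "norm (h $ i *s ((\<Sum>j<n. ?p i j x) - partial_series \<alpha> c i x))
            = norm (h $ i) * norm ((\<Sum>j<n. ?p i j x) - partial_series \<alpha> c i x)"
          by (simp only: norm_vector_smult)
        also have "\<dots> \<le> norm h * (e / C)"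
          using tail[OF x, where i=i and n=n] n by (intro mult_mono Finite_Cartesian_Product.norm_nth_le) auto
        finally show "norm (h $ i *s ((\<Sum>j<n. ?p i j x) - partial_series \<alpha> c i x)) \<le> norm h * (e / C)" .
      qed
      also have "\<dots> = e * norm h" using C by (simp add: C_def)
      finally show "norm (sum (\<lambda>j. ?f' j x h) {..<n} - ?g' x h) \<le> e * norm h" .
    qed
  next
    show "x0 \<in> ball x0 d" using d by simp
    have "summable (\<lambda>n. norm (monomial (\<alpha> n) x0 *s c n))"
      using has_series_summable[OF assms(1)] assms(2) by (simp add: norm_vector_smult)
    then show "(\<lambda>n. monomial (\<alpha> n) x0 *s c n) sums (\<Sum>n. monomial (\<alpha> n) x0 *s c n)"
      by (rule summable_norm_cancel[THEN summable_sums])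
  qed simp
  then obtain g where g_all: "\<forall>x\<in>ball x0 d. (\<lambda>n. monomial (\<alpha> n) x *s c n) sums g x \<and>
      (g has_derivative ?g' x) (at x within ball x0 d)" ..
  have g: "(\<lambda>n. monomial (\<alpha> n) x *s c n) sums g x" if "x \<in> ball x0 d" for x
    using bspec[OF g_all that] by (rule conjunct1)
  have g': "(g has_derivative ?g' x0) (at x0 within ball x0 d)"
    using bspec[OF g_all, of x0] d by (simp del: mem_ball add: centre_in_ball)
  have eq: "g x = f x" if "x \<in> ball x0 d" for x
  proof -
    have "f x = (\<Sum>n. monomial (\<alpha> n) x *s c n)"
      by (rule has_series_eq[OF assms(1)]) (use subsetD[OF sub that] in simp)
    then show ?thesis using sums_unique[OF g[OF that]] by simp
  qed
  have "(g has_derivative ?g' x0) (at x0)"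
    using g' d at_within_open[of x0 "ball x0 d"] by simp
  then show ?thesis
    by (rule has_derivative_transform_within_open[of _ _ _ _ "ball x0 d"]) (use d eq in auto)
qed

lemma frechet_derivative_has_series:
  assumes "has_series \<alpha> c \<epsilon> f" "x \<in> ball 0 \<epsilon>"
  shows "frechet_derivative f (at x) v = (\<Sum>i\<in>UNIV. v $ i *s partial_series \<alpha> c i x)"
  by (rule fun_cong[OF frechet_derivative_at[OF has_series_has_derivative[OF assms], symmetric]])

lemma has_series_Cr_on:
  assumes "has_series \<alpha> c \<epsilon> f"
  shows "Cr_on r f (ball 0 \<epsilon>)"
  using assms
proof (induction r arbitrary: \<alpha> c f)
  case 0
  have "continuous_on (ball 0 \<epsilon>) f"
    by (intro continuous_at_imp_continuous_on ballI has_derivative_continuous[OF has_series_has_derivative[OF 0]])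
  then show ?case by (simp add: Cr_on_0)
next
  case (Suc r)
  show ?case
  proof (rule Cr_on_SucI[OF open_ball has_series_has_derivative[OF Suc.prems]])
    fix v
    show "Cr_on r (\<lambda>x. \<Sum>i\<in>UNIV. v $ i *s partial_series \<alpha> c i x) (ball 0 \<epsilon>)"
      by (intro Cr_on_sum open_ball Cr_on_bilinear[OF open_ball bounded_bilinear_vector_smult]
            Cr_on_const Suc.IH[OF has_series_partial[OF Suc.prems]])
  qed
qed

section \<open>Order of vanishing at the origin\<close>

definition order_ge :: "nat \<Rightarrow> (nat \<Rightarrow> 'n::finite \<Rightarrow> nat) \<Rightarrow> (nat \<Rightarrow> 'b::zero) \<Rightarrow> bool" where
  "order_ge m \<alpha> c \<longleftrightarrow> (\<forall>n. (\<Sum>i\<in>UNIV. \<alpha> n i) < m \<longrightarrow> c n = 0)"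

text \<open>The degree of an exponent vector drops by exactly one unless
  \<open>\<alpha> n i = 0\<close>, and in that case the new coefficient is 0.\<close>

lemma order_ge_partial:
  assumes "order_ge (Suc m) \<alpha> c"
  shows "order_ge m (\<lambda>n. lower i (\<alpha> n)) (\<lambda>n. real (\<alpha> n i) *\<^sub>R (c n :: 'b::real_vector))"
  unfolding order_ge_def
proof (intro allI impI)
  fix n assume lt: "(\<Sum>j\<in>UNIV. lower i (\<alpha> n) j) < m"
  have "(\<Sum>j\<in>UNIV. lower i (\<alpha> n) j) = \<alpha> n i - 1 + (\<Sum>j\<in>UNIV - {i}. \<alpha> n j)"
    by (subst sum.remove[of _ i]) (auto simp: lower_def)
  moreover have "(\<Sum>j\<in>UNIV. \<alpha> n j) = \<alpha> n i + (\<Sum>j\<in>UNIV - {i}. \<alpha> n j)"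
    by (subst sum.remove[of _ i]) auto
  ultimately have "\<alpha> n i = 0 \<or> (\<Sum>j\<in>UNIV. \<alpha> n j) < Suc m" using lt by linarith
  then show "real (\<alpha> n i) *\<^sub>R c n = 0" using assms by (auto simp: order_ge_def)
qed

text \<open>Compare with the point \<open>X\<close> all of whose coordinates are \<open>s\<close>:
  since \<open>norm x ^ k \<le> norm x ^ m * s ^ (k - m)\<close> for \<open>k \<ge> m\<close>, a
  monomial of degree \<open>k\<close> is at most \<open>(norm x / s) ^ m\<close> times its value at
  \<open>X\<close>. The choice \<open>s = \<epsilon> / (2 * N)\<close> gives \<open>X\<close> the
  norm \<open>\<epsilon> / 2\<close>, where the series converges absolutely.\<close>

lemma series_order_bound:
  fixes f :: "'a::{real_normed_field,euclidean_space}^'n \<Rightarrow> 'a^'m"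
  defines "N \<equiv> norm ((\<chi> i. 1) :: 'a^'n)"
  assumes "has_series \<alpha> c \<epsilon> f" "order_ge m \<alpha> c" "\<epsilon> > 0"
  shows "\<exists>K. \<forall>x\<in>ball 0 (\<epsilon> / (2 * N)) \<inter> ball 0 \<epsilon>. norm (f x) \<le> K * norm x ^ m"
proof -
  have N: "N > 0" by (simp add: N_def vec_eq_iff)
  define s where "s = \<epsilon> / (2 * N)"
  have s: "s > 0" using N \<open>\<epsilon> > 0\<close> by (simp add: s_def)
  define X :: "'a^'n" where "X = (\<chi> i. of_real s)"
  have "X = s *\<^sub>R (\<chi> i. 1)" by (simp add: X_def vec_eq_iff scaleR_conv_of_real[where 'a='a])
  then have "norm X = s * N" using s by (simp add: N_def)
  also have "\<dots> < \<epsilon>" using N \<open>\<epsilon> > 0\<close> by (simp add: s_def)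
  finally have X: "X \<in> ball 0 \<epsilon>" by simp
  have sX: "summable (\<lambda>n. norm (monomial (\<alpha> n) X) * norm (c n))"
    by (rule has_series_summable[OF assms(2)]) (use X in simp)
  have nX: "norm (monomial (\<alpha> n) X) = s ^ (\<Sum>i\<in>UNIV. \<alpha> n i)" for n
    unfolding norm_monomial using s by (simp add: X_def power_sum)
  define K where "K = (\<Sum>n. norm (monomial (\<alpha> n) X) * norm (c n)) / s ^ m"
  have "norm (f x) \<le> K * norm x ^ m" if x: "x \<in> ball 0 s" "x \<in> ball 0 \<epsilon>" for x
  proof -
    have b: "norm (monomial (\<alpha> n) x *s c n) \<le> (norm x / s) ^ m * (norm (monomial (\<alpha> n) X) * norm (c n))" for n
    proof (cases "c n = 0")
      case False
      define k where "k = (\<Sum>i\<in>UNIV. \<alpha> n i)"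
      have k: "m \<le> k" using assms(3) False by (force simp: order_ge_def k_def)
      have "norm (monomial (\<alpha> n) x) \<le> norm x ^ k"
        unfolding norm_monomial k_def power_sum by (intro prod_mono conjI power_mono Finite_Cartesian_Product.norm_nth_le) auto
      also have "\<dots> = norm x ^ m * norm x ^ (k - m)" using k by (simp flip: power_add)
      also have "\<dots> \<le> norm x ^ m * s ^ (k - m)" using x by (intro mult_left_mono power_mono) auto
      also have "\<dots> = (norm x / s) ^ m * norm (monomial (\<alpha> n) X)"
        using k s unfolding nX k_def[symmetric] by (simp add: power_divide power_diff)
      finally show ?thesis by (simp add: norm_vector_smult mult_right_mono flip: mult.assoc)
    qed simp
    have "f x = (\<Sum>n. monomial (\<alpha> n) x *s c n)"
      by (rule has_series_eq[OF assms(2)]) (use x(2) in simp)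
    also have "norm \<dots> \<le> (\<Sum>n. (norm x / s) ^ m * (norm (monomial (\<alpha> n) X) * norm (c n)))"
      by (rule norm_suminf_le[OF b summable_mult[OF sX]])
    also have "\<dots> = K * norm x ^ m"
      unfolding suminf_mult[OF sX] by (simp add: K_def power_divide)
    finally show ?thesis .
  qed
  then show ?thesis unfolding s_def[symmetric] by blast
qed

section \<open>Taylor polynomials of power series\<close>

lemma dir_deriv_linear_comp:
  assumes "open U" "x \<in> U" "bounded_linear L" "Cr_on r f U" "length vs \<le> r"
  shows "dir_deriv vs (\<lambda>y. L (f y)) x = L (dir_deriv vs f x)"
  using assms(4,5)
proof (induction vs arbitrary: f r)
  case (Cons v vs)
  then obtain s where s: "r = Suc s" by (cases r) auto
  have "dir_deriv (v # vs) (\<lambda>y. L (f y)) x = dir_deriv vs (\<lambda>y. L (frechet_derivative f (at y) v)) x"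
    unfolding dir_deriv.simps
  proof (rule dir_deriv_cong_open[OF assms(1,2)])
    fix y assume y: "y \<in> U"
    show "frechet_derivative (\<lambda>y. L (f y)) (at y) v = L (frechet_derivative f (at y) v)"
      by (rule fun_cong[OF frechet_derivative_at[symmetric]],
          rule bounded_linear.has_derivative[OF assms(3) Cr_on_imp_has_derivative[OF _ y]])
         (use Cons.prems s in blast)
  qed
  also have "\<dots> = L (dir_deriv (v # vs) f x)"
    unfolding dir_deriv.simps
    by (rule Cons.IH[where r=s]) (use Cons.prems s in \<open>auto simp: Cr_on_Suc\<close>)
  finally show ?case .
qed simp

text \<open>The last entry of the list is the outermost derivative. A list of equal directions may
  be shortened at either end, and this end suits differentiation along a ray.\<close>

lemma dir_deriv_snoc: "dir_deriv (vs @ [v]) f = (\<lambda>y. frechet_derivative (dir_deriv vs f) (at y) v)"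
  by (induction vs arbitrary: f) auto

lemma has_series_restrict:
  fixes f :: "'a::{real_normed_field,euclidean_space}^'n \<Rightarrow> 'a^'m"
  assumes "has_series \<alpha> c \<epsilon> f"
  shows "has_series \<alpha> (\<lambda>n. if P n then c n else 0) \<epsilon> (\<lambda>x. \<Sum>n. monomial (\<alpha> n) x *s (if P n then c n else 0))"
  unfolding has_series_def
proof (intro ballI conjI refl)
  fix x :: "'a^'n" assume "x \<in> ball 0 \<epsilon>"
  then have "summable (\<lambda>n. norm (monomial (\<alpha> n) x) * norm (c n))"
    using has_series_summable[OF assms] by simp
  then show "summable (\<lambda>n. norm (monomial (\<alpha> n) x) * norm (if P n then c n else 0))"
    by (rule summable_comparison_test[rotated]) auto
qed

lemma has_series_summable_vec:
  fixes f :: "'a::{real_normed_field,euclidean_space}^'n \<Rightarrow> 'a^'m" and x :: "'a^'n"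
  assumes "has_series \<alpha> c \<epsilon> f" "norm x < \<epsilon>"
  shows "summable (\<lambda>n. monomial (\<alpha> n) x *s c n)"
  by (rule summable_norm_cancel)
     (use has_series_summable[OF assms] in \<open>simp add: norm_vector_smult\<close>)

lemma series_dir_deriv_zero:
  fixes f :: "'a::{real_normed_field,euclidean_space}^'n \<Rightarrow> 'a^'m"
  assumes "has_series \<alpha> c \<epsilon> f" "\<epsilon> > 0" "order_ge (Suc m) \<alpha> c" "length vs \<le> m"
  shows "dir_deriv vs f 0 = 0"
  using assms(1,3,4)
proof (induction vs arbitrary: \<alpha> c f m)
  case Nil
  have "order_ge (Suc 0) \<alpha> c" using Nil(2) by (auto simp: order_ge_def)
  from series_order_bound[OF Nil(1) this assms(2)] obtain K where
    K: "\<forall>x\<in>ball 0 (\<epsilon> / (2 * norm ((\<chi> i. 1) :: 'a^'n))) \<inter> ball 0 \<epsilon>. norm (f x) \<le> K * norm x ^ Suc 0"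
    by blast
  have "norm ((\<chi> i. 1) :: 'a^'n) > 0" by (simp add: vec_eq_iff)
  then have "0 \<in> ball 0 (\<epsilon> / (2 * norm ((\<chi> i. 1) :: 'a^'n))) \<inter> ball (0::'a^'n) \<epsilon>"
    using assms(2) by auto
  from bspec[OF K this] show ?case by simp
next
  case (Cons v vs)
  then obtain k where k: "m = Suc k" by (cases m) auto
  have b0: "0 \<in> ball (0::'a^'n) \<epsilon>" using assms(2) by simp
  have Cr: "Cr_on (length vs) (partial_series \<alpha> c i) (ball 0 \<epsilon>)" for i
    by (rule has_series_Cr_on[OF has_series_partial[OF Cons.prems(1)]])
  have bl: "bounded_linear ((*s) (a::'a) :: 'a^'m \<Rightarrow> _)" for a
    by (rule bounded_bilinear.bounded_linear_right[OF bounded_bilinear_vector_smult])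
  have "dir_deriv (v # vs) f 0 = dir_deriv vs (\<lambda>x. \<Sum>i\<in>UNIV. v $ i *s partial_series \<alpha> c i x) 0"
    unfolding dir_deriv.simps
    by (rule dir_deriv_cong_open[OF open_ball b0 frechet_derivative_has_series[OF Cons.prems(1)]])
  also have "\<dots> = (\<Sum>i\<in>UNIV. dir_deriv vs (\<lambda>x. v $ i *s partial_series \<alpha> c i x) 0)"
    by (rule dir_deriv_sum[OF open_ball b0 Cr_on_linear_comp[OF open_ball bl Cr] order_refl])
  also have "\<dots> = (\<Sum>i\<in>UNIV. v $ i *s dir_deriv vs (partial_series \<alpha> c i) 0)"
    by (rule sum.cong[OF refl], rule dir_deriv_linear_comp[OF open_ball b0 bl Cr order_refl])
  also have "\<dots> = 0"
    by (rule sum.neutral)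
       (use Cons.IH[OF has_series_partial[OF Cons.prems(1)] order_ge_partial] Cons.prems(2,3) k in auto)
  finally show ?case .
qed

lemma monomial_scaleR:
  fixes x :: "'a::{real_normed_field,euclidean_space}^'n"
  shows "monomial a (t *\<^sub>R x) = t ^ (\<Sum>i\<in>UNIV. a i) *\<^sub>R monomial a x"
  by (simp add: monomial_def power_sum scaleR_conv_of_real[where 'a='a] power_mult_distrib prod.distrib)

text \<open>On the ray through \<open>x\<close> the map is a constant times \<open>t ^ j\<close>,
  and derivatives in direction \<open>x\<close> are derivatives in \<open>t\<close>. For
  \<open>k > j\<close> the falling factorial contains the factor 0, so the truncated exponent
  \<open>j - k\<close> does no harm.\<close>

lemma homogeneous_ray_derivative:
  fixes H :: "'b::euclidean_space \<Rightarrow> 'c::euclidean_space"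
  assumes Cr: "\<And>r. Cr_on r H (ball 0 \<epsilon>)"
    and hom: "\<And>t. norm (t *\<^sub>R x) < \<epsilon> \<Longrightarrow> H (t *\<^sub>R x) = t ^ j *\<^sub>R a"
  shows "norm (t *\<^sub>R x) < \<epsilon> \<Longrightarrow>
    dir_deriv (replicate k x) H (t *\<^sub>R x) = ((\<Prod>i<k. real j - real i) * t ^ (j - k)) *\<^sub>R a"
proof (induction k arbitrary: t)
  case 0
  then show ?case using hom by simp
next
  case (Suc k)
  let ?D = "dir_deriv (replicate k x) H" and ?q = "\<Prod>i<k. real j - real i"
  have "?D differentiable at (t *\<^sub>R x)"
    using Cr[of "Suc k"] Suc.prems by (auto simp: Cr_on_def)
  then have "(?D has_derivative frechet_derivative ?D (at (t *\<^sub>R x))) (at (t *\<^sub>R x))"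
    by (simp add: frechet_derivative_works)
  then have 1: "((\<lambda>s. ?D (s *\<^sub>R x)) has_derivative (\<lambda>h. frechet_derivative ?D (at (t *\<^sub>R x)) (h *\<^sub>R x))) (at t)"
    by (rule has_derivative_compose[rotated]) (auto intro!: derivative_eq_intros)
  have op: "open {s. norm (s *\<^sub>R x) < \<epsilon>}"
    by (intro open_Collect_less continuous_intros)
  have "((\<lambda>s. (?q * s ^ (j - k)) *\<^sub>R a) has_derivative (\<lambda>h. (?q * (of_nat (j - k) * h * t ^ (j - k - 1))) *\<^sub>R a)) (at t)"
    by (auto intro!: derivative_eq_intros)
  then have 2: "((\<lambda>s. ?D (s *\<^sub>R x)) has_derivative (\<lambda>h. (?q * (of_nat (j - k) * h * t ^ (j - k - 1))) *\<^sub>R a)) (at t)"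
    by (rule has_derivative_transform_within_open[OF _ op]) (use Suc in auto)
  have "frechet_derivative ?D (at (t *\<^sub>R x)) x = (?q * (of_nat (j - k) * t ^ (j - k - 1))) *\<^sub>R a"
    using fun_cong[OF has_derivative_unique[OF 1 2], of 1] by simp
  moreover have "?q * (of_nat (j - k) * t ^ (j - k - 1)) = (\<Prod>i<Suc k. real j - real i) * t ^ (j - Suc k)"
  proof (cases "k \<le> j")
    case False
    then have "?q = 0" by (intro prod_zero) auto
    then show ?thesis by simp
  qed (simp add: of_nat_diff)
  moreover have "dir_deriv (replicate (Suc k) x) H = (\<lambda>y. frechet_derivative ?D (at y) x)"
    unfolding replicate_Suc replicate_append_same[symmetric] by (rule dir_deriv_snoc)
  ultimately show ?case by (simp only:)
qed

lemma homogeneous_part_taylor: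
  fixes H :: "'b::euclidean_space \<Rightarrow> 'c::euclidean_space"
  assumes "\<And>r. Cr_on r H (ball 0 \<epsilon>)" "\<epsilon> > 0"
    and "\<And>t. norm (t *\<^sub>R x) < \<epsilon> \<Longrightarrow> H (t *\<^sub>R x) = t ^ j *\<^sub>R H x"
  shows "dir_deriv (replicate k x) H 0 = (if k = j then fact j *\<^sub>R H x else 0)"
proof -
  \<comment> \<open>At \<open>t = 0\<close> the power \<open>0 ^ (j - k)\<close> kills the orders
    \<open>k < j\<close>, and the falling factorial kills \<open>k > j\<close>.\<close>
  have eq: "dir_deriv (replicate k x) H 0 = ((\<Prod>i<k. real j - real i) * 0 ^ (j - k)) *\<^sub>R H x"
    using homogeneous_ray_derivative[OF assms(1,3), of 0 k] assms(2) by simp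
  have "(\<Prod>i<j. real j - real i) = fact j"
    using fact_prod_rev[of j, where 'a=real] by (simp add: lessThan_atLeast0 of_nat_diff)
  moreover have "(\<Prod>i<k. real j - real i) = 0" if "j < k"
    using that by (intro prod_zero) auto
  ultimately show ?thesis
    unfolding eq by (cases k j rule: linorder_cases) auto
qed

text \<open>Sorting the series by total degree gives homogeneous parts, and those of degree at most
  \<open>r\<close> make up the Taylor polynomial. The remainder is kept as a series rather than as a
  bound, since its derivatives have to be controlled as well as its values.\<close>

theorem taylor_poly_remainder:
  fixes h :: "'a::{real_normed_field,euclidean_space}^'n \<Rightarrow> 'a^'m"
  assumes h: "has_series \<alpha> c \<epsilon> h" and "\<epsilon> > 0"
  obtains d R where "has_series \<alpha> d \<epsilon> R" "order_ge (Suc r) \<alpha> d"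
    "\<And>x. x \<in> ball 0 \<epsilon> \<Longrightarrow> h x = taylor_poly r h x + R x"
proof -
  define deg where "deg = (\<lambda>n. \<Sum>i\<in>UNIV. \<alpha> n i)"
  define H where "H = (\<lambda>j x. \<Sum>n. monomial (\<alpha> n) x *s (if deg n = j then c n else 0))"
  define d where "d = (\<lambda>n. if r < deg n then c n else 0)"
  define R where "R = (\<lambda>x. \<Sum>n. monomial (\<alpha> n) x *s d n)"
  have H: "has_series \<alpha> (\<lambda>n. if deg n = j then c n else 0) \<epsilon> (H j)" for j
    unfolding H_def by (rule has_series_restrict[OF h])
  have R: "has_series \<alpha> d \<epsilon> R"
    unfolding R_def d_def by (rule has_series_restrict[OF h])
  have ord: "order_ge (Suc r) \<alpha> d" by (auto simp: order_ge_def d_def deg_def)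
  have hom: "H j (t *\<^sub>R x) = t ^ j *\<^sub>R H j x" if x: "norm x < \<epsilon>" for j t x
  proof -
    have "H j (t *\<^sub>R x) = (\<Sum>n. t ^ j *\<^sub>R (monomial (\<alpha> n) x *s (if deg n = j then c n else 0)))"
      unfolding H_def by (rule suminf_cong) (auto simp: monomial_scaleR deg_def vec_eq_iff)
    also have "\<dots> = t ^ j *\<^sub>R H j x"
      unfolding H_def by (rule suminf_scaleR_right[symmetric, OF has_series_summable_vec[OF H x]])
    finally show ?thesis .
  qed
  have split: "h x = (\<Sum>j\<le>r. H j x) + R x" if x: "norm x < \<epsilon>" for x
  proof -
    have pt: "(\<Sum>j\<le>r. monomial (\<alpha> n) x *s (if deg n = j then c n else 0)) + monomial (\<alpha> n) x *s d n
        = monomial (\<alpha> n) x *s c n" for n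
      by (simp add: d_def if_distrib[of "(*s) _"] sum.delta cong: if_cong)
    have sH: "summable (\<lambda>n. monomial (\<alpha> n) x *s (if deg n = j then c n else 0))" for j
      by (rule has_series_summable_vec[OF H x])
    have "(\<Sum>j\<le>r. H j x) + R x
       = (\<Sum>n. (\<Sum>j\<le>r. monomial (\<alpha> n) x *s (if deg n = j then c n else 0))) + (\<Sum>n. monomial (\<alpha> n) x *s d n)"
      unfolding H_def R_def by (subst suminf_sum[OF sH]) simp
    also have "\<dots> = (\<Sum>n. (\<Sum>j\<le>r. monomial (\<alpha> n) x *s (if deg n = j then c n else 0)) + monomial (\<alpha> n) x *s d n)"
      by (rule suminf_add[OF summable_sum[OF sH] has_series_summable_vec[OF R x]])
    also have "\<dots> = (\<Sum>n. monomial (\<alpha> n) x *s c n)" by (simp only: pt)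
    finally show ?thesis using has_series_eq[OF h x] by simp
  qed
  have "taylor_poly r h x = (\<Sum>j\<le>r. H j x)" if x: "norm x < \<epsilon>" for x
    unfolding taylor_poly_def
  proof (rule sum.cong[OF refl])
    fix j assume j: "j \<in> {..r}"
    let ?v = "replicate j x"
    have b0: "0 \<in> ball (0::'a^'n) \<epsilon>" using \<open>\<epsilon> > 0\<close> by simp
    have CH: "Cr_on k (H i) (ball 0 \<epsilon>)" for k i by (rule has_series_Cr_on[OF H])
    have "dir_deriv ?v h 0 = dir_deriv ?v (\<lambda>x. (\<Sum>j\<le>r. H j x) + R x) 0"
      by (rule dir_deriv_cong_open[OF open_ball b0]) (use split in simp)
    also have "\<dots> = dir_deriv ?v (\<lambda>x. \<Sum>j\<le>r. H j x) 0 + dir_deriv ?v R 0"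
      by (rule dir_deriv_add[OF open_ball b0 Cr_on_sum[OF open_ball CH] has_series_Cr_on[OF R] order_refl])
    also have "dir_deriv ?v R 0 = 0"
      by (rule series_dir_deriv_zero[OF R \<open>\<epsilon> > 0\<close> ord]) (use j in simp)
    finally have "dir_deriv ?v h 0 = dir_deriv ?v (\<lambda>x. \<Sum>j\<le>r. H j x) 0" by simp
    also have "\<dots> = (\<Sum>k\<le>r. dir_deriv ?v (H k) 0)"
      by (rule dir_deriv_sum[OF open_ball b0 CH order_refl])
    also have "\<dots> = (\<Sum>k\<le>r. if j = k then fact k *\<^sub>R H k x else 0)"
      using hom[OF x] by (intro sum.cong[OF refl] homogeneous_part_taylor[OF CH \<open>\<epsilon> > 0\<close>]) auto
    also have "\<dots> = fact j *\<^sub>R H j x" using j by simp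
    finally show "(1 / fact j) *\<^sub>R dir_deriv ?v h 0 = H j x" by simp
  qed
  then show ?thesis using that[OF R ord] split by simp
qed

section \<open>Interpolation by flat bumps\<close>

text \<open>A sequence of functions is considered, each on its own region at its own scale. Bounds
  with constants independent of the index are what allows such functions to be glued to a map with
  controlled derivatives near the origin.\<close>

locale scaled_domains =
  fixes \<rho> :: "nat \<Rightarrow> real" and V :: "nat \<Rightarrow> 'b::euclidean_space set"
  assumes \<rho>_pos: "\<rho> i > 0" and open_V: "open (V i)"
begin

text \<open>Each derivative is allowed to lose one factor \<open>\<rho> i\<close>.\<close>

definition derivs_bounded :: "nat \<Rightarrow> (nat \<Rightarrow> real) \<Rightarrow> (nat \<Rightarrow> 'b \<Rightarrow> 'c::euclidean_space) \<Rightarrow> bool" where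
  "derivs_bounded r w f \<longleftrightarrow> (\<forall>i. Cr_on r (f i) (V i)) \<and> (\<forall>vs. length vs \<le> r \<longrightarrow>
     (\<exists>K. \<forall>i. \<forall>x\<in>V i. norm (dir_deriv vs (f i) x) \<le> K * (w i / \<rho> i ^ length vs)))"

lemma derivs_bounded_0:
  "derivs_bounded 0 w f \<longleftrightarrow> (\<forall>i. continuous_on (V i) (f i)) \<and>
     (\<exists>K. \<forall>i. \<forall>x\<in>V i. norm (f i x) \<le> K * w i)"
  by (auto simp: derivs_bounded_def Cr_on_0)

lemma derivs_bounded_Suc:
  "derivs_bounded (Suc r) w f \<longleftrightarrow> (\<forall>i. continuous_on (V i) (f i)) \<and>
     (\<forall>i. \<forall>x\<in>V i. f i differentiable at x) \<and> (\<exists>K. \<forall>i. \<forall>x\<in>V i. norm (f i x) \<le> K * w i) \<and>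
     (\<forall>v. derivs_bounded r (\<lambda>i. w i / \<rho> i) (\<lambda>i x. frechet_derivative (f i) (at x) v))"
proof -
  have split: "(\<forall>vs. P vs) \<longleftrightarrow> P [] \<and> (\<forall>v vs. P (v # vs))" for P :: "'b list \<Rightarrow> bool"
    by (metis list.exhaust)
  show ?thesis
    unfolding derivs_bounded_def Cr_on_Suc
    by (subst split) (simp add: field_simps, blast)
qed

lemma derivs_bounded_le: "derivs_bounded s w f \<Longrightarrow> r \<le> s \<Longrightarrow> derivs_bounded r w f"
  unfolding derivs_bounded_def using Cr_on_le le_trans by blast

lemma derivs_bounded_cong:
  assumes "\<And>i x. x \<in> V i \<Longrightarrow> f i x = g i x" "derivs_bounded r w g"
  shows "derivs_bounded r w f"
proof -
  have "dir_deriv vs (f i) x = dir_deriv vs (g i) x" if "x \<in> V i" for vs i x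
    by (rule dir_deriv_cong_open[OF open_V that assms(1)])
  moreover have "Cr_on r (f i) (V i)" for i
    by (rule Cr_on_cong[OF open_V assms(1)]) (use assms(2) in \<open>auto simp: derivs_bounded_def\<close>)
  ultimately show ?thesis
    using assms(2) unfolding derivs_bounded_def by simp
qed

lemma derivs_bounded_SucI:
  assumes "\<And>i x. x \<in> V i \<Longrightarrow> (f i has_derivative f' i x) (at x)"
    and "\<And>i x. x \<in> V i \<Longrightarrow> norm (f i x) \<le> K * w i"
    and "\<And>v. derivs_bounded r (\<lambda>i. w i / \<rho> i) (\<lambda>i x. f' i x v)"
  shows "derivs_bounded (Suc r) w f"
  unfolding derivs_bounded_Suc
proof (intro conjI allI ballI)
  show "continuous_on (V i) (f i)" for i
    by (intro continuous_at_imp_continuous_on ballI has_derivative_continuous[OF assms(1)])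
  show "f i differentiable at x" if "x \<in> V i" for i x
    using assms(1)[OF that] by (auto simp: differentiable_def)
  show "\<exists>K. \<forall>i. \<forall>x\<in>V i. norm (f i x) \<le> K * w i" using assms(2) by blast
  show "derivs_bounded r (\<lambda>i. w i / \<rho> i) (\<lambda>i x. frechet_derivative (f i) (at x) v)" for v
    by (rule derivs_bounded_cong[OF fun_cong[OF frechet_derivative_at[OF assms(1), symmetric]] assms(3)])
qed

lemma derivs_bounded_imp_has_derivative:
  "derivs_bounded (Suc r) w f \<Longrightarrow> x \<in> V i \<Longrightarrow>
    (f i has_derivative frechet_derivative (f i) (at x)) (at x)"
  unfolding derivs_bounded_Suc frechet_derivative_works[symmetric] by blast

lemma derivs_bounded_imp_bound:
  assumes "derivs_bounded r w f"
  obtains K where "\<And>i x. x \<in> V i \<Longrightarrow> norm (f i x) \<le> K * w i"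
  using derivs_bounded_le[OF assms le0] unfolding derivs_bounded_0 by blast

lemma derivs_bounded_const:
  fixes a :: "nat \<Rightarrow> 'c::euclidean_space"
  assumes "\<And>i. norm (a i) \<le> K * w i"
  shows "derivs_bounded r w (\<lambda>i x. a i)"
proof -
  have zero: "derivs_bounded r w' (\<lambda>i x. 0 :: 'c)" for r w'
    unfolding derivs_bounded_def by (auto simp: Cr_on_const dir_deriv_const intro: exI[of _ 0])
  show ?thesis
  proof (cases r)
    case 0
    then show ?thesis using assms by (auto simp: derivs_bounded_0 intro!: exI[of _ K])
  next
    case (Suc s)
    show ?thesis
      unfolding Suc by (rule derivs_bounded_SucI[where f' = "\<lambda>_ _ _. 0" and K=K]) (simp_all add: zero assms)
  qed
qed

lemma derivs_bounded_weight_cmult: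
  assumes "derivs_bounded r (\<lambda>i. M * w i) f"
  shows "derivs_bounded r w f"
  unfolding derivs_bounded_def
proof (intro conjI allI impI)
  show "Cr_on r (f i) (V i)" for i using assms by (simp add: derivs_bounded_def)
  fix vs :: "'b list" assume "length vs \<le> r"
  then obtain K where K: "\<And>i x. x \<in> V i \<Longrightarrow> norm (dir_deriv vs (f i) x) \<le> K * (M * w i / \<rho> i ^ length vs)"
    using assms unfolding derivs_bounded_def by meson
  have "K * (M * w i / \<rho> i ^ length vs) = (K * M) * (w i / \<rho> i ^ length vs)" for i by simp
  with K show "\<exists>K. \<forall>i. \<forall>x\<in>V i. norm (dir_deriv vs (f i) x) \<le> K * (w i / \<rho> i ^ length vs)"
    by metis
qed

lemma derivs_bounded_add:
  assumes "derivs_bounded r w f" "derivs_bounded r w g"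
  shows "derivs_bounded r w (\<lambda>i x. f i x + g i x)"
  unfolding derivs_bounded_def
proof (intro conjI allI impI)
  show "Cr_on r (\<lambda>x. f i x + g i x) (V i)" for i
    by (rule Cr_on_add[OF open_V]) (use assms in \<open>auto simp: derivs_bounded_def\<close>)
  fix vs :: "'b list" assume l: "length vs \<le> r"
  obtain K where K: "\<And>i x. x \<in> V i \<Longrightarrow> norm (dir_deriv vs (f i) x) \<le> K * (w i / \<rho> i ^ length vs)"
    using assms(1) l unfolding derivs_bounded_def by meson
  obtain L where L: "\<And>i x. x \<in> V i \<Longrightarrow> norm (dir_deriv vs (g i) x) \<le> L * (w i / \<rho> i ^ length vs)"
    using assms(2) l unfolding derivs_bounded_def by meson
  have "norm (dir_deriv vs (\<lambda>x. f i x + g i x) x) \<le> (K + L) * (w i / \<rho> i ^ length vs)" if "x \<in> V i" for i x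
  proof -
    have "dir_deriv vs (\<lambda>x. f i x + g i x) x = dir_deriv vs (f i) x + dir_deriv vs (g i) x"
      by (rule dir_deriv_add[OF open_V that _ _ l]) (use assms in \<open>auto simp: derivs_bounded_def\<close>)
    then show ?thesis
      using norm_triangle_mono[OF K[OF that] L[OF that]] by (simp only: distrib_right)
  qed
  then show "\<exists>K. \<forall>i. \<forall>x\<in>V i. norm (dir_deriv vs (\<lambda>x. f i x + g i x) x) \<le> K * (w i / \<rho> i ^ length vs)"
    by blast
qed

lemma derivs_bounded_sum:
  assumes "finite I" "\<And>j. j \<in> I \<Longrightarrow> derivs_bounded r w (f j)" "\<And>i. w i \<ge> 0"
  shows "derivs_bounded r w (\<lambda>i x. \<Sum>j\<in>I. f j i x)"
  using assms(1,2)
proof (induction I rule: finite_induct)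
  case empty
  then show ?case using assms(3) derivs_bounded_const[of "\<lambda>_. 0" 0] by simp
next
  case (insert j I)
  then show ?case using derivs_bounded_add[of r w "f j" "\<lambda>i x. \<Sum>j\<in>I. f j i x"] by simp
qed

text \<open>Each summand of the product rule differentiates one factor only, so it loses a single
  factor \<open>\<rho> i\<close>, and both summands end up with the same weight.\<close>

lemma derivs_bounded_bilinear:
  assumes "bounded_bilinear B" "derivs_bounded r w f" "derivs_bounded r w' g"
  shows "derivs_bounded r (\<lambda>i. w i * w' i) (\<lambda>i x. B (f i x) (g i x))"
proof -
  obtain C where C: "\<And>a b. norm (B a b) \<le> norm a * norm b * C" and C0: "C \<ge> 0"
    using bounded_bilinear.nonneg_bounded[OF assms(1)] by blast
  have bound: "\<exists>K. \<forall>i. \<forall>x\<in>V i. norm (B (f i x) (g i x)) \<le> K * (w i * w' i)"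
    if f: "derivs_bounded r w f" and g: "derivs_bounded r w' g" for r w w' f g
  proof -
    obtain K where K: "\<And>i x. x \<in> V i \<Longrightarrow> norm (f i x) \<le> K * w i"
      using derivs_bounded_imp_bound[OF f] by blast
    obtain L where L: "\<And>i x. x \<in> V i \<Longrightarrow> norm (g i x) \<le> L * w' i"
      using derivs_bounded_imp_bound[OF g] by blast
    have "norm (B (f i x) (g i x)) \<le> (K * L * C) * (w i * w' i)" if x: "x \<in> V i" for i x
    proof -
      have "norm (f i x) * norm (g i x) * C \<le> (K * w i) * (L * w' i) * C"
        using K[OF x] L[OF x] C0 order_trans[OF norm_ge_zero K[OF x]]
        by (intro mult_right_mono mult_mono) auto
      then show ?thesis using C[of "f i x" "g i x"] by (simp add: mult_ac)
    qed
    then show ?thesis by blast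
  qed
  show ?thesis
    using assms(2,3)
  proof (induction r arbitrary: w w' f g)
    case 0
    then show ?case
      using bound[OF 0] bounded_bilinear.continuous_on[OF assms(1)]
      unfolding derivs_bounded_0 by blast
  next
    case (Suc r)
    obtain K where K: "\<And>i x. x \<in> V i \<Longrightarrow> norm (B (f i x) (g i x)) \<le> K * (w i * w' i)"
      using bound[OF Suc.prems] by blast
    show ?case
    proof (rule derivs_bounded_SucI[OF _ K])
      fix i x assume x: "x \<in> V i"
      show "((\<lambda>x. B (f i x) (g i x)) has_derivative (\<lambda>v. B (f i x) (frechet_derivative (g i) (at x) v)
          + B (frechet_derivative (f i) (at x) v) (g i x))) (at x)"
        using bounded_bilinear.FDERIV[OF assms(1) derivs_bounded_imp_has_derivative[OF Suc.prems(1) x]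
            derivs_bounded_imp_has_derivative[OF Suc.prems(2) x]] .
    next
      fix v
      have f: "derivs_bounded r w f" "derivs_bounded r (\<lambda>i. w i / \<rho> i) (\<lambda>i x. frechet_derivative (f i) (at x) v)"
        and g: "derivs_bounded r w' g" "derivs_bounded r (\<lambda>i. w' i / \<rho> i) (\<lambda>i x. frechet_derivative (g i) (at x) v)"
        using Suc.prems derivs_bounded_le[of "Suc r" _ _ r] by (simp_all add: derivs_bounded_Suc)
      show "derivs_bounded r (\<lambda>i. w i * w' i / \<rho> i) (\<lambda>i x. B (f i x) (frechet_derivative (g i) (at x) v)
          + B (frechet_derivative (f i) (at x) v) (g i x))"
        using derivs_bounded_add[of r "\<lambda>i. w i * w' i / \<rho> i"] Suc.IH[OF f(1) g(2)] Suc.IH[OF f(2) g(1)]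
        by simp
    qed
  qed
qed

text \<open>The chain rule gives one factor \<open>1 / \<rho> i\<close> per derivative, while the
  rescaled argument stays in the ball of radius \<open>C\<close>, where the continuous derivatives
  of the fixed profile are bounded independently of \<open>i\<close>.\<close>

lemma derivs_bounded_rescaled:
  fixes \<phi> :: "'b \<Rightarrow> 'c::euclidean_space"
  assumes "Cr_on r \<phi> UNIV" "\<And>i x. x \<in> V i \<Longrightarrow> norm (x - a i) \<le> C * \<rho> i"
  shows "derivs_bounded r (\<lambda>_. 1) (\<lambda>i x. \<phi> ((x - a i) /\<^sub>R \<rho> i))"
proof -
  have bound: "\<exists>K. \<forall>i. \<forall>x\<in>V i. norm (\<phi> ((x - a i) /\<^sub>R \<rho> i)) \<le> K * 1" if "continuous_on UNIV \<phi>" for \<phi> :: "'b \<Rightarrow> 'c"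
  proof -
    have "compact (\<phi> ` cball 0 C)"
      using that by (intro compact_continuous_image) (auto intro: continuous_on_subset)
    from compact_imp_bounded[OF this] obtain K where K: "\<And>z. z \<in> cball 0 C \<Longrightarrow> norm (\<phi> z) \<le> K"
      unfolding bounded_iff by blast
    have "norm (\<phi> ((x - a i) /\<^sub>R \<rho> i)) \<le> K" if "x \<in> V i" for i x
    proof (rule K)
      have "norm ((x - a i) /\<^sub>R \<rho> i) = norm (x - a i) / \<rho> i"
        using \<rho>_pos[of i] by (simp add: divide_inverse_commute)
      also have "\<dots> \<le> C"
        using assms(2)[OF that] \<rho>_pos[of i] by (simp add: pos_divide_le_eq)
      finally show "(x - a i) /\<^sub>R \<rho> i \<in> cball 0 C" by simp
    qed
    then show ?thesis by (intro exI[of _ K]) simp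
  qed
  show ?thesis
    using assms(1)
  proof (induction r arbitrary: \<phi>)
    case 0
    then have "continuous_on UNIV \<phi>" by (simp add: Cr_on_0)
    moreover have "continuous_on (V i) (\<lambda>x. \<phi> ((x - a i) /\<^sub>R \<rho> i))" for i
      by (rule continuous_on_compose2[OF \<open>continuous_on UNIV \<phi>\<close>]) (auto intro!: continuous_intros)
    ultimately show ?case
      using bound[of \<phi>] unfolding derivs_bounded_0 by blast
  next
    case (Suc r)
    obtain K where K: "\<And>i x. x \<in> V i \<Longrightarrow> norm (\<phi> ((x - a i) /\<^sub>R \<rho> i)) \<le> K * 1"
      using bound[OF Cr_on_imp_continuous_on[OF Suc.prems]] by blast
    show ?case
    proof (rule derivs_bounded_SucI[OF _ K])
      fix i x
      have d: "(\<phi> has_derivative frechet_derivative \<phi> (at ((x - a i) /\<^sub>R \<rho> i))) (at ((x - a i) /\<^sub>R \<rho> i))"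
        by (rule Cr_on_imp_has_derivative[OF Suc.prems]) simp
      have "((\<lambda>x. (x - a i) /\<^sub>R \<rho> i) has_derivative (\<lambda>v. v /\<^sub>R \<rho> i)) (at x)"
        by (auto intro!: derivative_eq_intros)
      from has_derivative_compose[OF this d]
      have "((\<lambda>x. \<phi> ((x - a i) /\<^sub>R \<rho> i)) has_derivative
          (\<lambda>v. frechet_derivative \<phi> (at ((x - a i) /\<^sub>R \<rho> i)) (v /\<^sub>R \<rho> i))) (at x)" .
      moreover have "frechet_derivative \<phi> (at ((x - a i) /\<^sub>R \<rho> i)) (v /\<^sub>R \<rho> i)
          = (1 / \<rho> i) *\<^sub>R frechet_derivative \<phi> (at ((x - a i) /\<^sub>R \<rho> i)) v" for v
        using linear_cmul[OF has_derivative_linear[OF d], of "1 / \<rho> i" v] by (simp add: divide_inverse)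
      ultimately show "((\<lambda>x. \<phi> ((x - a i) /\<^sub>R \<rho> i)) has_derivative
          (\<lambda>v. (1 / \<rho> i) *\<^sub>R frechet_derivative \<phi> (at ((x - a i) /\<^sub>R \<rho> i)) v)) (at x)" by simp
    next
      fix v
      have "derivs_bounded r (\<lambda>i. 1 / \<rho> i) (\<lambda>i x. 1 / \<rho> i)"
        by (rule derivs_bounded_const[where K=1]) (use \<rho>_pos in \<open>simp add: less_imp_le\<close>)
      moreover have "derivs_bounded r (\<lambda>_. 1) (\<lambda>i x. frechet_derivative \<phi> (at ((x - a i) /\<^sub>R \<rho> i)) v)"
        by (rule Suc.IH) (use Suc.prems in \<open>simp add: Cr_on_Suc\<close>)
      ultimately show "derivs_bounded r (\<lambda>i. 1 / \<rho> i)
         (\<lambda>i x. (1 / \<rho> i) *\<^sub>R frechet_derivative \<phi> (at ((x - a i) /\<^sub>R \<rho> i)) v)"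
        using derivs_bounded_bilinear[OF bounded_bilinear_scaleR] by fastforce
    qed
  qed
qed

lemma derivs_bounded_linear:
  assumes L: "\<And>i. bounded_linear (L i)" "\<And>i v. norm (L i v) \<le> l i * norm v"
    and V: "\<And>i x. x \<in> V i \<Longrightarrow> norm (x - a i) \<le> C * \<rho> i" and l: "\<And>i. l i \<ge> 0"
  shows "derivs_bounded r (\<lambda>i. l i * \<rho> i) (\<lambda>i x. L i (x - a i))"
proof -
  \<comment> \<open>One derivative more than requested, so that the case without derivatives needs
    no separate treatment; the first derivative in a fixed direction is constant on
    \<open>V i\<close>.\<close>
  have "derivs_bounded (Suc r) (\<lambda>i. l i * \<rho> i) (\<lambda>i x. L i (x - a i))"
  proof (rule derivs_bounded_SucI)
    fix i x assume x: "x \<in> V i"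
    show "((\<lambda>x. L i (x - a i)) has_derivative L i) (at x)"
      by (rule bounded_linear.has_derivative[OF L(1), of "\<lambda>x. x - a i" "\<lambda>v. v", simplified])
         (auto intro!: derivative_eq_intros)
    show "norm (L i (x - a i)) \<le> C * (l i * \<rho> i)"
      using order_trans[OF L(2) mult_left_mono[OF V[OF x] l]] by (simp add: mult_ac)
  next
    fix v
    have "norm (L i v) \<le> norm v * (l i * \<rho> i / \<rho> i)" for i
      using L(2)[of i v] \<rho>_pos[of i] by (simp add: mult_ac)
    then show "derivs_bounded r (\<lambda>i. l i * \<rho> i / \<rho> i) (\<lambda>i x. L i v)"
      by (rule derivs_bounded_const)
  qed
  then show ?thesis by (rule derivs_bounded_le) simp
qed

end

text \<open>A partial derivative lowers the order of the series by one, which is exactly the loss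
  allowed. The bound \<open>norm x \<le> C * \<rho> i\<close> trades powers of \<open>norm x\<close>
  for powers of the scale.\<close>

lemma derivs_bounded_series:
  fixes f :: "'a::{real_normed_field,euclidean_space}^'n \<Rightarrow> 'a^'m"
  assumes "scaled_domains \<rho> V" "has_series \<alpha> c \<epsilon> f" "\<epsilon> > 0" "order_ge r \<alpha> c"
    and V: "\<And>i x. x \<in> V i \<Longrightarrow> norm x < \<epsilon> \<and> norm x < \<epsilon> / (2 * norm ((\<chi> i. 1) :: 'a^'n)) \<and> norm x \<le> C * \<rho> i"
  shows "scaled_domains.derivs_bounded \<rho> V r (\<lambda>i. \<rho> i ^ r) (\<lambda>_. f)"
proof -
  interpret scaled_domains \<rho> V by fact
  have Vb: "x \<in> ball 0 \<epsilon>" if "x \<in> V i" for x i using V[OF that] by simp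
  have bound: "\<exists>K. \<forall>i. \<forall>x\<in>V i. norm (f x) \<le> K * \<rho> i ^ r"
    if f: "has_series \<alpha> c \<epsilon> f" "order_ge r \<alpha> c" for r \<alpha> c and f :: "'a^'n \<Rightarrow> 'a^'m"
  proof -
    obtain K where K: "\<And>x. norm x < \<epsilon> \<Longrightarrow> norm x < \<epsilon> / (2 * norm ((\<chi> i. 1) :: 'a^'n)) \<Longrightarrow> norm (f x) \<le> K * norm x ^ r"
      using series_order_bound[OF f \<open>\<epsilon> > 0\<close>] by fastforce
    have "norm (f x) \<le> \<bar>K\<bar> * C ^ r * \<rho> i ^ r" if "x \<in> V i" for i x
    proof -
      have "norm (f x) \<le> \<bar>K\<bar> * norm x ^ r"
        using K[of x] V[OF that] mult_right_mono[OF abs_ge_self[of K], of "norm x ^ r"] by simp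
      also have "\<dots> \<le> \<bar>K\<bar> * (C * \<rho> i) ^ r"
        using V[OF that] by (intro mult_left_mono power_mono) auto
      finally show ?thesis by (simp add: power_mult_distrib mult_ac)
    qed
    then show ?thesis by blast
  qed
  show ?thesis
    using assms(2,4)
  proof (induction r arbitrary: \<alpha> c f)
    case 0
    have "continuous_on (V i) f" for i
      by (rule continuous_on_subset[OF Cr_on_imp_continuous_on[OF has_series_Cr_on[OF 0(1)]]])
         (use Vb in blast)
    then show ?case using bound[OF 0] unfolding derivs_bounded_0 by blast
  next
    case (Suc r)
    obtain K where K: "\<And>i x. x \<in> V i \<Longrightarrow> norm (f x) \<le> K * \<rho> i ^ Suc r"
      using bound[OF Suc.prems] by blast
    have w: "(\<lambda>i. \<rho> i ^ Suc r / \<rho> i) = (\<lambda>i. \<rho> i ^ r)"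
    proof
      show "\<rho> i ^ Suc r / \<rho> i = \<rho> i ^ r" for i using \<rho>_pos[of i] by simp
    qed
    show ?case
    proof (rule derivs_bounded_SucI[OF has_series_has_derivative[OF Suc.prems(1) Vb] K])
      fix v :: "'a^'n"
      have "derivs_bounded r (\<lambda>i. 1 * \<rho> i ^ r) (\<lambda>i x. v $ j *s partial_series \<alpha> c j x)" for j
        by (rule derivs_bounded_bilinear[OF bounded_bilinear_vector_smult derivs_bounded_const[where K="norm (v $ j)"]
              Suc.IH[OF has_series_partial[OF Suc.prems(1)] order_ge_partial[OF Suc.prems(2)]]]) simp
      then have "derivs_bounded r (\<lambda>i. \<rho> i ^ r) (\<lambda>i x. v $ j *s partial_series \<alpha> c j x)" for j
        by (simp only: mult_1_left)
      then show "derivs_bounded r (\<lambda>i. \<rho> i ^ Suc r / \<rho> i) (\<lambda>i x. \<Sum>j\<in>UNIV. v $ j *s partial_series \<alpha> c j x)"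
        unfolding w by (intro derivs_bounded_sum) (use \<rho>_pos in \<open>simp_all add: less_imp_le\<close>)
    qed
  qed
qed

section \<open>A bump function of finite smoothness\<close>

lemma has_derivative_pos_power:
  "((\<lambda>t::real. max 0 t ^ Suc (Suc n)) has_derivative (\<lambda>h. (h * real (Suc (Suc n))) * max 0 t ^ Suc n)) (at t)"
proof -
  consider "t > 0" | "t < 0" | "t = 0" by linarith
  then show ?thesis
  proof cases
    case 1
    have "((\<lambda>t. t ^ Suc (Suc n)) has_derivative (\<lambda>h. of_nat (Suc (Suc n)) * h * t ^ (Suc (Suc n) - 1))) (at t)"
      by (rule has_derivative_power[OF has_derivative_ident])
    then have "((\<lambda>t::real. max 0 t ^ Suc (Suc n)) has_derivative (\<lambda>h. of_nat (Suc (Suc n)) * h * t ^ (Suc (Suc n) - 1))) (at t)"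
      by (rule has_derivative_transform_within_open[of _ _ _ _ "{0<..}"]) (use 1 in auto)
    then show ?thesis using 1 by (simp add: mult_ac)
  next
    case 2
    have "((\<lambda>t::real. 0) has_derivative (\<lambda>h. 0)) (at t)" by simp
    then have "((\<lambda>t::real. max 0 t ^ Suc (Suc n)) has_derivative (\<lambda>h. 0)) (at t)"
      by (rule has_derivative_transform_within_open[of _ _ _ _ "{..<0}"]) (use 2 in auto)
    then show ?thesis using 2 by simp
  next
    case 3
    have "((\<lambda>h::real. max 0 h ^ Suc (Suc n) / h) \<longlongrightarrow> 0) (at 0)"
    proof (rule Lim_null_comparison)
      show "\<forall>\<^sub>F h in at 0. norm (max 0 h ^ Suc (Suc n) / h) \<le> \<bar>h\<bar> ^ Suc n"
      proof (rule always_eventually, rule allI)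
        fix h :: real
        show "norm (max 0 h ^ Suc (Suc n) / h) \<le> \<bar>h\<bar> ^ Suc n"
        proof (cases "h > 0")
          case False
          then have "max 0 h = 0" by simp
          then show ?thesis by (simp del: power_Suc add: power_0_left)
        qed simp
      qed
      have "((\<lambda>h::real. \<bar>h\<bar>) \<longlongrightarrow> 0) (at 0)" by (rule tendsto_rabs_zero[OF tendsto_ident_at])
      from tendsto_power[OF this, of "Suc n"] show "((\<lambda>h::real. \<bar>h\<bar> ^ Suc n) \<longlongrightarrow> 0) (at 0)" by simp
    qed
    then have "((\<lambda>t::real. max 0 t ^ Suc (Suc n)) has_real_derivative 0) (at 0)"
      unfolding DERIV_def by simp
    then show ?thesis using 3 by (simp add: has_field_derivative_def lambda_zero)
  qed
qed

text \<open>Each derivative lowers the exponent by one; after \<open>n\<close> of them a multiple of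
  \<open>max 0 t\<close> is left, which is still continuous.\<close>

lemma Cr_on_pos_power: "r \<le> n \<Longrightarrow> Cr_on r (\<lambda>t::real. max 0 t ^ Suc n) UNIV"
proof (induction r arbitrary: n)
  case 0
  show ?case unfolding Cr_on_0 by (intro continuous_intros)
next
  case (Suc r)
  then obtain k where k: "n = Suc k" "r \<le> k" by (cases n) auto
  show ?case
    unfolding k(1)
  proof (rule Cr_on_SucI[OF open_UNIV has_derivative_pos_power])
    fix v :: real
    show "Cr_on r (\<lambda>x. (v * real (Suc (Suc k))) * max 0 x ^ Suc k) UNIV"
      by (rule Cr_on_linear_comp[OF open_UNIV bounded_linear_mult_right Suc.IH[OF k(2)]])
  qed
qed

text \<open>The derivative of \<open>\<phi>\<close> vanishes at 0 so that multiplication by a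
  rescaled bump preserves both the value and the derivative of the other factor at the
  centre.\<close>

lemma bump_exists:
  obtains \<phi> :: "'b::euclidean_space \<Rightarrow> real"
  where "Cr_on r \<phi> UNIV" "\<phi> 0 = 1" "(\<phi> has_derivative (\<lambda>_. 0)) (at 0)"
    "\<And>z. norm z \<ge> 1/4 \<Longrightarrow> \<phi> z = 0"
proof
  \<comment> \<open>The factor 16 makes \<open>?g\<close> vanish on the sphere of radius 1/4, so its
    positive part is supported in that ball.\<close>
  let ?g = "\<lambda>z::'b. 1 + (-16) *\<^sub>R (z \<bullet> z)"
  let ?\<phi> = "\<lambda>z. max 0 (?g z) ^ Suc (Suc r)"
  have "Cr_on r ?g UNIV"
    by (intro Cr_on_add open_UNIV Cr_on_const Cr_on_linear_comp[OF open_UNIV bounded_linear_scaleR_right]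
        Cr_on_bilinear[OF open_UNIV bounded_bilinear_inner] Cr_on_bounded_linear bounded_linear_ident)
  then show "Cr_on r ?\<phi> UNIV"
    by (rule Cr_on_compose[OF open_UNIV open_UNIV _ Cr_on_pos_power]) auto
  show "?\<phi> 0 = 1" by simp
  have "(?g has_derivative (\<lambda>_. 0)) (at 0)"
    by (auto intro!: derivative_eq_intros)
  from has_derivative_compose[OF this has_derivative_pos_power]
  show "(?\<phi> has_derivative (\<lambda>_. 0)) (at 0)" by simp
  show "?\<phi> z = 0" if "norm z \<ge> 1/4" for z
  proof -
    have "(1/4)\<^sup>2 \<le> (norm z)\<^sup>2" using that by (intro power_mono) auto
    then have "1/16 \<le> z \<bullet> z" by (simp add: power2_norm_eq_inner power_divide)
    then show ?thesis by simp
  qed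
qed

section \<open>Gluing bumps along a rapidly decreasing sequence\<close>

lemma geometric_decay:
  fixes \<rho> :: "nat \<Rightarrow> real"
  assumes "\<And>i. \<rho> i > 0" "\<And>i. \<rho> (Suc i) < \<rho> i / 4" "i < j"
  shows "\<rho> j < \<rho> i / 4"
  using assms(3)
proof (induction j)
  case (Suc j)
  then show ?case using assms(1)[of i] assms(2)[of j] assms(1)[of j] by (cases "i = j") auto
qed simp

text \<open>Around \<open>a i\<close> the map \<open>P\<close> is \<open>G i\<close> cut off by a
  bump of radius \<open>norm (a i) / 4\<close>. On \<open>V i\<close> the scale and the distance to
  the origin are comparable, so the weight \<open>norm (a i) ^ Suc r\<close>, with one factor lost
  per derivative, turns into flatness of \<open>P\<close> at the origin.\<close>

theorem flat_interpolation:
  fixes a :: "nat \<Rightarrow> 'b::euclidean_space" and G :: "nat \<Rightarrow> 'b \<Rightarrow> 'c::euclidean_space"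
  defines "V \<equiv> \<lambda>i. {x. norm (a i) / 2 < norm x \<and> norm x < 2 * norm (a i)}"
  assumes a: "\<And>i. a i \<noteq> 0" "\<And>i. norm (a (Suc i)) < norm (a i) / 4"
    and G: "scaled_domains.derivs_bounded (\<lambda>i. norm (a i)) V (Suc r) (\<lambda>i. norm (a i) ^ Suc r) G"
  obtains P where "P 0 = 0" "Cr_on (Suc r) P (- {0})"
    "\<And>vs. length vs \<le> Suc r \<Longrightarrow> \<exists>K. \<forall>x. x \<noteq> 0 \<longrightarrow> norm (dir_deriv vs P x) \<le> K * norm x ^ (Suc r - length vs)"
    "\<And>i. P (a i) = G i (a i)"
    "\<And>i. (P has_derivative frechet_derivative (G i) (at (a i))) (at (a i))"
proof -
  let ?\<rho> = "\<lambda>i. norm (a i)"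
  have \<rho>: "?\<rho> i > 0" for i using a(1) by simp
  have opV: "open (V i)" for i
    unfolding V_def by (intro open_Collect_conj open_Collect_less continuous_intros)
  interpret scaled_domains ?\<rho> V by standard (use \<rho> opV in auto)
  obtain \<phi> :: "'b \<Rightarrow> real" where \<phi>: "Cr_on (Suc r) \<phi> UNIV" "\<phi> 0 = 1" "(\<phi> has_derivative (\<lambda>_. 0)) (at 0)"
    "\<And>z. norm z \<ge> 1/4 \<Longrightarrow> \<phi> z = 0" using bump_exists by blast
  define B where "B = (\<lambda>i x. \<phi> ((x - a i) /\<^sub>R ?\<rho> i) *\<^sub>R G i x)"
  have close: "norm (x - a i) \<le> 3 * ?\<rho> i" if "x \<in> V i" for x i
    using that norm_triangle_ineq4[of x "a i"] by (simp add: V_def)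
  have "derivs_bounded (Suc r) (\<lambda>i. 1 * ?\<rho> i ^ Suc r) B"
    unfolding B_def
    by (rule derivs_bounded_bilinear[OF bounded_bilinear_scaleR derivs_bounded_rescaled[OF \<phi>(1) close] G])
  then have B: "derivs_bounded (Suc r) (\<lambda>i. ?\<rho> i ^ Suc r) B" by (simp only: mult_1_left)
  \<comment> \<open>The support lies well inside the annulus \<open>V i\<close>, whose radii are 1/2
    and 2 times \<open>norm (a i)\<close>; the gap is used in \<open>local\<close>.\<close>
  have supp: "x \<in> {x. 3/4 * ?\<rho> i < norm x \<and> norm x < 5/4 * ?\<rho> i}" if "B i x \<noteq> 0" for i x
  proof -
    have "norm ((x - a i) /\<^sub>R ?\<rho> i) < 1/4"
      using that \<phi>(4) unfolding B_def by (metis not_le scaleR_zero_left)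
    moreover have "norm ((x - a i) /\<^sub>R ?\<rho> i) = norm (x - a i) / ?\<rho> i"
      using \<rho>[of i] by (simp add: divide_inverse_commute)
    ultimately have "norm (x - a i) < ?\<rho> i / 4" using \<rho>[of i] by (simp add: pos_divide_less_eq)
    then show ?thesis
      using norm_triangle_sub[of x "a i"] norm_triangle_sub[of "a i" x]
      by (simp add: norm_minus_commute)
  qed
  \<comment> \<open>Decay by more than a factor of 4 separates the annuli:
    \<open>2 * norm (a j) < norm (a i) / 2\<close> for \<open>i < j\<close>.\<close>
  have disj: "i = j" if "x \<in> V i" "x \<in> V j" for i j x
  proof (rule ccontr)
    assume "i \<noteq> j"
    then consider "?\<rho> j < ?\<rho> i / 4" | "?\<rho> i < ?\<rho> j / 4"
      using geometric_decay[of ?\<rho>, OF \<rho> a(2)] by (meson linorder_neqE_nat)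
    then show False using that by cases (auto simp: V_def)
  qed
  define P where "P = (\<lambda>x. if \<exists>i. x \<in> V i then B (THE i. x \<in> V i) x else 0)"
  have PB: "P x = B i x" if "x \<in> V i" for x i
  proof -
    have "(THE i. x \<in> V i) = i" using that disj by (intro the_equality) auto
    then show ?thesis using that by (auto simp: P_def)
  qed
  have local: "\<exists>N. open N \<and> x \<in> N \<and> (\<forall>y\<in>N. P y = 0)" if x: "x \<noteq> 0" "\<And>i. x \<notin> V i" for x
  proof (intro exI conjI ballI)
    \<comment> \<open>If \<open>B i y \<noteq> 0\<close> for some \<open>y\<close> in this shell,
      then \<open>norm y\<close> is between 3/4 and 5/4 of \<open>norm (a i)\<close>, and a change
      of about 10 percent keeps \<open>x\<close> inside the wider annulus
      \<open>V i\<close>.\<close>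
    let ?N = "{y::'b. 9/10 * norm x < norm y \<and> norm y < 11/10 * norm x}"
    show "open ?N" by (intro open_Collect_conj open_Collect_less continuous_intros)
    show "x \<in> ?N" using x(1) by simp
    fix y assume y: "y \<in> ?N"
    show "P y = 0"
    proof (rule ccontr)
      assume ne: "P y \<noteq> 0"
      then obtain i where i: "y \<in> V i" by (auto simp: P_def split: if_splits)
      then have "B i y \<noteq> 0" using ne PB by simp
      from supp[OF this] y have "x \<in> V i" by (auto simp: V_def)
      then show False using x(2) by blast
    qed
  qed
  have CrB: "Cr_on (Suc r) (B i) (V i)" for i using B by (simp add: derivs_bounded_def)
  have dirPB: "dir_deriv vs P x = dir_deriv vs (B i) x" if "x \<in> V i" for vs x i
    by (rule dir_deriv_cong_open[OF opV that PB])
  have aV: "a i \<in> V i" for i using \<rho>[of i] by (auto simp: V_def)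
  show ?thesis
  proof (rule that)
    show "P 0 = 0" using \<rho> by (auto simp: P_def V_def not_less less_imp_le)
    show "Cr_on (Suc r) P (- {0})"
    proof (rule Cr_on_local)
      fix x :: 'b assume "x \<in> - {0}"
      then have x: "x \<noteq> 0" by simp
      show "\<exists>N. open N \<and> x \<in> N \<and> Cr_on (Suc r) P N"
      proof (cases "\<exists>i. x \<in> V i")
        case True
        then obtain i where "x \<in> V i" ..
        then show ?thesis using Cr_on_cong[OF opV PB CrB] opV by blast
      next
        case False
        then obtain N where "open N" "x \<in> N" "\<And>y. y \<in> N \<Longrightarrow> P y = 0" using local[OF x] by blast
        then show ?thesis using Cr_on_cong[OF \<open>open N\<close>, of P "\<lambda>_. 0", OF _ Cr_on_const] by blast
      qed
    qed
    show "\<exists>K. \<forall>x. x \<noteq> 0 \<longrightarrow> norm (dir_deriv vs P x) \<le> K * norm x ^ (Suc r - length vs)"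
      if l: "length vs \<le> Suc r" for vs
    proof -
      obtain K where K: "\<And>i x. x \<in> V i \<Longrightarrow> norm (dir_deriv vs (B i) x) \<le> K * (?\<rho> i ^ Suc r / ?\<rho> i ^ length vs)"
        using B l unfolding derivs_bounded_def by meson
      let ?m = "Suc r - length vs"
      have "norm (dir_deriv vs P x) \<le> (\<bar>K\<bar> * 2 ^ ?m) * norm x ^ ?m" if x: "x \<noteq> 0" for x
      proof (cases "\<exists>i. x \<in> V i")
        case True
        then obtain i where i: "x \<in> V i" ..
        have "?\<rho> i ^ Suc r / ?\<rho> i ^ length vs = ?\<rho> i ^ ?m"
          using \<rho>[of i] l by (simp add: power_diff del: power_Suc)
        then have "norm (dir_deriv vs P x) \<le> K * ?\<rho> i ^ ?m" using K[OF i] dirPB[OF i] by simp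
        also have "\<dots> \<le> \<bar>K\<bar> * (2 * norm x) ^ ?m"
          using i \<rho>[of i] by (intro mult_mono power_mono) (auto simp: V_def)
        finally show ?thesis by (simp add: power_mult_distrib mult_ac)
      next
        case False
        then obtain N where N: "open N" "x \<in> N" "\<And>y. y \<in> N \<Longrightarrow> P y = 0" using local[OF x] by blast
        have "dir_deriv vs P x = dir_deriv vs (\<lambda>_. 0) x" by (rule dir_deriv_cong_open[OF N])
        then show ?thesis by (simp add: dir_deriv_const)
      qed
      then show ?thesis by blast
    qed
    show "P (a i) = G i (a i)" for i
      using PB[OF aV] \<phi>(2) by (simp add: B_def)
    show "(P has_derivative frechet_derivative (G i) (at (a i))) (at (a i))" for i
    proof -
      have g: "(G i has_derivative frechet_derivative (G i) (at (a i))) (at (a i))"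
        by (rule derivs_bounded_imp_has_derivative[OF G aV])
      have "((\<lambda>x. (x - a i) /\<^sub>R ?\<rho> i) has_derivative (\<lambda>v. v /\<^sub>R ?\<rho> i)) (at (a i))"
        by (auto intro!: derivative_eq_intros)
      from has_derivative_compose[OF this] \<phi>(3)
      have p: "((\<lambda>x. \<phi> ((x - a i) /\<^sub>R ?\<rho> i)) has_derivative (\<lambda>_. 0)) (at (a i))" by simp
      have "(B i has_derivative frechet_derivative (G i) (at (a i))) (at (a i))"
        unfolding B_def using bounded_bilinear.FDERIV[OF bounded_bilinear_scaleR p g] \<phi>(2) by simp
      then show ?thesis
        by (rule has_derivative_transform_within_open[OF _ opV aV]) (simp add: PB)
    qed
  qed
qed

section \<open>Germs and jets of flat perturbations\<close>

lemma onorm_le_sum_Basis: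
  fixes f :: "'b::euclidean_space \<Rightarrow> 'c::real_normed_vector"
  assumes "bounded_linear f"
  shows "onorm f \<le> (\<Sum>b\<in>Basis. norm (f b))"
proof (rule onorm_le)
  fix v
  have "norm (f v) \<le> (\<Sum>b\<in>Basis. norm v * norm (f b))"
    unfolding bounded_linear_sum_Basis[OF assms, of v]
    by (rule sum_norm_le) (auto intro: mult_right_mono Basis_le_norm)
  then show "norm (f v) \<le> (\<Sum>b\<in>Basis. norm (f b)) * norm v"
    by (simp add: sum_distrib_left mult.commute)
qed

text \<open>Iterated derivatives are bounded for each direction separately, while the class for
  \<open>r = 0\<close> is phrased with operator norms; finitely many basis directions suffice to
  pass from one to the other.\<close>

lemma bounded_directional_derivatives_onorm:
  fixes D :: "'b::euclidean_space \<Rightarrow> 'b \<Rightarrow> 'c::euclidean_space"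
  assumes "\<forall>\<^sub>F x in F. bounded_linear (D x)" "\<And>b. \<exists>K. \<forall>\<^sub>F x in F. norm (D x b) \<le> K"
  shows "\<exists>K. \<forall>\<^sub>F x in F. onorm (D x) \<le> (K::real)"
proof -
  obtain K where K: "\<And>b. \<forall>\<^sub>F x in F. norm (D x b) \<le> K b" using assms(2) by metis
  have "\<forall>\<^sub>F x in F. \<forall>b\<in>Basis. norm (D x b) \<le> K b" using K by (intro eventually_ball_finite) auto
  with assms(1) have "\<forall>\<^sub>F x in F. onorm (D x) \<le> (\<Sum>b\<in>Basis. K b)"
  proof eventually_elim
    case (elim x)
    then show ?case using onorm_le_sum_Basis[of "D x"] sum_mono[of Basis "\<lambda>b. norm (D x b)" K] by simp
  qed
  then show ?thesis by blast
qed

text \<open>For \<open>r = 0\<close> the growth condition and the jet condition both compare with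
  \<open>1 / norm x\<close>; anything bounded is negligible against it.\<close>

lemma eventually_bound_inverse_norm:
  "\<forall>\<^sub>F x::'b::euclidean_space in at 0. K \<le> c * norm (1 / norm x)" if "c > 0"
proof -
  have "(\<lambda>x::'b. K * norm x) \<midarrow>0\<rightarrow> 0"
    by (intro tendsto_mult_right_zero tendsto_norm_zero tendsto_ident_at)
  from order_tendstoD(2)[OF this \<open>c > 0\<close>] have "\<forall>\<^sub>F x::'b in at 0. K * norm x < c" .
  moreover have "\<forall>\<^sub>F x::'b in at 0. x \<noteq> 0" by (rule eventually_neq_at_within)
  ultimately show ?thesis by eventually_elim (simp add: field_simps)
qed

text \<open>\<open>P\<close> has \<open>r + 1\<close> derivatives off the origin, but flatness gives
  only \<open>r\<close> across it. For \<open>r = 0\<close> the additional derivative supplies the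
  first derivative that the class requires away from the origin, and it is bounded there.\<close>

lemma flat_perturbation_germ:
  fixes h P :: "'b::euclidean_space \<Rightarrow> 'c::euclidean_space"
  assumes h: "\<And>s. Cr_on s h (ball 0 \<epsilon>)" "h 0 = 0" "\<epsilon> > 0"
    and P: "P 0 = 0" "Cr_on (Suc r) P (- {0})"
    and flat: "\<And>vs. length vs \<le> Suc r \<Longrightarrow> \<exists>K. \<forall>x. x \<noteq> 0 \<longrightarrow> norm (dir_deriv vs P x) \<le> K * norm x ^ (Suc r - length vs)"
  shows "Cr_germ r (\<lambda>x. h x + P x)" and "same_jet r h (\<lambda>x. h x + P x)"
proof -
  let ?q = "\<lambda>x. h x + P x" and ?U = "ball (0::'b) \<epsilon>"
  have b0: "0 \<in> ?U" using h(3) by simp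
  have opU: "open (?U - {0})" by auto
  have PU: "Cr_on (Suc r) P (?U - {0})" by (rule Cr_on_subset[OF P(2)]) auto
  have ext: "Cr_on r P ?U \<and> (\<forall>vs. length vs \<le> r \<longrightarrow> dir_deriv vs P 0 = 0)"
  proof (rule flat_extension[where P = P, OF open_ball b0 _ P(1)])
    show "Cr_on r P (?U - {0})" by (rule Cr_on_le[OF PU]) simp
    show "\<exists>K. \<forall>x\<in>?U - {0}. norm (dir_deriv vs P x) \<le> K * norm x ^ (Suc r - length vs)"
      if "length vs \<le> r" for vs using flat[of vs] that by auto
  qed
  then have q: "Cr_on r ?q ?U" using Cr_on_add[OF open_ball h(1)] by blast
  have evU: "\<forall>\<^sub>F x in at 0. x \<in> ?U - {0}"
    using opU b0 unfolding eventually_at_topological by (intro exI[of _ ?U]) auto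
  have dP: "(P has_derivative frechet_derivative P (at x)) (at x)" if "x \<in> ?U - {0}" for x
    by (rule Cr_on_imp_has_derivative[OF PU that])
  have dh: "(h has_derivative frechet_derivative h (at x)) (at x)" if "x \<in> ?U" for x
    by (rule Cr_on_imp_has_derivative[OF h(1)[of 1, unfolded One_nat_def] that])
  have dq: "frechet_derivative ?q (at x) = (\<lambda>v. frechet_derivative h (at x) v + frechet_derivative P (at x) v)"
    if "x \<in> ?U - {0}" for x
    by (rule frechet_derivative_at[symmetric], rule has_derivative_add) (use dP dh that in auto)
  have Pb: "\<exists>K. \<forall>\<^sub>F x in at 0. norm (frechet_derivative P (at x) v) \<le> K" for v
  proof -
    obtain K where K: "\<And>x. x \<noteq> 0 \<Longrightarrow> norm (frechet_derivative P (at x) v) \<le> K * norm x ^ r"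
      using flat[of "[v]"] by auto
    have "\<forall>\<^sub>F x::'b in at 0. norm x < 1"
      by (rule order_tendstoD(2)[OF tendsto_norm_zero[OF tendsto_ident_at]]) simp
    with evU have "\<forall>\<^sub>F x in at 0. norm (frechet_derivative P (at x) v) \<le> \<bar>K\<bar>"
    proof eventually_elim
      case (elim x)
      have "norm (frechet_derivative P (at x) v) \<le> K * norm x ^ r" using K elim by simp
      also have "\<dots> \<le> \<bar>K\<bar> * 1" using elim by (intro mult_mono power_le_one) auto
      finally show ?case by simp
    qed
    then show ?thesis by blast
  qed
  have hb: "\<exists>K. \<forall>\<^sub>F x in at 0. norm (frechet_derivative h (at x) v) \<le> K" for v
  proof -
    have "continuous_on ?U (\<lambda>x. frechet_derivative h (at x) v)"
      using h(1)[of "Suc 0"] unfolding Cr_on_Suc Cr_on_0 by blast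
    then have "((\<lambda>x. frechet_derivative h (at x) v) \<longlongrightarrow> frechet_derivative h (at 0) v) (at 0)"
      using b0 by (simp add: continuous_on_eq_continuous_at isCont_def)
    then have "\<forall>\<^sub>F x in at 0. norm (frechet_derivative h (at x) v) < norm (frechet_derivative h (at 0) v) + 1"
      by (intro order_tendstoD(2)[OF tendsto_norm]) auto
    then show ?thesis by (blast intro: eventually_mono less_imp_le)
  qed
  have onP: "\<exists>K. \<forall>\<^sub>F x in at 0. onorm (frechet_derivative P (at x)) \<le> K"
    by (rule bounded_directional_derivatives_onorm[OF _ Pb])
       (rule eventually_mono[OF evU has_derivative_bounded_linear[OF dP]])
  have onq: "\<exists>K. \<forall>\<^sub>F x in at 0. onorm (frechet_derivative ?q (at x)) \<le> K"
  proof (rule bounded_directional_derivatives_onorm)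
    show "\<forall>\<^sub>F x in at 0. bounded_linear (frechet_derivative ?q (at x))"
      using evU
    proof eventually_elim
      case (elim x)
      then show ?case unfolding dq[OF elim]
        using has_derivative_bounded_linear[OF dP[OF elim]] has_derivative_bounded_linear[OF dh, of x]
        by (intro bounded_linear_add) auto
    qed
    fix v
    obtain K L where K: "\<forall>\<^sub>F x in at 0. norm (frechet_derivative P (at x) v) \<le> K"
      and L: "\<forall>\<^sub>F x in at 0. norm (frechet_derivative h (at x) v) \<le> L" using Pb hb by blast
    from evU K L have "\<forall>\<^sub>F x in at 0. norm (frechet_derivative ?q (at x) v) \<le> L + K"
    proof eventually_elim
      case (elim x)
      then show ?case unfolding dq[OF elim(1)] by (intro norm_triangle_mono)
    qed
    then show "\<exists>K. \<forall>\<^sub>F x in at 0. norm (frechet_derivative ?q (at x) v) \<le> K" by blast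
  qed
  show "Cr_germ r ?q"
  proof (cases "r = 0")
    case True
    have "Cr_on 1 ?q (?U - {0})"
      using Cr_on_add[OF opU Cr_on_subset[OF h(1) Diff_subset] PU] True by simp
    moreover have "(\<lambda>x. onorm (frechet_derivative ?q (at x))) \<in> O[at 0](\<lambda>x. 1 / norm x)"
    proof -
      obtain K where K: "\<forall>\<^sub>F x in at 0. onorm (frechet_derivative ?q (at x)) \<le> K" using onq by blast
      have pos: "\<forall>\<^sub>F x in at 0. 0 \<le> onorm (frechet_derivative ?q (at x))"
        using evU
      proof eventually_elim
        case (elim x)
        then show ?case unfolding dq[OF elim]
          using has_derivative_bounded_linear[OF dP[OF elim]] has_derivative_bounded_linear[OF dh, of x]
          by (intro onorm_pos_le bounded_linear_add) auto
      qed
      show ?thesis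
      proof (rule bigoI[where c = 1])
        from K pos eventually_bound_inverse_norm[OF zero_less_one, of K]
        show "\<forall>\<^sub>F x in at 0. norm (onorm (frechet_derivative ?q (at x))) \<le> 1 * norm (1 / norm x)"
          by eventually_elim simp
      qed
    qed
    ultimately show ?thesis
      using q h P True unfolding Cr_germ_def by (auto simp: Cr_on_0)
  next
    case False
    then show ?thesis using q h P unfolding Cr_germ_def by auto
  qed
  show "same_jet r h ?q"
  proof (cases "r = 0")
    case True
    have "(\<lambda>x. onorm (\<lambda>v. frechet_derivative h (at x) v - frechet_derivative ?q (at x) v)) \<in> o[at 0](\<lambda>x. 1 / norm x)"
    proof (rule landau_o.smallI)
      fix c :: real assume c: "c > 0"
      obtain K where K: "\<forall>\<^sub>F x in at 0. onorm (frechet_derivative P (at x)) \<le> K" using onP by blast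
      from evU K eventually_bound_inverse_norm[OF c, of K]
      show "\<forall>\<^sub>F x in at 0. norm (onorm (\<lambda>v. frechet_derivative h (at x) v - frechet_derivative ?q (at x) v)) \<le> c * norm (1 / norm x)"
      proof eventually_elim
        case (elim x)
        have "onorm (\<lambda>v. frechet_derivative h (at x) v - frechet_derivative ?q (at x) v) = onorm (frechet_derivative P (at x))"
          unfolding dq[OF elim(1)] using onorm_neg[of "frechet_derivative P (at x)"] by simp
        moreover have "0 \<le> onorm (frechet_derivative P (at x))"
          by (rule onorm_pos_le[OF has_derivative_bounded_linear[OF dP[OF elim(1)]]])
        ultimately show ?case using elim by simp
      qed
    qed
    then show ?thesis using True unfolding same_jet_def by simp
  next
    case False
    have "dir_deriv vs h 0 = dir_deriv vs ?q 0" if "length vs \<le> r" for vs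
      using dir_deriv_add[OF open_ball b0 h(1) conjunct1[OF ext] that] ext that by simp
    then show ?thesis using False unfolding same_jet_def by simp
  qed
qed

text \<open>The modification near \<open>a i\<close> is \<open>s i *s R x + L i (x - a i)\<close>.
  Both terms are of size \<open>norm (a i) ^ Suc r\<close> on the annulus: \<open>R\<close> vanishes
  to order \<open>r + 1\<close> and \<open>s i\<close> is bounded, while \<open>L i\<close> is of
  size \<open>norm (a i) ^ r\<close> and acts on vectors of length at most
  \<open>3 * norm (a i)\<close>. As \<open>s i\<close> may change with \<open>i\<close>, one
  \<open>q\<close> can follow different members of the family.\<close>

theorem jet_interpolation:
  fixes h R :: "'a::{real_normed_field,euclidean_space}^'n \<Rightarrow> 'a^'m" and a :: "nat \<Rightarrow> 'a^'n"
  assumes h: "has_series \<alpha> c \<epsilon> h" "h 0 = 0" "\<epsilon> > 0"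
    and R: "has_series \<alpha> d \<epsilon> R" "order_ge (Suc r) \<alpha> d"
    and a: "\<And>i. a i \<noteq> 0" "\<And>i. norm (a (Suc i)) < norm (a i) / 4"
      "\<And>i. 2 * norm (a i) < \<epsilon>" "\<And>i. 2 * norm (a i) < \<epsilon> / (2 * norm ((\<chi> i. 1) :: 'a^'n))"
    and s: "\<And>i. norm (s i) \<le> S"
    and L: "\<And>i. bounded_linear (L i)" "\<And>i v. norm (L i v) \<le> M * norm (a i) ^ r * norm v" "M \<ge> 0"
  obtains q where "Cr_germ r q" "same_jet r h q" "\<And>i. q (a i) = h (a i) + s i *s R (a i)"
    "\<And>i. (q has_derivative (\<lambda>v. frechet_derivative h (at (a i)) v
        + (s i *s frechet_derivative R (at (a i)) v + L i v))) (at (a i))"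
proof -
  define V where "V = (\<lambda>i. {x :: 'a^'n. norm (a i) / 2 < norm x \<and> norm x < 2 * norm (a i)})"
  define G where "G = (\<lambda>i x. s i *s R x + L i (x - a i))"
  have \<rho>: "norm (a i) > 0" for i using a(1) by simp
  have opV: "open (V i)" for i
    unfolding V_def by (intro open_Collect_conj open_Collect_less continuous_intros)
  interpret scaled_domains "\<lambda>i. norm (a i)" V by standard (use \<rho> opV in auto)
  have sd: "scaled_domains (\<lambda>i. norm (a i)) V" by unfold_locales
  have close: "norm (x - a i) \<le> 3 * norm (a i)" if "x \<in> V i" for x i
    using that norm_triangle_ineq4[of x "a i"] by (simp add: V_def)
  have R': "derivs_bounded (Suc r) (\<lambda>i. norm (a i) ^ Suc r) (\<lambda>_. R)"
  proof (rule derivs_bounded_series[OF sd R(1) h(3) R(2)])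
    fix i x assume "x \<in> V i"
    then show "norm x < \<epsilon> \<and> norm x < \<epsilon> / (2 * norm ((\<chi> i. 1) :: 'a^'n)) \<and> norm x \<le> 2 * norm (a i)"
      using a(3,4)[of i] by (auto simp: V_def)
  qed
  have "derivs_bounded (Suc r) (\<lambda>i. 1 * norm (a i) ^ Suc r) (\<lambda>i x. s i *s R x)"
    by (rule derivs_bounded_bilinear[OF bounded_bilinear_vector_smult derivs_bounded_const[where K=S] R'])
       (use s in simp)
  then have sR: "derivs_bounded (Suc r) (\<lambda>i. norm (a i) ^ Suc r) (\<lambda>i x. s i *s R x)" by (simp only: mult_1_left)
  have "derivs_bounded (Suc r) (\<lambda>i. M * norm (a i) ^ r * norm (a i)) (\<lambda>i x. L i (x - a i))"
    by (rule derivs_bounded_linear[OF L(1,2) close]) (use L(3) in auto)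
  then have "derivs_bounded (Suc r) (\<lambda>i. M * norm (a i) ^ Suc r) (\<lambda>i x. L i (x - a i))"
    by (simp only: mult.assoc power_Suc2)
  then have LV: "derivs_bounded (Suc r) (\<lambda>i. norm (a i) ^ Suc r) (\<lambda>i x. L i (x - a i))"
    by (rule derivs_bounded_weight_cmult)
  have G: "derivs_bounded (Suc r) (\<lambda>i. norm (a i) ^ Suc r) G"
    unfolding G_def by (rule derivs_bounded_add[OF sR LV])
  obtain P where P: "P 0 = 0" "Cr_on (Suc r) P (- {0})"
    "\<And>vs. length vs \<le> Suc r \<Longrightarrow> \<exists>K. \<forall>x. x \<noteq> 0 \<longrightarrow> norm (dir_deriv vs P x) \<le> K * norm x ^ (Suc r - length vs)"
    and PG: "\<And>i. P (a i) = G i (a i)"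
    "\<And>i. (P has_derivative frechet_derivative (G i) (at (a i))) (at (a i))"
    using flat_interpolation[OF a(1,2) G[unfolded V_def]] by blast
  have ab: "a i \<in> ball 0 \<epsilon>" for i
    unfolding mem_ball_0 using a(3)[of i] norm_ge_zero[of "a i"] by linarith
  have L0: "L i 0 = 0" for i using L(2)[of i 0] by simp
  show ?thesis
  proof (rule that[of "\<lambda>x. h x + P x"])
    show "Cr_germ r (\<lambda>x. h x + P x)" "same_jet r h (\<lambda>x. h x + P x)"
      using flat_perturbation_germ[OF has_series_Cr_on[OF h(1)] h(2,3) P] by blast+
    show "h (a i) + P (a i) = h (a i) + s i *s R (a i)" for i
      by (simp add: PG G_def L0)
    fix i
    have dh: "(h has_derivative frechet_derivative h (at (a i))) (at (a i))"
      by (rule Cr_on_imp_has_derivative[OF has_series_Cr_on[OF h(1), of 1, unfolded One_nat_def] ab])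
    have dR: "(R has_derivative frechet_derivative R (at (a i))) (at (a i))"
      by (rule Cr_on_imp_has_derivative[OF has_series_Cr_on[OF R(1), of 1, unfolded One_nat_def] ab])
    have dL: "((\<lambda>x. L i (x - a i)) has_derivative L i) (at (a i))"
      by (rule bounded_linear.has_derivative[OF L(1), of "\<lambda>x. x - a i" "\<lambda>v. v", simplified])
         (auto intro!: derivative_eq_intros)
    have "(G i has_derivative (\<lambda>v. s i *s frechet_derivative R (at (a i)) v + L i v)) (at (a i))"
      unfolding G_def
      by (intro has_derivative_add dL bounded_linear.has_derivative[OF
            bounded_bilinear.bounded_linear_right[OF bounded_bilinear_vector_smult] dR])
    from frechet_derivative_at[OF this] PG(2)[of i]
    have dP: "(P has_derivative (\<lambda>v. s i *s frechet_derivative R (at (a i)) v + L i v)) (at (a i))" by simp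
    show "((\<lambda>x. h x + P x) has_derivative (\<lambda>v. frechet_derivative h (at (a i)) v
        + (s i *s frechet_derivative R (at (a i)) v + L i v))) (at (a i))"
      by (rule has_derivative_add[OF dh dP])
  qed
qed

section \<open>Conjugation and linear functionals over the scalar field\<close>

text \<open>By polarisation the inner product is a combination of squared norms, and multiplication
  by \<open>z\<close> scales all of them by the same factor.\<close>

lemma inner_mult_mult:
  fixes x y z :: "'a::{real_normed_field,euclidean_space}"
  shows "(x * z) \<bullet> (y * z) = (x \<bullet> y) * (norm z)\<^sup>2"
proof -
  have pol: "2 * (u \<bullet> v) = (norm (u + v))\<^sup>2 - (norm u)\<^sup>2 - (norm v)\<^sup>2" for u v :: 'a
    by (simp add: power2_norm_eq_inner inner_add_left inner_add_right inner_commute)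
  have "2 * ((x * z) \<bullet> (y * z)) = (2 * (x \<bullet> y)) * (norm z)\<^sup>2"
    unfolding pol distrib_right[symmetric]
    by (simp only: norm_mult power_mult_distrib left_diff_distrib)
  then show ?thesis by simp
qed

text \<open>Polarising the multiplicativity of the norm, as for composition algebras, shows that every
  element satisfies its characteristic equation.\<close>

lemma mult_conjugate:
  fixes z :: "'a::{real_normed_field,euclidean_space}"
  shows "z * conjugate z = of_real ((norm z)\<^sup>2)"
proof -
  \<comment> \<open>A second polarisation, now in the common factor. The instance with
    \<open>x\<close> equal to \<open>z\<close> and \<open>w = 1\<close> determines the inner
    products of \<open>z * z\<close> with all \<open>y\<close>.\<close>
  have pol: "(x * z) \<bullet> (y * w) + (x * w) \<bullet> (y * z) = 2 * (x \<bullet> y) * (z \<bullet> w)" for x y z w :: 'a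
  proof -
    have "(x * (z + w)) \<bullet> (y * (z + w)) = (x \<bullet> y) * (norm (z + w))\<^sup>2" by (rule inner_mult_mult)
    moreover have "(norm (z + w))\<^sup>2 = (norm z)\<^sup>2 + 2 * (z \<bullet> w) + (norm w)\<^sup>2"
      by (simp add: power2_norm_eq_inner inner_add_left inner_add_right inner_commute)
    ultimately show ?thesis
      using inner_mult_mult[of x z y] inner_mult_mult[of x w y]
      by (simp add: algebra_simps inner_add_left inner_add_right)
  qed
  have "(z * z) \<bullet> y = ((2 * (z \<bullet> 1)) *\<^sub>R z - (norm z)\<^sup>2 *\<^sub>R 1) \<bullet> y" for y
  proof -
    have "(z * z) \<bullet> y + z \<bullet> (y * z) = 2 * (z \<bullet> y) * (z \<bullet> 1)"
      using pol[of z z y 1] by (simp only: mult_1_right)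
    moreover have "z \<bullet> (y * z) = (1 \<bullet> y) * (norm z)\<^sup>2"
      using inner_mult_mult[of 1 z y] by (simp only: mult_1_left)
    ultimately have "(z * z) \<bullet> y = 2 * (z \<bullet> y) * (z \<bullet> 1) - (1 \<bullet> y) * (norm z)\<^sup>2" by linarith
    then show ?thesis by (simp only: inner_diff_left inner_scaleR_left mult_ac)
  qed
  then have "z * z = (2 * (z \<bullet> 1)) *\<^sub>R z - (norm z)\<^sup>2 *\<^sub>R 1"
    by (rule vector_eq_rdot[THEN iffD1, OF allI])
  then show ?thesis
    by (simp add: conjugate_def algebra_simps scaleR_conv_of_real of_real_mult)
qed

lemma conjugate_0 [simp]: "conjugate 0 = 0"
  by (simp add: conjugate_def)

lemma conjugate_add: "conjugate (x + y) = conjugate x + conjugate y"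
  by (simp add: conjugate_def inner_add_left algebra_simps)

lemma norm_conjugate [simp]: "norm (conjugate z) = norm z"
proof (cases "z = 0")
  case False
  have "norm z * norm (conjugate z) = norm z * norm z"
    unfolding norm_mult[symmetric, of z "conjugate z"] mult_conjugate norm_of_real
    by (simp add: power2_eq_square)
  with False show ?thesis by simp
qed simp

lemma conjugate_eq_divide: "z \<noteq> 0 \<Longrightarrow> conjugate z = of_real ((norm z)\<^sup>2) / z"
  using mult_conjugate[of z] by (simp add: field_simps)

text \<open>Away from 0 the conjugate is \<open>norm z ^ 2 / z\<close>, and the norm and the inverse
  are both multiplicative.\<close>

lemma conjugate_mult: "conjugate (x * y) = conjugate x * conjugate y"
proof (cases "x = 0 \<or> y = 0")
  case False
  then show ?thesis by (simp add: conjugate_eq_divide norm_mult power_mult_distrib)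
qed auto

lemma conjugate_conjugate [simp]: "conjugate (conjugate z) = z"
proof (cases "z = 0")
  case False
  then have "conjugate z \<noteq> 0" by (metis norm_conjugate norm_eq_zero)
  from conjugate_eq_divide[OF this] have "conjugate (conjugate z) = of_real ((norm z)\<^sup>2) / conjugate z"
    by (simp only: norm_conjugate)
  also have "\<dots> = of_real ((norm z)\<^sup>2) / (of_real ((norm z)\<^sup>2) / z)"
    by (simp only: conjugate_eq_divide[OF False])
  also have "\<dots> = z" using False by simp
  finally show ?thesis .
qed simp

lemma conjugate_sum: "conjugate (\<Sum>i\<in>I. f i) = (\<Sum>i\<in>I. conjugate (f i))"
  by (induction I rule: infinite_finite_induct) (simp_all add: conjugate_add)

section \<open>Covectors and their norms\<close>

definition dotK :: "'a::comm_ring_1^'n \<Rightarrow> 'a^'n \<Rightarrow> 'a" where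
  "dotK a x = (\<Sum>i\<in>UNIV. a $ i * x $ i)"

lemma dotK_add_right: "dotK a (x + y) = dotK a x + dotK a y"
  by (simp add: dotK_def algebra_simps sum.distrib)

lemma dotK_smult_right: "dotK a (c *s x) = c * dotK a x"
  by (simp add: dotK_def algebra_simps sum_distrib_left)

lemma dotK_zero [simp]: "dotK a 0 = 0" "dotK 0 x = 0"
  by (simp_all add: dotK_def)

lemma dotK_axis: "dotK a (axis i 1) = a $ i"
  by (simp add: dotK_def axis_def if_distrib[of "(*) _"] cong: if_cong)

lemma norm_dotK_le:
  fixes a x :: "'a::{real_normed_field,euclidean_space}^'n"
  shows "norm (dotK a x) \<le> real CARD('n) * (norm a * norm x)"
proof -
  have "norm (dotK a x) \<le> (\<Sum>i\<in>(UNIV :: 'n set). norm a * norm x)"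
    unfolding dotK_def
    by (rule sum_norm_le) (auto simp: norm_mult intro!: mult_mono Finite_Cartesian_Product.norm_nth_le)
  then show ?thesis by simp
qed

text \<open>The conjugate of \<open>b\<close> divided by \<open>norm b ^ 2\<close> attains equality
  in the Cauchy-Schwarz inequality, so \<open>y\<close> is as short as \<open>dotK b y = 1\<close>
  permits.\<close>

lemma dotK_unit_exists:
  fixes b :: "'a::{real_normed_field,euclidean_space}^'n"
  assumes "b \<noteq> 0"
  obtains y where "dotK b y = 1" "norm y = 1 / norm b"
proof
  let ?c = "\<chi> j. conjugate (b $ j)"
  have "dotK b ?c = of_real ((norm b)\<^sup>2)"
    by (simp add: dotK_def mult_conjugate norm_vec_def L2_set_def sum_nonneg)
  then show "dotK b (of_real (1 / (norm b)\<^sup>2) *s ?c) = 1"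
    using assms by (simp add: dotK_smult_right flip: of_real_power)
  have "norm ?c = norm b" by (simp add: norm_vec_def)
  then show "norm (of_real (1 / (norm b)\<^sup>2) *s ?c) = 1 / norm b"
    unfolding norm_vector_smult norm_of_real using assms by (simp add: power2_eq_square)
qed

section \<open>Scalar multiplication and linear functionals on the product space\<close>

lemma scaleK_simps:
  "scaleK c (u + v) = scaleK c u + scaleK c v" "scaleK (c + d) u = scaleK c u + scaleK d u"
  "scaleK c (scaleK d u) = scaleK (c * d) u" "scaleK 1 u = u" "scaleK 0 u = 0"
  "fst (scaleK c u) = c *s fst u" "snd (scaleK c u) = c *s snd u"
  by (simp_all add: scaleK_def vector_add_ldistrib vector_sadd_rdistrib vector_smult_assoc prod_eq_iff)

lemma bounded_bilinear_scaleK: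
  "bounded_bilinear (scaleK :: 'a::{real_normed_field,euclidean_space} \<Rightarrow> ('a^'n) \<times> ('a^'m) \<Rightarrow> _)"
proof (rule bounded_bilinear.intro)
  have "norm (scaleK a b) = norm a * norm b" for a :: 'a and b :: "('a^'n) \<times> ('a^'m)"
    by (simp add: scaleK_def norm_prod_def norm_vector_smult power_mult_distrib real_sqrt_mult
        flip: distrib_left)
  then show "\<exists>K. \<forall>(a::'a) b::('a^'n) \<times> ('a^'m). norm (scaleK a b) \<le> norm a * norm b * K"
    by (intro exI[of _ 1]) simp
qed (simp_all add: scaleK_simps, simp_all add: scaleK_def vec_eq_iff)

definition K_linear :: "(('a::{real_normed_field,euclidean_space}^'n) \<times> ('a^'m) \<Rightarrow> 'a) \<Rightarrow> bool" where
  "K_linear \<phi> \<longleftrightarrow> (\<forall>u v. \<phi> (u + v) = \<phi> u + \<phi> v) \<and> (\<forall>c v. \<phi> (scaleK c v) = c * \<phi> v)"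

lemma K_linear_add: "K_linear \<phi> \<Longrightarrow> \<phi> (u + v) = \<phi> u + \<phi> v"
  and K_linear_scaleK: "K_linear \<phi> \<Longrightarrow> \<phi> (scaleK c v) = c * \<phi> v"
  unfolding K_linear_def by blast+

lemma K_linear_zero: "K_linear \<phi> \<Longrightarrow> \<phi> 0 = 0"
  using K_linear_scaleK[of \<phi> 0 0] by (simp add: scaleK_simps)

lemma K_linear_diff: "K_linear \<phi> \<Longrightarrow> \<phi> (u - v) = \<phi> u - \<phi> v"
  using K_linear_add[of \<phi> "u - v" v] by (simp add: algebra_simps)

lemma K_linear_sum: "K_linear \<phi> \<Longrightarrow> \<phi> (\<Sum>i\<in>I. f i) = (\<Sum>i\<in>I. \<phi> (f i))"
  by (induction I rule: infinite_finite_induct) (simp_all add: K_linear_add K_linear_zero)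

lemma K_linear_combination:
  "(\<And>i. i \<in> I \<Longrightarrow> K_linear (\<phi> i)) \<Longrightarrow> K_linear (\<lambda>v. \<Sum>i\<in>I. c i * \<phi> i v)"
  unfolding K_linear_def
  by (simp add: algebra_simps sum.distrib sum_distrib_left del: split_paired_All)

lemma K_linear_dotK:
  fixes \<phi> :: "('a::{real_normed_field,euclidean_space}^'n) \<times> ('a^'m) \<Rightarrow> 'a"
  assumes "K_linear \<phi>"
  obtains a b where "\<And>v. \<phi> v = dotK a (fst v) + dotK b (snd v)"
proof
  fix v :: "('a^'n) \<times> ('a^'m)"
  have "v = (\<Sum>i\<in>UNIV. scaleK (fst v $ i) (axis i 1, 0)) + (\<Sum>j\<in>UNIV. scaleK (snd v $ j) (0, axis j 1))"
    by (simp add: prod_eq_iff fst_sum snd_sum scaleK_simps basis_expansion)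
  then have "\<phi> v = \<phi> ((\<Sum>i\<in>UNIV. scaleK (fst v $ i) (axis i 1, 0)) + (\<Sum>j\<in>UNIV. scaleK (snd v $ j) (0, axis j 1)))"
    by (rule arg_cong)
  also have "\<dots> = dotK (\<chi> i. \<phi> (axis i 1, 0)) (fst v) + dotK (\<chi> j. \<phi> (0, axis j 1)) (snd v)"
    by (simp add: K_linear_add[OF assms] K_linear_sum[OF assms] K_linear_scaleK[OF assms] dotK_def mult.commute)
  finally show "\<phi> v = dotK (\<chi> i. \<phi> (axis i 1, 0)) (fst v) + dotK (\<chi> j. \<phi> (0, axis j 1)) (snd v)" .
qed

text \<open>Induction in the style of Gram and Schmidt: \<open>\<psi>\<close> is the new functional
  minus its expansion along the earlier ones, and it is nonzero by independence. A vector on which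
  it does not vanish is cleared of its \<open>e\<close>-components and normalised, and multiples of
  the result correct the old \<open>e j\<close>.\<close>

lemma dual_system_exists:
  fixes \<phi> :: "nat \<Rightarrow> ('a::{real_normed_field,euclidean_space}^'n) \<times> ('a^'m) \<Rightarrow> 'a"
  assumes "\<And>i. i < d \<Longrightarrow> K_linear (\<phi> i)"
    and "\<And>c. (\<And>v. (\<Sum>i<d. c i * \<phi> i v) = 0) \<Longrightarrow> \<forall>i<d. c i = 0"
  shows "\<exists>e. \<forall>i<d. \<forall>j<d. \<phi> i (e j) = (if i = j then 1 else 0)"
  using assms
proof (induction d)
  case (Suc d)
  have lin: "K_linear (\<phi> i)" if "i \<le> d" for i using Suc.prems(1)[of i] that by simp
  have ind: "\<forall>i<d. c i = 0" if c: "\<And>v. (\<Sum>i<d. c i * \<phi> i v) = 0" for c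
  proof -
    let ?c = "\<lambda>i. if i = d then 0 else c i"
    have eq: "(\<Sum>i<d. ?c i * \<phi> i v) = (\<Sum>i<d. c i * \<phi> i v)" for v
      by (rule sum.cong) auto
    have "(\<Sum>i<Suc d. ?c i * \<phi> i v) = 0" for v
      unfolding sum.lessThan_Suc eq c by simp
    then have all: "\<forall>i<Suc d. ?c i = 0" by (rule Suc.prems(2))
    show ?thesis
    proof (intro allI impI)
      fix i assume "i < d"
      then show "c i = 0" using all[rule_format, of i] by simp
    qed
  qed
  have "\<exists>e. \<forall>i<d. \<forall>j<d. \<phi> i (e j) = (if i = j then 1 else 0)"
    by (rule Suc.IH[OF lin[OF less_imp_le] ind])
  then obtain e where e: "\<And>i j. i < d \<Longrightarrow> j < d \<Longrightarrow> \<phi> i (e j) = (if i = j then 1 else 0)" by blast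
  define \<psi> where "\<psi> = (\<lambda>w. \<phi> d w - (\<Sum>i<d. \<phi> d (e i) * \<phi> i w))"
  have "\<exists>w. \<psi> w \<noteq> 0"
  proof (rule ccontr)
    assume "\<nexists>w. \<psi> w \<noteq> 0"
    then have \<psi>0: "\<psi> v = 0" for v by blast
    have "(\<Sum>i<Suc d. (if i = d then 1 else - \<phi> d (e i)) * \<phi> i v) = 0" for v
      using \<psi>0[of v] unfolding \<psi>_def by (simp add: sum_negf)
    then have "\<forall>i<Suc d. (if i = d then 1 else - \<phi> d (e i)) = 0" by (rule Suc.prems(2))
    from this[rule_format, of d] show False by simp
  qed
  then obtain w where w: "\<psi> w \<noteq> 0" ..
  define w' where "w' = w - (\<Sum>i<d. scaleK (\<phi> i w) (e i))"
  have \<phi>w': "\<phi> i w' = \<phi> i w - (\<Sum>j<d. \<phi> j w * \<phi> i (e j))" if "i \<le> d" for i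
    unfolding w'_def by (simp add: K_linear_diff K_linear_sum K_linear_scaleK lin[OF that])
  have w'0: "\<phi> i w' = 0" if "i < d" for i
  proof -
    have "(\<Sum>j<d. \<phi> j w * \<phi> i (e j)) = (\<Sum>j<d. if i = j then \<phi> j w else 0)"
      using e[OF that] by (intro sum.cong) auto
    then show ?thesis using that by (simp add: \<phi>w')
  qed
  have w'd: "\<phi> d w' = \<psi> w" by (simp add: \<phi>w' \<psi>_def mult.commute)
  define f where "f = scaleK (1 / \<psi> w) w'"
  have fi: "\<phi> i f = (if i = d then 1 else 0)" if "i \<le> d" for i
    using that w w'0 w'd unfolding f_def by (auto simp: K_linear_scaleK[OF lin[OF that]])
  define e' where "e' = (\<lambda>j. if j = d then f else e j - scaleK (\<phi> d (e j)) f)"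
  have "\<phi> i (e' j) = (if i = j then 1 else 0)" if "i < Suc d" "j < Suc d" for i j
  proof (cases "j = d")
    case True
    then show ?thesis using fi that by (simp add: e'_def)
  next
    case False
    then have "\<phi> i (e' j) = \<phi> i (e j) - \<phi> d (e j) * \<phi> i f"
      using lin[of i] that by (simp add: e'_def K_linear_diff K_linear_scaleK)
    then show ?thesis using fi[of i] e[of i j] that False by (cases "i = d") auto
  qed
  then show ?case by blast
qed simp

text \<open>Subtracting the \<open>e\<close>-components moves any \<open>v\<close> into the common
  kernel, where \<open>\<psi>\<close> vanishes.\<close>

lemma functional_in_span:
  fixes \<phi> :: "nat \<Rightarrow> ('a::{real_normed_field,euclidean_space}^'n) \<times> ('a^'m) \<Rightarrow> 'a"
  assumes "\<And>i. i < d \<Longrightarrow> K_linear (\<phi> i)" "K_linear \<psi>"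
    and e: "\<And>i j. i < d \<Longrightarrow> j < d \<Longrightarrow> \<phi> i (e j) = (if i = j then 1 else 0)"
    and "\<And>v. (\<And>i. i < d \<Longrightarrow> \<phi> i v = 0) \<Longrightarrow> \<psi> v = 0"
  shows "\<psi> v = (\<Sum>i<d. \<psi> (e i) * \<phi> i v)"
proof -
  have "\<phi> j (v - (\<Sum>i<d. scaleK (\<phi> i v) (e i))) = 0" if "j < d" for j
  proof -
    have "(\<Sum>i<d. \<phi> i v * \<phi> j (e i)) = (\<Sum>i<d. if j = i then \<phi> i v else 0)"
      using e[OF that] by (intro sum.cong) auto
    then show ?thesis
      using that by (simp add: K_linear_diff K_linear_sum K_linear_scaleK assms(1)[OF that])
  qed
  then have "\<psi> (v - (\<Sum>i<d. scaleK (\<phi> i v) (e i))) = 0" by (rule assms(4))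
  then show ?thesis
    by (simp add: K_linear_diff K_linear_sum K_linear_scaleK assms(2) mult.commute)
qed

section \<open>Tangent spaces\<close>

lemma K_smooth_on_has_derivative:
  "K_smooth_on g U \<Longrightarrow> z \<in> U \<Longrightarrow> (g has_derivative frechet_derivative g (at z)) (at z)"
  unfolding K_smooth_on_def by (rule Cr_on_imp_has_derivative[of 0]) auto

lemma K_smooth_on_K_linear:
  assumes "K_smooth_on g U" "z \<in> U"
  shows "K_linear (frechet_derivative g (at z))"
proof -
  have "linear (frechet_derivative g (at z))"
    by (rule has_derivative_linear[OF K_smooth_on_has_derivative[OF assms]])
  then show ?thesis
    using assms unfolding K_linear_def K_smooth_on_def by (auto simp: linear_add)
qed

lemma tangent_space_graph:
  fixes q :: "'b::euclidean_space \<Rightarrow> 'c::euclidean_space"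
  assumes "v \<in> tangent_space (graph q) (x, q x)" "(q has_derivative D) (at x)"
  shows "snd v = D (fst v)"
proof -
  obtain \<gamma> where \<gamma>: "\<gamma> 0 = (x, q x)" "(\<gamma> has_vector_derivative v) (at 0)" "\<forall>\<^sub>F t in at 0. \<gamma> t \<in> graph q"
    using assms(1) by (auto simp: tangent_space_def)
  have d: "(\<gamma> has_derivative (\<lambda>t. t *\<^sub>R v)) (at 0)" using \<gamma>(2) by (simp add: has_vector_derivative_def)
  have 1: "((\<lambda>t. fst (\<gamma> t)) has_derivative (\<lambda>t. fst (t *\<^sub>R v))) (at 0)"
    and 2: "((\<lambda>t. snd (\<gamma> t)) has_derivative (\<lambda>t. snd (t *\<^sub>R v))) (at 0)"
    by (rule has_derivative_fst[OF d], rule has_derivative_snd[OF d])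
  have "((\<lambda>t. q (fst (\<gamma> t))) has_derivative (\<lambda>t. D (fst (t *\<^sub>R v)))) (at 0)"
    by (rule has_derivative_compose[OF 1]) (simp add: \<gamma>(1) assms(2))
  then have 3: "((\<lambda>t. snd (\<gamma> t)) has_derivative (\<lambda>t. D (fst (t *\<^sub>R v)))) (at 0)"
    by (rule has_derivative_transform_eventually)
       (use \<gamma>(1,3) in \<open>auto simp: graph_def elim!: eventually_mono\<close>)
  show ?thesis using fun_cong[OF has_derivative_unique[OF 2 3], of 1] by simp
qed

lemma tangent_space_subset_kernel:
  fixes g :: "'b::euclidean_space \<Rightarrow> 'c::euclidean_space"
  assumes "v \<in> tangent_space M p" "open U" "p \<in> U" "\<And>z. z \<in> M \<inter> U \<Longrightarrow> g z = 0" "p \<in> M"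
    and "(g has_derivative D) (at p)"
  shows "D v = 0"
proof -
  obtain \<gamma> where \<gamma>: "\<gamma> 0 = p" "(\<gamma> has_vector_derivative v) (at 0)" "\<forall>\<^sub>F t in at 0. \<gamma> t \<in> M"
    using assms(1) by (auto simp: tangent_space_def)
  have d: "(\<gamma> has_derivative (\<lambda>t. t *\<^sub>R v)) (at 0)" using \<gamma>(2) by (simp add: has_vector_derivative_def)
  have 1: "((\<lambda>t. g (\<gamma> t)) has_derivative (\<lambda>t. D (t *\<^sub>R v))) (at 0)"
    by (rule has_derivative_compose[OF d]) (simp add: \<gamma>(1) assms(6))
  have "(\<gamma> \<longlongrightarrow> p) (at 0)"
    using has_derivative_continuous[OF d] \<gamma>(1) by (simp add: continuous_at isCont_def)
  then have "\<forall>\<^sub>F t in at 0. \<gamma> t \<in> U" using assms(2,3) by (rule topological_tendstoD)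
  with \<gamma>(3) have ev: "\<forall>\<^sub>F t in at 0. g (\<gamma> t) = 0"
    by eventually_elim (simp add: assms(4))
  have "((\<lambda>t. 0) has_derivative (\<lambda>t. D (t *\<^sub>R v))) (at (0::real))"
    by (rule has_derivative_transform_eventually[OF 1 ev]) (use assms \<gamma>(1) in auto)
  from fun_cong[OF has_derivative_unique[OF this has_derivative_const], of 1] show ?thesis by simp
qed

text \<open>A curve in \<open>M\<close> with velocity \<open>v\<close> comes from straightening
  \<open>M\<close> near \<open>p\<close>: the local diffeomorphism \<open>F\<close> has the identity
  as its derivative at \<open>p\<close> and carries the zero set of the \<open>g i\<close> into the
  common kernel of their differentials at \<open>p\<close>. The curve is the preimage of the line
  spanned by \<open>v\<close>.\<close>

theorem kernel_subset_tangent_space: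
  fixes M :: "(('a::{real_normed_field,euclidean_space}^'n) \<times> ('a^'m)) set"
    and g :: "nat \<Rightarrow> ('a^'n) \<times> ('a^'m) \<Rightarrow> 'a"
  assumes U: "open U" "p \<in> U" "p \<in> M" and g: "\<And>i. i < d \<Longrightarrow> K_smooth_on (g i) U"
    and M: "M \<inter> U = {z\<in>U. \<forall>i<d. g i z = 0}"
    and e: "\<And>i j. i < d \<Longrightarrow> j < d \<Longrightarrow> frechet_derivative (g i) (at p) (e j) = (if i = j then 1 else 0)"
    and v: "\<And>i. i < d \<Longrightarrow> frechet_derivative (g i) (at p) v = 0"
  shows "v \<in> tangent_space M p"
proof -
  define D where "D = (\<lambda>i z. frechet_derivative (g i) (at z))"
  define \<pi> where "\<pi> = (\<lambda>w. \<Sum>i<d. scaleK (D i p w) (e i))"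
  \<comment> \<open>The components of \<open>z - p\<close> along the \<open>e i\<close> are replaced
    by the values \<open>g i z\<close>, so that \<open>g j\<close> becomes the linear functional
    \<open>D j p\<close> composed with \<open>F\<close>.\<close>
  define F where "F = (\<lambda>z. (z - p) - \<pi> (z - p) + (\<Sum>i<d. scaleK (g i z) (e i)))"
  define F' where "F' = (\<lambda>z w. w - \<pi> w + (\<Sum>i<d. scaleK (D i z w) (e i)))"
  have dg: "(g i has_derivative D i z) (at z)" if "i < d" "z \<in> U" for i z
    unfolding D_def by (rule K_smooth_on_has_derivative[OF g[OF that(1)] that(2)])
  have lin: "K_linear (D i p)" if "i < d" for i
    unfolding D_def by (rule K_smooth_on_K_linear[OF g[OF that] U(2)])
  have blsc: "bounded_linear (\<lambda>c. scaleK c (e i))" for i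
    by (rule bounded_bilinear.bounded_linear_left[OF bounded_bilinear_scaleK])
  have bl\<pi>: "bounded_linear \<pi>"
    unfolding \<pi>_def
    by (intro bounded_linear_sum bounded_linear_compose[OF blsc] has_derivative_bounded_linear[OF dg])
       (use U in auto)
  have blF': "bounded_linear (F' z)" if "z \<in> U" for z
    unfolding F'_def
    by (intro bounded_linear_add bounded_linear_sub bounded_linear_ident bl\<pi> bounded_linear_sum
        bounded_linear_compose[OF blsc] has_derivative_bounded_linear[OF dg[OF _ that]]) auto
  have dF: "(F has_derivative F' z) (at z)" if "z \<in> U" for z
  proof -
    have id: "((\<lambda>z. z - p) has_derivative (\<lambda>w. w)) (at z)" by (auto intro!: derivative_eq_intros)
    show ?thesis
      unfolding F_def F'_def
      by (intro has_derivative_add has_derivative_diff id bounded_linear.has_derivative[OF bl\<pi> id]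
          has_derivative_sum bounded_linear.has_derivative[OF blsc] dg that) auto
  qed
  have \<phi>\<pi>: "D j p (\<Sum>i<d. scaleK (c i) (e i)) = c j" if "j < d" for j c
  proof -
    have "D j p (\<Sum>i<d. scaleK (c i) (e i)) = (\<Sum>i<d. c i * D j p (e i))"
      by (simp add: K_linear_sum[OF lin[OF that]] K_linear_scaleK[OF lin[OF that]])
    also have "\<dots> = (\<Sum>i<d. if j = i then c i else 0)"
      using e that by (intro sum.cong) (auto simp: D_def)
    finally show ?thesis using that by simp
  qed
  have gF: "g j z = D j p (F z)" if "j < d" for j z
    unfolding F_def \<pi>_def K_linear_add[OF lin[OF that]] K_linear_diff[OF lin[OF that], of "z - p"] \<phi>\<pi>[OF that]
    by simp
  have app: "blinfun_apply (Blinfun (F' z)) = F' z" if "z \<in> U" for z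
    by (rule bounded_linear_Blinfun_apply[OF blF'[OF that]])
  have cont: "continuous_on U (\<lambda>z. Blinfun (F' z))"
  proof (rule continuous_on_blinfun_componentwise)
    fix b :: "('a^'n) \<times> ('a^'m)"
    have "continuous_on U (\<lambda>z. D i z b)" if "i < d" for i
    proof -
      have "Cr_on (Suc 0) (g i) U" using g[OF that] by (simp add: K_smooth_on_def)
      then show ?thesis unfolding D_def Cr_on_Suc Cr_on_0 by blast
    qed
    then have "continuous_on U (\<lambda>z. F' z b)"
      unfolding F'_def
      by (intro continuous_intros bounded_linear.continuous_on[OF blsc]) auto
    then show "continuous_on U (\<lambda>z. blinfun_apply (Blinfun (F' z)) b)"
      by (rule continuous_on_eq) (simp add: app)
  qed
  have F'p: "F' p = id" by (simp add: F'_def \<pi>_def fun_eq_iff)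
  have "id_blinfun o\<^sub>L Blinfun (F' p) = id_blinfun"
    by (rule blinfun_eqI) (simp add: app[OF U(2), unfolded F'p] F'p)
  moreover have "(F has_derivative blinfun_apply (Blinfun (F' z))) (at z)" if "z \<in> U" for z
    unfolding app[OF that] by (rule dF[OF that])
  ultimately obtain U' V G G' where "open U'" and *: "U' \<subseteq> U" "p \<in> U'" "open V" "F p \<in> V" "homeomorphism U' V F G"
    "\<And>y. y \<in> V \<Longrightarrow> (G has_derivative G' y) (at y)"
    "\<And>y. y \<in> V \<Longrightarrow> G' y = inv (blinfun_apply (Blinfun (F' (G y))))"
    "\<And>y. y \<in> V \<Longrightarrow> bij (blinfun_apply (Blinfun (F' (G y))))"
    using inverse_function_theorem[OF U(1) _ cont U(2)] by metis
  have gp: "g i p = 0" if "i < d" for i using M U that by blast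
  have Fp: "F p = 0"
    using linear_0[OF bounded_linear.linear[OF bl\<pi>]] gp by (simp add: F_def scaleK_simps)
  have Gp: "G 0 = p" using homeomorphism_apply1[OF *(5,2)] Fp by simp
  have V0: "0 \<in> V" using *(4) Fp by simp
  have "G' 0 = id" using *(7)[OF V0] Gp app[OF U(2)] F'p by simp
  then have dG: "(G has_derivative (\<lambda>w. w)) (at 0)" using *(6)[OF V0] by (simp add: id_def)
  have line: "((\<lambda>t. t *\<^sub>R v) has_derivative (\<lambda>t. t *\<^sub>R v)) (at (0::real))"
    by (auto intro!: derivative_eq_intros)
  have "((\<lambda>t. G (t *\<^sub>R v)) has_derivative (\<lambda>t. t *\<^sub>R v)) (at (0::real))"
    by (rule has_derivative_compose[OF line]) (simp add: dG)
  then have der: "((\<lambda>t. G (t *\<^sub>R v)) has_vector_derivative v) (at 0)"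
    by (simp add: has_vector_derivative_def)
  have "((\<lambda>t. t *\<^sub>R v) \<longlongrightarrow> 0) (at (0::real))"
    using has_derivative_continuous[OF line] by (simp add: isCont_def)
  then have "\<forall>\<^sub>F t in at (0::real). t *\<^sub>R v \<in> V" using *(3) V0 by (rule topological_tendstoD)
  then have "\<forall>\<^sub>F t in at (0::real). G (t *\<^sub>R v) \<in> M"
  proof eventually_elim
    case (elim t)
    have "G (t *\<^sub>R v) \<in> U"
      using homeomorphism_image2[OF *(5)] imageI[OF elim, of G] subsetD[OF *(1)] by simp
    moreover have "g i (G (t *\<^sub>R v)) = 0" if "i < d" for i
    proof -
      have "linear (D i p)" by (rule has_derivative_linear[OF dg[OF that U(2)]])
      then have "D i p (t *\<^sub>R v) = 0" using v[OF that] by (simp add: D_def linear_cmul)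
      then show ?thesis using gF[OF that] homeomorphism_apply2[OF *(5) elim] by simp
    qed
    ultimately show ?case using M by blast
  qed
  with der Gp show ?thesis
    unfolding tangent_space_def by (intro CollectI exI[of _ "\<lambda>t. G (t *\<^sub>R v)"]) simp
qed

section \<open>The transversality estimate\<close>

text \<open>The points are chosen one after another, each against a bound set by its predecessor,
  because the annuli carrying the bumps are disjoint only if the scales shrink by more than a factor
  of 4.\<close>

lemma decaying_sequence_exists:
  fixes Q :: "'b::real_normed_vector \<Rightarrow> bool"
  assumes "\<And>\<delta>. \<delta> > 0 \<Longrightarrow> \<exists>x. x \<noteq> 0 \<and> norm x < \<delta> \<and> Q x" "\<delta>0 > 0"
  obtains a where "\<And>i. a i \<noteq> 0" "\<And>i::nat. norm (a (Suc i)) < norm (a i) / 4"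
    "\<And>i. norm (a i) < \<delta>0" "\<And>i. Q (a i)" "a \<longlonglongrightarrow> 0"
proof -
  have "\<exists>a. \<forall>i::nat. (a i \<noteq> 0 \<and> norm (a i) < \<delta>0 \<and> Q (a i)) \<and> norm (a (Suc i)) < norm (a i) / 4"
  proof (rule dependent_nat_choice)
    show "\<exists>x. x \<noteq> 0 \<and> norm x < \<delta>0 \<and> Q x" by (rule assms(1)[OF assms(2)])
    fix x :: 'b assume x: "x \<noteq> 0 \<and> norm x < \<delta>0 \<and> Q x"
    obtain y where y: "y \<noteq> 0" "norm y < norm x / 4" "Q y" using assms(1)[of "norm x / 4"] x by auto
    then have "norm y < \<delta>0" using x norm_ge_zero[of x] by linarith
    with y show "\<exists>y. (y \<noteq> 0 \<and> norm y < \<delta>0 \<and> Q y) \<and> norm y < norm x / 4" by blast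
  qed
  then obtain a where a: "\<And>i. a i \<noteq> 0" "\<And>i::nat. norm (a (Suc i)) < norm (a i) / 4"
    "\<And>i. norm (a i) < \<delta>0" "\<And>i. Q (a i)" by blast
  have le: "norm (a i) \<le> \<delta>0 * (1/4) ^ i" for i
  proof (induction i)
    case 0
    then show ?case using a(3)[of 0] by simp
  next
    case (Suc i)
    then show ?case using a(2)[of i] by simp
  qed
  have "(\<lambda>i. (1/4) ^ i) \<longlonglongrightarrow> (0::real)" by (rule LIMSEQ_power_zero) simp
  from tendsto_mult_right_zero[OF this, of \<delta>0]
  have "a \<longlonglongrightarrow> 0" by (rule Lim_null_comparison[rotated]) (simp add: le)
  with a that show ?thesis by blast
qed

lemma Cr_germ_continuous: "Cr_germ r q \<Longrightarrow> (q \<longlongrightarrow> 0) (at 0)"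
proof -
  assume q: "Cr_germ r q"
  then obtain \<epsilon> where "\<epsilon> > 0" "continuous_on (ball 0 \<epsilon>) q"
    unfolding Cr_germ_def by (auto split: if_splits intro: Cr_on_imp_continuous_on)
  moreover have "q 0 = 0" using q by (simp add: Cr_germ_def)
  ultimately show ?thesis
    by (metis centre_in_ball continuous_on_eq_continuous_at isCont_def open_ball)
qed

lemma graph_eventually_near:
  assumes "Cr_germ r q" "a \<longlonglongrightarrow> 0" "\<And>i. a i \<noteq> 0" "\<epsilon> > 0"
  obtains i :: nat where "(a i, q (a i)) \<in> ball 0 \<epsilon>"
proof -
  have "filterlim a (at 0) sequentially" using assms(2,3) by (simp add: filterlim_at)
  from filterlim_compose[OF Cr_germ_continuous[OF assms(1)] this] have "(\<lambda>i. q (a i)) \<longlonglongrightarrow> 0" .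
  from tendsto_Pair[OF assms(2) this] have "(\<lambda>i. (a i, q (a i))) \<longlonglongrightarrow> 0"
    by (simp add: zero_prod_def)
  then have "\<forall>\<^sub>F i in sequentially. dist (a i, q (a i)) 0 < \<epsilon>" using assms(4) by (rule tendstoD)
  then obtain i where "dist (a i, q (a i)) 0 < \<epsilon>" by (auto simp: eventually_sequentially)
  then show ?thesis using that by (simp add: dist_commute)
qed

text \<open>Otherwise points of \<open>Z\<close> with parameters bounded by \<open>B\<close>
  accumulate at the origin, and the graph of a single admissible \<open>q\<close> passes through
  infinitely many of them. Since the parameter may differ from point to point, the resulting
  \<open>\<delta>\<close> is uniform in \<open>s\<close>.\<close>

lemma avoids_of_jet_condition:
  fixes h R :: "'a::{real_normed_field,euclidean_space}^'n \<Rightarrow> 'a^'m"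
  assumes h: "has_series \<alpha> c \<epsilon> h" "h 0 = 0" "\<epsilon> > 0"
    and R: "has_series \<alpha> d \<epsilon> R" "order_ge (Suc r) \<alpha> d"
    and S: "\<And>q. Cr_germ r q \<Longrightarrow> same_jet r h q \<Longrightarrow> \<exists>\<epsilon>>0. graph q \<inter> Z \<inter> ball 0 \<epsilon> = {0}"
  shows "\<exists>\<delta>>0. \<forall>x s. x \<noteq> 0 \<and> norm x < \<delta> \<and> norm s \<le> B \<longrightarrow> (x, h x + s *s R x) \<notin> Z"
proof (rule ccontr)
  assume neg: "\<not> ?thesis"
  let ?N = "norm ((\<chi> i. 1) :: 'a^'n)"
  have N: "?N > 0" by (simp add: vec_eq_iff)
  \<comment> \<open>Half of each of the radii \<open>\<epsilon>\<close> and
    \<open>\<epsilon> / (2 * ?N)\<close> within which the series and its order bound are available,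
    because the annuli reach out to \<open>2 * norm (a i)\<close>.\<close>
  define \<delta>0 where "\<delta>0 = min (\<epsilon> / 2) (\<epsilon> / (4 * ?N))"
  have "\<delta>0 > 0" using N h(3) by (simp add: \<delta>0_def)
  then obtain a where a: "\<And>i. a i \<noteq> 0" "\<And>i::nat. norm (a (Suc i)) < norm (a i) / 4"
    "\<And>i. norm (a i) < \<delta>0" "\<And>i. \<exists>s. norm s \<le> B \<and> (a i, h (a i) + s *s R (a i)) \<in> Z" "a \<longlonglongrightarrow> 0"
    using decaying_sequence_exists[of "\<lambda>x. \<exists>s. norm s \<le> B \<and> (x, h x + s *s R x) \<in> Z" \<delta>0] neg by metis
  obtain s where s: "\<And>i. norm (s i) \<le> B" "\<And>i. (a i, h (a i) + s i *s R (a i)) \<in> Z"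
    using a(4) by metis
  have small: "2 * norm (a i) < \<epsilon>" "2 * norm (a i) < \<epsilon> / (2 * ?N)" for i
    using a(3)[of i] N by (simp_all add: \<delta>0_def field_simps)
  have z: "bounded_linear (\<lambda>_ :: 'a^'n. 0 :: 'a^'m)" "norm (0 :: 'a^'m) \<le> 0 * norm (a i) ^ r * norm v"
    for i and v :: "'a^'n" by (rule bounded_linear_zero, simp)
  obtain q where q: "Cr_germ r q" "same_jet r h q" "\<And>i. q (a i) = h (a i) + s i *s R (a i)"
    "\<And>i. (q has_derivative (\<lambda>v. frechet_derivative h (at (a i)) v
        + (s i *s frechet_derivative R (at (a i)) v + 0))) (at (a i))"
    by (rule jet_interpolation[where a = a and s = s and L = "\<lambda>_ _. 0" and M = 0,
          OF h R a(1,2) small s(1) z order_refl]) (rule that; assumption)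
  obtain \<epsilon>' where "\<epsilon>' > 0" and e: "graph q \<inter> Z \<inter> ball 0 \<epsilon>' = {0}" using S[OF q(1,2)] by blast
  obtain i where i: "(a i, q (a i)) \<in> ball 0 \<epsilon>'"
    by (rule graph_eventually_near[OF q(1) a(5,1) \<open>\<epsilon>' > 0\<close>])
  have "(a i, q (a i)) \<in> graph q" unfolding graph_def by blast
  moreover have "(a i, q (a i)) \<in> Z" unfolding q(3) by (rule s(2))
  ultimately have "(a i, q (a i)) \<in> {0}" unfolding e[symmetric] using i by (intro IntI)
  then show False using a(1)[of i] by (simp add: zero_prod_def)
qed

text \<open>The covector \<open>(p, b)\<close> restricts to \<open>c\<close> on the graph of \<open>h + s R\<close>. If \<open>c\<close> were too small, a
  rank one change of the derivative of size \<open>O(|x|^r)\<close> would make the graph tangent to \<open>ker (p, b)\<close>.\<close>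

theorem conormal_estimate:
  fixes h R :: "'a::{real_normed_field,euclidean_space}^'n \<Rightarrow> 'a^'m"
  assumes h: "has_series \<alpha> c0 \<epsilon> h" "h 0 = 0" "\<epsilon> > 0"
    and R: "has_series \<alpha> d \<epsilon> R" "order_ge (Suc r) \<alpha> d"
    and W: "tr_W r W h"
  shows "\<exists>\<delta>>0. \<forall>x s p b c. x \<noteq> 0 \<and> norm x < \<delta> \<and> norm s \<le> B \<and> (x, h x + s *s R x) \<in> W \<and>
      (\<forall>v\<in>tangent_space W (x, h x + s *s R x). dotK p (fst v) + dotK b (snd v) = 0) \<and>
      (\<forall>\<xi>. dotK c \<xi> = dotK p \<xi> + dotK b (frechet_derivative h (at x) \<xi> + s *s frechet_derivative R (at x) \<xi>))
      \<longrightarrow> norm x ^ r * norm b \<le> norm c"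
proof (rule ccontr)
  let ?claim = ?thesis
  assume neg: "\<not> ?claim"
  \<comment> \<open>Packing \<open>s\<close>, \<open>p\<close>, \<open>b\<close> and
    \<open>c\<close> into one tuple lets a single choice along the sequence pick all of
    them.\<close>
  define bad where "bad = (\<lambda>x (s, p, b, c). norm s \<le> B \<and> (x, h x + s *s R x) \<in> W \<and>
      (\<forall>v\<in>tangent_space W (x, h x + s *s R x). dotK p (fst v) + dotK b (snd v) = 0) \<and>
      (\<forall>\<xi>. dotK c \<xi> = dotK p \<xi> + dotK b (frechet_derivative h (at x) \<xi> + s *s frechet_derivative R (at x) \<xi>))
      \<and> norm c < norm x ^ r * norm b)"
  have bad: "\<exists>x. x \<noteq> 0 \<and> norm x < \<delta> \<and> (\<exists>y. bad x y)" if "\<delta> > 0" for \<delta>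
  proof (rule ccontr)
    assume no: "\<nexists>x. x \<noteq> 0 \<and> norm x < \<delta> \<and> (\<exists>y. bad x y)"
    have key: "norm x ^ r * norm b \<le> norm c" if *: "x \<noteq> 0" "norm x < \<delta>" "norm s \<le> B" "(x, h x + s *s R x) \<in> W"
      "\<forall>v\<in>tangent_space W (x, h x + s *s R x). dotK p (fst v) + dotK b (snd v) = 0"
      "\<forall>\<xi>. dotK c \<xi> = dotK p \<xi> + dotK b (frechet_derivative h (at x) \<xi> + s *s frechet_derivative R (at x) \<xi>)"
      for x s p b c
    proof (rule ccontr)
      assume "\<not> norm x ^ r * norm b \<le> norm c"
      then have "bad x (s, p, b, c)"
        unfolding bad_def prod.case using *(3-6) by (intro conjI) (assumption | simp only: not_le)+
      with no *(1,2) show False by blast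
    qed
    have ?claim
      by (intro exI[of _ \<delta>] conjI[OF that] allI impI, elim conjE, rule key; assumption)
    with neg show False ..
  qed
  let ?N = "norm ((\<chi> i. 1) :: 'a^'n)"
  have N: "?N > 0" by (simp add: vec_eq_iff)
  define \<delta>0 where "\<delta>0 = min (\<epsilon> / 2) (\<epsilon> / (4 * ?N))"
  have "\<delta>0 > 0" using N h(3) by (simp add: \<delta>0_def)
  obtain a where a: "\<And>i. a i \<noteq> 0" "\<And>i::nat. norm (a (Suc i)) < norm (a i) / 4"
    "\<And>i. norm (a i) < \<delta>0" "\<And>i. \<exists>y. bad (a i) y" "a \<longlonglongrightarrow> 0"
    by (rule decaying_sequence_exists[of "\<lambda>x. \<exists>y. bad x y" \<delta>0], erule bad, rule \<open>\<delta>0 > 0\<close>)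
       (rule that; assumption)
  have "\<forall>i. \<exists>y. bad (a i) y" by (rule allI[OF a(4)])
  from choice[OF this] obtain y where y: "\<forall>i. bad (a i) (y i)" ..
  define s where "s = (\<lambda>i. fst (y i))"
  define p where "p = (\<lambda>i. fst (snd (y i)))"
  define b where "b = (\<lambda>i. fst (snd (snd (y i))))"
  define c where "c = (\<lambda>i. snd (snd (snd (y i))))"
  have "bad (a i) (s i, p i, b i, c i)" for i using y by (simp add: s_def p_def b_def c_def)
  note B = this[unfolded bad_def prod.case]
  have sB: "norm (s i) \<le> B" for i using B by (rule conjunct1)
  have inW: "(a i, h (a i) + s i *s R (a i)) \<in> W" for i
    by (rule B[THEN conjunct2, THEN conjunct1])
  have ann: "dotK (p i) (fst v) + dotK (b i) (snd v) = 0"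
    if "v \<in> tangent_space W (a i, h (a i) + s i *s R (a i))" for i v
    by (rule bspec[OF B[THEN conjunct2, THEN conjunct2, THEN conjunct1] that])
  have cc: "dotK (c i) \<xi> = dotK (p i) \<xi> + dotK (b i) (frechet_derivative h (at (a i)) \<xi> + s i *s frechet_derivative R (at (a i)) \<xi>)" for i \<xi>
    by (rule B[THEN conjunct2, THEN conjunct2, THEN conjunct2, THEN conjunct1, THEN spec])
  have lt: "norm (c i) < norm (a i) ^ r * norm (b i)" for i
    by (rule B[THEN conjunct2, THEN conjunct2, THEN conjunct2, THEN conjunct2])
  \<comment> \<open>The strict inequality excludes \<open>b i = 0\<close>, so a vector
    \<open>w i\<close> with \<open>dotK (b i) (w i) = 1\<close> exists.\<close>
  have b0: "b i \<noteq> 0" for i using lt[of i] by auto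
  have "\<exists>w. dotK (b i) w = 1 \<and> norm w = 1 / norm (b i)" for i
    by (rule dotK_unit_exists[OF b0[of i]]) blast
  then have "\<forall>i. \<exists>w. dotK (b i) w = 1 \<and> norm w = 1 / norm (b i)" by blast
  from choice[OF this] obtain w where w: "\<And>i. dotK (b i) (w i) = 1" "\<And>i. norm (w i) = 1 / norm (b i)" by blast
  \<comment> \<open>As \<open>b i\<close> takes the value 1 on \<open>w i\<close>, composing it with
    \<open>L i\<close> gives \<open>- c i\<close>, which cancels the restriction of
    \<open>(p i, b i)\<close> to the graph. Since \<open>norm (w i) = 1 / norm (b i)\<close>, the
    size of \<open>L i\<close> is at most a constant times
    \<open>norm (c i) / norm (b i) < norm (a i) ^ r\<close>, a tilt that the jet tolerates.\<close>
  define L where "L = (\<lambda>i \<xi>. - dotK (c i) \<xi> *s w i)"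
  define M where "M = real CARD('n)"
  have Lb: "norm (L i v) \<le> M * norm (a i) ^ r * norm v" for i v
  proof -
    have "norm (L i v) = norm (dotK (c i) v) / norm (b i)" by (simp add: L_def norm_vector_smult w(2))
    also have "\<dots> \<le> (M * (norm (c i) * norm v)) / norm (b i)"
      unfolding M_def by (intro divide_right_mono norm_dotK_le) simp
    also have "\<dots> \<le> (M * ((norm (a i) ^ r * norm (b i)) * norm v)) / norm (b i)"
      using lt[of i] by (intro divide_right_mono mult_left_mono mult_right_mono) (auto simp: M_def)
    also have "\<dots> = M * norm (a i) ^ r * norm v" using b0[of i] by simp
    finally show ?thesis .
  qed
  have Llin: "bounded_linear (L i)" for i
  proof (rule bounded_linear_intro)
    show "L i (u + v) = L i u + L i v" for u v
      by (simp add: L_def dotK_add_right vec_eq_iff algebra_simps)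
    show "L i (t *\<^sub>R u) = t *\<^sub>R L i u" for t u
    proof -
      have "t *\<^sub>R u = of_real t *s u" by (simp add: vec_eq_iff scaleR_conv_of_real[where 'a='a])
      then have "dotK (c i) (t *\<^sub>R u) = of_real t * dotK (c i) u"
        by (simp only: dotK_smult_right)
      then show ?thesis by (simp add: L_def vec_eq_iff scaleR_conv_of_real[where 'a='a])
    qed
    show "norm (L i v) \<le> norm v * (M * norm (a i) ^ r)" for v using Lb[of i v] by (simp add: mult_ac)
  qed
  have small: "2 * norm (a i) < \<epsilon>" "2 * norm (a i) < \<epsilon> / (2 * ?N)" for i
    using a(3)[of i] N by (simp_all add: \<delta>0_def field_simps)
  have M0: "M \<ge> 0" by (simp add: M_def)
  obtain q where q: "Cr_germ r q" "same_jet r h q" "\<And>i. q (a i) = h (a i) + s i *s R (a i)"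
    and dq: "\<And>i. (q has_derivative (\<lambda>v. frechet_derivative h (at (a i)) v
        + (s i *s frechet_derivative R (at (a i)) v + L i v))) (at (a i))"
    by (rule jet_interpolation[where a = a and s = s and L = L and M = M,
          OF h R a(1,2) small sB Llin Lb M0]) (rule that; assumption)
  have "\<exists>\<epsilon>>0. \<forall>w\<in>graph q \<inter> W \<inter> ball 0 \<epsilon> - {0}. transverse_at (graph q) W w"
    by (rule W[unfolded tr_W_def, THEN spec, THEN mp, OF conjI[OF q(1,2)]])
  then obtain \<epsilon>' where "\<epsilon>' > 0"
    and tr: "\<forall>w\<in>graph q \<inter> W \<inter> ball 0 \<epsilon>' - {0}. transverse_at (graph q) W w" by blast
  obtain i where i: "(a i, q (a i)) \<in> ball 0 \<epsilon>'" by (rule graph_eventually_near[OF q(1) a(5,1) \<open>\<epsilon>' > 0\<close>])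
  have "transverse_at (graph q) W (a i, q (a i))"
  proof (rule bspec[OF tr], intro DiffI IntI i)
    show "(a i, q (a i)) \<in> graph q" unfolding graph_def by blast
    show "(a i, q (a i)) \<in> W" unfolding q(3) by (rule inW)
    show "(a i, q (a i)) \<notin> {0}" using a(1)[of i] by (simp add: zero_prod_def)
  qed
  \<comment> \<open>Transversality would split the vertical vector \<open>(0, w i)\<close> into a
    tangent vector of the graph and one of \<open>W\<close>. The covector \<open>(p i, b i)\<close>
    kills both but takes the value 1 on their sum.\<close>
  then obtain t u where tu: "(0, w i) = t + u" and t: "t \<in> tangent_space (graph q) (a i, q (a i))"
    and u: "u \<in> tangent_space W (a i, q (a i))"
    unfolding transverse_at_def by blast
  have st: "snd t = frechet_derivative h (at (a i)) (fst t)
        + (s i *s frechet_derivative R (at (a i)) (fst t) + L i (fst t))"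
    by (rule tangent_space_graph[OF t dq])
  have "dotK (p i) (fst t) + dotK (b i) (snd t) = dotK (c i) (fst t) + dotK (b i) (L i (fst t))"
    unfolding cc st by (simp add: dotK_add_right)
  also have "\<dots> = 0" unfolding L_def dotK_smult_right w(1) by simp
  finally have 1: "dotK (p i) (fst t) + dotK (b i) (snd t) = 0" .
  have 2: "dotK (p i) (fst u) + dotK (b i) (snd u) = 0" by (rule ann) (use u in \<open>simp only: q(3)\<close>)
  have "fst t + fst u = 0" "snd t + snd u = w i" using tu by (auto simp: prod_eq_iff)
  then have "dotK (b i) (w i) = dotK (p i) (fst t + fst u) + dotK (b i) (snd t + snd u)" by simp
  also have "\<dots> = 0" using 1 2 by (simp add: dotK_add_right algebra_simps)
  finally show False using w(1) by simp
qed

section \<open>Regularity of the family\<close>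

lemma norm_vec_1: "norm (v :: 'a::real_normed_vector^1) = norm (v $ 1)"
  by (simp add: norm_vec_def L2_set_def UNIV_1)

text \<open>In a right triangle with legs \<open>m\<close> and \<open>n\<close> the quotient is the
  sine of the angle whose tangent is \<open>n / m\<close>. The hypotheses force
  \<open>m > 0\<close>, so the infinite value of \<open>tan_arcsin\<close> does not occur.\<close>

lemma tan_arcsin_ratio_le:
  assumes "0 \<le> m" "0 \<le> n" "n \<le> k * m" "m \<noteq> 0 \<or> n \<noteq> 0"
  shows "tan_arcsin (n / sqrt (m\<^sup>2 + n\<^sup>2)) \<le> ennreal k"
proof -
  have m: "m > 0" using assms by (cases "m = 0") auto
  define s where "s = sqrt (m\<^sup>2 + n\<^sup>2)"
  have s: "s > 0" "s\<^sup>2 = m\<^sup>2 + n\<^sup>2"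
  proof -
    have "0 < m\<^sup>2 + n\<^sup>2" by (rule add_pos_nonneg) (use m in simp_all)
    then show "s > 0" "s\<^sup>2 = m\<^sup>2 + n\<^sup>2" unfolding s_def by (simp_all only: real_sqrt_gt_zero real_sqrt_pow2 less_imp_le)
  qed
  have "n < s"
    unfolding s_def by (rule real_less_rsqrt) (use m in simp)
  then have lt: "n / s < 1" using s(1) by simp
  have "0 \<le> n / s" using assms(2) s(1) by simp
  then have ge: "-1 \<le> n / s" by linarith
  have "(m / s)\<^sup>2 + (n / s)\<^sup>2 = s\<^sup>2 / s\<^sup>2"
    unfolding power_divide add_divide_distrib[symmetric] s(2)[symmetric] ..
  then have "1 - (n / s)\<^sup>2 = (m / s)\<^sup>2" using s(1) by simp
  then have "cos (arcsin (n / s)) = m / s"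
    using cos_arcsin[OF ge less_imp_le[OF lt]] m s(1) by simp
  then have "tan (arcsin (n / s)) = n / m"
    using sin_arcsin[OF ge less_imp_le[OF lt]] s(1) by (simp add: tan_def)
  also have "\<dots> \<le> k" using assms(3) m by (simp add: pos_divide_le_eq)
  finally show ?thesis
    using lt unfolding tan_arcsin_def s_def[symmetric] by (simp add: ennreal_leI)
qed

lemma Cr_on_Pair:
  assumes "open U" "Cr_on r f U" "Cr_on r g U"
  shows "Cr_on r (\<lambda>x. (f x, g x)) U"
proof -
  have "Cr_on r (\<lambda>x. (f x, 0) + (0, g x)) U"
    by (intro Cr_on_add[OF assms(1)] Cr_on_linear_comp[OF assms(1) _ assms(2)]
        Cr_on_linear_comp[OF assms(1) _ assms(3)] bounded_linear_Pair bounded_linear_ident bounded_linear_zero)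
  then show ?thesis by simp
qed

section \<open>The family as one map of point and parameter\<close>

definition graph_family ::
  "('a::{real_normed_field,euclidean_space}^'n \<Rightarrow> 'a^'m) \<Rightarrow> ('a^'n \<Rightarrow> 'a^'m) \<Rightarrow> ('a^'n) \<times> ('a^1) \<Rightarrow> ('a^'n) \<times> ('a^'m)" where
  "graph_family h R z = (fst z, h (fst z) + (- (snd z $ 1)) *s R (fst z))"

definition graph_family_deriv ::
  "('a::{real_normed_field,euclidean_space}^'n \<Rightarrow> 'a^'m) \<Rightarrow> ('a^'n \<Rightarrow> 'a^'m) \<Rightarrow> ('a^'n) \<times> ('a^1)
    \<Rightarrow> ('a^'n) \<times> ('a^1) \<Rightarrow> ('a^'n) \<times> ('a^'m)" where
  "graph_family_deriv h R z v = (fst v, frechet_derivative h (at (fst z)) (fst v)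
     + ((- (snd z $ 1)) *s frechet_derivative R (at (fst z)) (fst v) + (- (snd v $ 1)) *s R (fst z)))"

lemma bounded_linear_neg_parameter: "bounded_linear (\<lambda>z :: ('a::real_normed_vector^'n) \<times> ('a^1). - (snd z $ 1))"
  by (intro bounded_linear_minus bounded_linear_compose[OF bounded_linear_vec_nth bounded_linear_snd])

lemma open_strip: "open {z :: ('a::real_normed_vector^'n) \<times> ('a^1). norm (fst z) < \<epsilon>}"
  by (intro open_Collect_less continuous_intros)

lemma graph_family_Cr_on:
  fixes h R :: "'a::{real_normed_field,euclidean_space}^'n \<Rightarrow> 'a^'m"
  assumes "has_series \<alpha> c \<epsilon> h" "has_series \<alpha>' d \<epsilon> R"
  shows "Cr_on r (graph_family h R) {z. norm (fst z) < \<epsilon>}"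
proof -
  let ?D = "{z :: ('a^'n) \<times> ('a^1). norm (fst z) < \<epsilon>}"
  have fst: "Cr_on r fst ?D" by (rule Cr_on_bounded_linear[OF bounded_linear_fst])
  have h: "Cr_on r (\<lambda>z. h (fst z)) ?D"
    by (rule Cr_on_compose[OF open_strip open_ball fst has_series_Cr_on[OF assms(1)]]) auto
  have R: "Cr_on r (\<lambda>z. R (fst z)) ?D"
    by (rule Cr_on_compose[OF open_strip open_ball fst has_series_Cr_on[OF assms(2)]]) auto
  show ?thesis
    unfolding graph_family_def
    by (intro Cr_on_Pair[OF open_strip fst] Cr_on_add[OF open_strip h]
        Cr_on_bilinear[OF open_strip bounded_bilinear_vector_smult _ R]
        Cr_on_bounded_linear bounded_linear_neg_parameter)
qed

lemma graph_family_has_derivative: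
  assumes "has_series \<alpha> c \<epsilon> h" "has_series \<alpha>' d \<epsilon> R" "norm (fst z) < \<epsilon>"
  shows "(graph_family h R has_derivative graph_family_deriv h R z) (at z)"
proof -
  have b: "fst z \<in> ball 0 \<epsilon>" using assms(3) by simp
  have f: "(fst has_derivative fst) (at z)" by (rule bounded_linear_imp_has_derivative[OF bounded_linear_fst])
  have dh: "(h has_derivative frechet_derivative h (at (fst z))) (at (fst z))"
    by (rule Cr_on_imp_has_derivative[OF has_series_Cr_on[OF assms(1)] b])
  have dR: "(R has_derivative frechet_derivative R (at (fst z))) (at (fst z))"
    by (rule Cr_on_imp_has_derivative[OF has_series_Cr_on[OF assms(2)] b])
  show ?thesis
    unfolding graph_family_def graph_family_deriv_def
    by (intro has_derivative_Pair f has_derivative_add has_derivative_compose[OF f dh]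
        bounded_bilinear.FDERIV[OF bounded_bilinear_vector_smult] has_derivative_compose[OF f dR]
        bounded_linear_imp_has_derivative bounded_linear_neg_parameter)
qed

lemma frechet_derivative_has_series_smult:
  assumes "has_series \<alpha> c \<epsilon> h" "norm x < \<epsilon>"
  shows "frechet_derivative h (at x) (a *s v) = a *s frechet_derivative h (at x) v"
proof -
  have "x \<in> ball 0 \<epsilon>" using assms(2) by simp
  note D = frechet_derivative_has_series[OF assms(1) this]
  show ?thesis unfolding D by (simp add: vec_eq_iff sum_distrib_left mult_ac)
qed

lemma graph_family_deriv_scaleK:
  assumes "has_series \<alpha> c \<epsilon> h" "has_series \<alpha>' d \<epsilon> R" "norm (fst z) < \<epsilon>"
  shows "graph_family_deriv h R z (scaleK a v) = scaleK a (graph_family_deriv h R z v)"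
  unfolding graph_family_deriv_def scaleK_def
  using frechet_derivative_has_series_smult[OF assms(1,3)] frechet_derivative_has_series_smult[OF assms(2,3)]
  by (simp add: vec_eq_iff algebra_simps)

lemma K_smooth_on_graph_family:
  assumes hR: "has_series \<alpha> c \<epsilon> h" "has_series \<alpha>' d \<epsilon> R"
    and V: "open V" "V \<subseteq> {z. norm (fst z) < \<epsilon>}" and U: "open U" "graph_family h R ` V \<subseteq> U" and g: "K_smooth_on g U"
  shows "K_smooth_on (\<lambda>z. g (graph_family h R z)) V"
    and "z \<in> V \<Longrightarrow> frechet_derivative (\<lambda>z. g (graph_family h R z)) (at z) v
      = frechet_derivative g (at (graph_family h R z)) (graph_family_deriv h R z v)"
proof -
  have D: "frechet_derivative (\<lambda>z. g (graph_family h R z)) (at z) v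
      = frechet_derivative g (at (graph_family h R z)) (graph_family_deriv h R z v)" if z: "z \<in> V" for z v
  proof (rule fun_cong[OF frechet_derivative_at[symmetric]])
    have "norm (fst z) < \<epsilon>" "graph_family h R z \<in> U" using z V(2) U(2) by auto
    then show "((\<lambda>z. g (graph_family h R z)) has_derivative
       (\<lambda>v. frechet_derivative g (at (graph_family h R z)) (graph_family_deriv h R z v))) (at z)"
      using has_derivative_compose[OF graph_family_has_derivative[OF hR] K_smooth_on_has_derivative[OF g]] by blast
  qed
  then show "z \<in> V \<Longrightarrow> frechet_derivative (\<lambda>z. g (graph_family h R z)) (at z) v
      = frechet_derivative g (at (graph_family h R z)) (graph_family_deriv h R z v)" .
  show "K_smooth_on (\<lambda>z. g (graph_family h R z)) V"
    unfolding K_smooth_on_def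
  proof (intro conjI allI ballI)
    show "Cr_on r (\<lambda>z. g (graph_family h R z)) V" for r
      by (rule Cr_on_compose[OF V(1) U(1) Cr_on_subset[OF graph_family_Cr_on[OF hR] V(2)] _ U(2)])
         (use g in \<open>simp add: K_smooth_on_def\<close>)
    fix z a v assume z: "z \<in> V"
    have "norm (fst z) < \<epsilon>" "graph_family h R z \<in> U" using z V(2) U(2) by auto
    show "frechet_derivative (\<lambda>z. g (graph_family h R z)) (at z) (scaleK a v) =
        a * frechet_derivative (\<lambda>z. g (graph_family h R z)) (at z) v"
      unfolding D[OF z] graph_family_deriv_scaleK[OF hR \<open>norm (fst z) < \<epsilon>\<close>]
      by (rule K_linear_scaleK[OF K_smooth_on_K_linear[OF g \<open>graph_family h R z \<in> U\<close>]])
  qed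
qed

section \<open>Distance from the parameter axis and regularity\<close>

lemma conjugate_hinner:
  "conjugate (hinner u v) = dotK (\<chi> i. conjugate (fst u $ i)) (fst v) + dotK (\<chi> j. conjugate (snd u $ j)) (snd v)"
  by (simp add: hinner_def dotK_def conjugate_add conjugate_sum conjugate_mult)

lemma dotK_eqI: "(\<And>x. dotK a x = dotK b x) \<Longrightarrow> a = b"
  by (metis dotK_axis vec_eq_iff)

text \<open>Against a vector of the parameter axis only the part \<open>\<nu>\<close> of a normal
  vector \<open>(\<mu>, \<nu>)\<close> enters the pairing. As the parameter is one-dimensional, the
  sine is \<open>norm \<nu> / norm (\<mu>, \<nu>)\<close> whatever that vector is.\<close>

lemma subspace_dist_parameter_axis_le:
  fixes T :: "(('a::{real_normed_field,euclidean_space}^'n) \<times> ('a^1)) set"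
  assumes "\<And>u. u \<in> hperp T \<Longrightarrow> norm (snd u) \<le> k * norm (fst u)"
  shows "subspace_dist ({0} \<times> UNIV) T \<le> ennreal k"
  unfolding subspace_dist_def
proof (rule SUP_least)
  fix w :: "(('a^'n) \<times> ('a^1)) \<times> (('a^'n) \<times> ('a^1))"
  assume "w \<in> (hperp T - {0}) \<times> (({0} \<times> UNIV) - {0})"
  then obtain \<mu> \<nu> t where w: "w = ((\<mu>, \<nu>), (0, t))"
    and u: "(\<mu>, \<nu>) \<in> hperp T" "(\<mu>, \<nu>) \<noteq> 0" and "(0 :: 'a^'n, t) \<noteq> 0"
    by (cases w) auto
  then have t: "norm t \<noteq> 0" by (simp add: zero_prod_def)
  have "norm (hinner (\<mu>, \<nu>) (0 :: 'a^'n, t)) = norm \<nu> * norm t"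
    by (simp add: hinner_def norm_vec_1 UNIV_1 norm_mult)
  then have "norm (hinner (\<mu>, \<nu>) (0 :: 'a^'n, t)) / (norm (\<mu>, \<nu>) * norm (0 :: 'a^'n, t))
      = norm \<nu> / sqrt ((norm \<mu>)\<^sup>2 + (norm \<nu>)\<^sup>2)"
    using t by (simp add: norm_Pair)
  moreover have "tan_arcsin (norm \<nu> / sqrt ((norm \<mu>)\<^sup>2 + (norm \<nu>)\<^sup>2)) \<le> ennreal k"
    by (rule tan_arcsin_ratio_le) (use assms[OF u(1)] u(2) in \<open>auto simp: zero_prod_def\<close>)
  ultimately show "(case w of (u, v) \<Rightarrow> tan_arcsin (norm (hinner u v) / (norm u * norm v))) \<le> ennreal k"
    unfolding w prod.case by (simp only:)
qed

text \<open>Near \<open>(0, u)\<close> the set \<open>M\<close> is cut out by the equations of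
  \<open>W\<close> composed with \<open>graph_family h R\<close>. The estimate is applied to
  arbitrary linear combinations of their differentials, not to single equations; this serves both
  independence and the bound on the distance.\<close>

theorem w_regular_of_conormal_estimate:
  fixes h R :: "'a::{real_normed_field,euclidean_space}^'n \<Rightarrow> 'a^'m" and u :: "'a^1"
  assumes h: "has_series \<alpha> c0 \<epsilon> h" "h 0 = 0" "\<epsilon> > 0"
    and R: "has_series \<alpha> d0 \<epsilon> R" "order_ge (Suc r) \<alpha> d0"
    and W: "W \<inter> ({0} \<times> UNIV) = {}" "submanifold (W \<inter> ball 0 \<epsilon>0)" "\<epsilon>0 > 0"
    and M: "\<And>z. norm (fst z) < \<epsilon> \<Longrightarrow> z \<in> M \<longleftrightarrow> graph_family h R z \<in> W"
    and \<delta>: "\<delta> > 0"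
    and est: "\<And>x s p b c. x \<noteq> 0 \<Longrightarrow> norm x < \<delta> \<Longrightarrow> norm s \<le> B \<Longrightarrow> (x, h x + s *s R x) \<in> W \<Longrightarrow>
      (\<And>v. v \<in> tangent_space W (x, h x + s *s R x) \<Longrightarrow> dotK p (fst v) + dotK b (snd v) = 0) \<Longrightarrow>
      (\<And>\<xi>. dotK c \<xi> = dotK p \<xi> + dotK b (frechet_derivative h (at x) \<xi> + s *s frechet_derivative R (at x) \<xi>)) \<Longrightarrow>
      norm x ^ r * norm b \<le> norm c"
    and u: "norm (u $ 1) < B"
  shows "w_regular_at M (0, u)"
proof -
  let ?\<beta> = "graph_family h R"
  let ?N = "norm ((\<chi> i. 1) :: 'a^'n)"
  have N: "?N > 0" by (simp add: vec_eq_iff)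
  obtain K' where K': "\<forall>x\<in>ball 0 (\<epsilon> / (2 * ?N)) \<inter> ball 0 \<epsilon>. norm (R x) \<le> K' * norm x ^ Suc r"
    using series_order_bound[OF R h(3)] by blast
  define \<epsilon>2 where "\<epsilon>2 = min \<epsilon> (\<epsilon> / (2 * ?N))"
  define K where "K = \<bar>K'\<bar>"
  have \<epsilon>2: "\<epsilon>2 > 0" "\<epsilon>2 \<le> \<epsilon>" using h(3) N by (simp_all add: \<epsilon>2_def)
  have KR: "norm (R x) \<le> K * norm x ^ Suc r" if "norm x < \<epsilon>2" for x
  proof -
    have "norm (R x) \<le> K' * norm x ^ Suc r"
      by (rule bspec[OF K']) (use that in \<open>simp add: \<epsilon>2_def\<close>)
    also have "\<dots> \<le> K * norm x ^ Suc r" unfolding K_def by (intro mult_right_mono) auto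
    finally show ?thesis .
  qed
  have R0: "R 0 = 0" using KR[of 0] \<epsilon>2 by simp
  \<comment> \<open>On this set the bound for \<open>R\<close> and the conormal estimate are
    available. At \<open>(0, u)\<close> the map \<open>?\<beta>\<close> takes the value 0, so a
    neighbourhood is mapped into the ball where \<open>W\<close> is a submanifold.\<close>
  let ?O = "{z :: ('a^'n) \<times> ('a^1). norm (fst z) < \<epsilon>2} \<inter> ({z. norm (fst z) < \<delta>} \<inter> {z. norm (- (snd z $ 1)) < B})"
  have opO: "open ?O"
    by (intro open_Int open_strip open_Collect_less continuous_intros)
  have contO: "continuous_on ?O ?\<beta>"
    by (rule continuous_on_subset[OF Cr_on_imp_continuous_on[OF graph_family_Cr_on[OF h(1) R(1), of 0]]])
       (use \<epsilon>2 in auto)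
  have "open (?O \<inter> ?\<beta> -` ball 0 \<epsilon>0)"
    by (rule continuous_open_preimage[OF contO opO open_ball])
  moreover have "(0, u) \<in> ?O \<inter> ?\<beta> -` ball 0 \<epsilon>0"
    using \<epsilon>2 \<delta> u W(3) by (simp add: graph_family_def h(2) R0 flip: zero_prod_def)
  ultimately obtain \<epsilon>1 where \<epsilon>1: "\<epsilon>1 > 0" "ball (0, u) \<epsilon>1 \<subseteq> ?O \<inter> ?\<beta> -` ball 0 \<epsilon>0"
    by (rule openE)
  let ?Z = "ball (0 :: 'a^'n, u) \<epsilon>1"
  have Z: "norm (fst z) < \<epsilon>2" "norm (fst z) < \<delta>" "norm (- (snd z $ 1)) \<le> B" "?\<beta> z \<in> ball 0 \<epsilon>0" "norm (fst z) < \<epsilon>"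
    if "z \<in> ?Z" for z
    using subsetD[OF \<epsilon>1(2) that] \<epsilon>2(2) by auto
  have contZ: "continuous_on ?Z ?\<beta>" 
    by (rule continuous_on_subset[OF contO subset_trans[OF \<epsilon>1(2) Int_lower1]])
  \<comment> \<open>\<open>CARD('m)\<close> comes from the crude bound for \<open>dotK\<close>; the
    summand 1 keeps \<open>C\<close> positive even if \<open>K = 0\<close>.\<close>
  define C where "C = real CARD('m) * K + 1"
  have K0: "K \<ge> 0" by (simp add: K_def)
  have C: "C > 0" using K0 by (simp add: C_def add_nonneg_pos)
  have main: "(\<exists>k. submanifold_at k (M \<inter> ?Z) w) \<and>
      subspace_dist ({0} \<times> UNIV) (tangent_space M w) \<le> ennreal (C * norm (fst w))"
    if w: "w \<in> M \<inter> ?Z" for w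
  proof -
    have wZ: "w \<in> ?Z" using w by blast
    note zw = Z[OF wZ]
    define x where "x = fst w"
    define s where "s = - (snd w $ 1)"
    have \<beta>w: "?\<beta> w = (x, h x + s *s R x)" by (simp add: graph_family_def x_def s_def)
    have \<beta>W: "?\<beta> w \<in> W" 
      by (rule M[OF zw(5), THEN iffD1]) (rule IntD1[OF w])
    \<comment> \<open>\<open>W\<close> does not meet \<open>{0} \<times> UNIV\<close>. This makes
      \<open>norm x ^ r\<close> positive, without which the estimate would say nothing about
      \<open>b\<close>.\<close>
    have x0: "x \<noteq> 0"
    proof
      assume "x = 0"
      then have "?\<beta> w \<in> {0} \<times> UNIV" unfolding \<beta>w by simp
      from IntI[OF \<beta>W this] show False unfolding W(1) by (rule emptyE)
    qed
    have "\<exists>k. submanifold_at k (W \<inter> ball 0 \<epsilon>0) (?\<beta> w)"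
      by (rule bspec[OF W(2)[unfolded submanifold_def] IntI[OF \<beta>W zw(4)]])
    then obtain k :: nat and U and g :: "nat \<Rightarrow> ('a^'n) \<times> ('a^'m) \<Rightarrow> 'a" where sub: "open U \<and> ?\<beta> w \<in> U \<and> (\<forall>i<k. K_smooth_on (g i) U) \<and>
      W \<inter> ball 0 \<epsilon>0 \<inter> U = {z\<in>U. \<forall>i<k. g i z = 0} \<and>
      (\<forall>c. (\<forall>v. (\<Sum>i<k. c i * frechet_derivative (g i) (at (?\<beta> w)) v) = 0) \<longrightarrow> (\<forall>i<k. c i = 0))"
      unfolding submanifold_at_def by (elim exE) (rule that, assumption)
    note U = sub[THEN conjunct1] sub[THEN conjunct2, THEN conjunct1]
    note sub2 = sub[THEN conjunct2, THEN conjunct2]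
    have g: "K_smooth_on (g i) U" if "i < k" for i
      by (rule sub2[THEN conjunct1, rule_format, OF that])
    note WU = sub2[THEN conjunct2, THEN conjunct1]
    have ind: "\<forall>i<k. c i = 0" if "\<And>v. (\<Sum>i<k. c i * frechet_derivative (g i) (at (?\<beta> w)) v) = 0" for c
      by (rule sub2[THEN conjunct2, THEN conjunct2, THEN spec, THEN mp, OF allI[OF that]])
    define V where "V = ?Z \<inter> ?\<beta> -` U"
    have V: "open V" "w \<in> V" "V \<subseteq> {z. norm (fst z) < \<epsilon>}" "?\<beta> ` V \<subseteq> U"
      unfolding V_def
      by (rule continuous_open_preimage[OF contZ open_ball U(1)], intro IntI vimageI2 wZ U(2),
          blast intro: Z(5), blast)
    define G where "G = (\<lambda>i z. g i (?\<beta> z))"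
    have G: "K_smooth_on (G i) V" if "i < k" for i
      unfolding G_def by (rule K_smooth_on_graph_family(1)[OF h(1) R(1) V(1,3) U(1) V(4) g[OF that]])
    have DG: "frechet_derivative (G i) (at w) v = frechet_derivative (g i) (at (?\<beta> w)) (graph_family_deriv h R w v)"
      if "i < k" for i v
      unfolding G_def by (rule K_smooth_on_graph_family(2)[OF h(1) R(1) V(1,3) U(1) V(4) g[OF that] V(2)])
    have MV: "M \<inter> V = {z\<in>V. \<forall>i<k. G i z = 0}"
    proof -
      have "z \<in> M \<longleftrightarrow> (\<forall>i<k. G i z = 0)" if "z \<in> V" for z
      proof -
        have z: "z \<in> ?Z" "?\<beta> z \<in> U" using that unfolding V_def by blast+
        have "z \<in> M \<longleftrightarrow> ?\<beta> z \<in> W \<inter> ball 0 \<epsilon>0 \<inter> U" using M[OF Z(5)[OF z(1)]] Z(4)[OF z(1)] z(2) by blast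
        also have "\<dots> \<longleftrightarrow> (\<forall>i<k. G i z = 0)" unfolding WU G_def using z(2) by blast
        finally show ?thesis .
      qed
      then show ?thesis by blast
    qed
    have linG: "K_linear (frechet_derivative (G i) (at w))" if "i < k" for i
      by (rule K_smooth_on_K_linear[OF G[OF that] V(2)])
    \<comment> \<open>The parameter enters only through the multiple of \<open>R\<close>, so the
      parameter component of a pulled-back combination is \<open>- dotK b (R x)\<close>. The
      estimate applies because the same combination of the differentials of the \<open>g i\<close>
      annihilates the tangent vectors of \<open>W\<close>.\<close>
    have cov: "\<exists>p b q. (\<forall>v. (\<Sum>i<k. c i * frechet_derivative (G i) (at w) v) = dotK q (fst v) + (- (snd v $ 1)) * dotK b (R x)) \<and>
        (\<forall>v. (\<Sum>i<k. c i * frechet_derivative (g i) (at (?\<beta> w)) v) = dotK p (fst v) + dotK b (snd v)) \<and>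
        (\<forall>\<xi>. dotK q \<xi> = dotK p \<xi> + dotK b (frechet_derivative h (at x) \<xi> + s *s frechet_derivative R (at x) \<xi>)) \<and>
        norm x ^ r * norm b \<le> norm q" for c
    proof -
      let ?a = "\<lambda>v. \<Sum>i<k. c i * frechet_derivative (g i) (at (?\<beta> w)) v"
      let ?A = "\<lambda>v. \<Sum>i<k. c i * frechet_derivative (G i) (at w) v"
      have la: "K_linear ?a" by (rule K_linear_combination) (use K_smooth_on_K_linear[OF g U(2)] in simp)
      have lA: "K_linear ?A" by (rule K_linear_combination) (use linG in simp)
      obtain p b where pb: "\<And>v. ?a v = dotK p (fst v) + dotK b (snd v)" by (rule K_linear_dotK[OF la]) blast
      obtain q e where qe: "\<And>v. ?A v = dotK q (fst v) + dotK e (snd v)" by (rule K_linear_dotK[OF lA]) blast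
      have "?A v = ?a (graph_family_deriv h R w v)" for v
        by (rule sum.cong) (simp_all add: DG)
      then have Aa: "?A v = dotK p (fst v) + dotK b (frechet_derivative h (at x) (fst v)
          + (s *s frechet_derivative R (at x) (fst v) + (- (snd v $ 1)) *s R x))" for v
        unfolding pb by (simp add: graph_family_deriv_def x_def s_def)
      have q: "dotK q \<xi> = dotK p \<xi> + dotK b (frechet_derivative h (at x) \<xi> + s *s frechet_derivative R (at x) \<xi>)" for \<xi>
        using Aa[of "(\<xi>, 0)"] qe[of "(\<xi>, 0)"] by simp
      have A: "?A v = dotK q (fst v) + (- (snd v $ 1)) * dotK b (R x)" for v
        unfolding Aa q by (simp only: dotK_add_right dotK_smult_right add.assoc)
      have "norm x ^ r * norm b \<le> norm q"
      proof (rule est[OF x0 _ _ _ _ q])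
        show "norm x < \<delta>" "norm s \<le> B" using zw by (simp_all add: x_def s_def)
        show "(x, h x + s *s R x) \<in> W" using \<beta>W \<beta>w by simp
        fix v assume v: "v \<in> tangent_space W (x, h x + s *s R x)"
        have "frechet_derivative (g i) (at (?\<beta> w)) v = 0" if "i < k" for i
        proof (rule tangent_space_subset_kernel[where M = W and U = "U \<inter> ball 0 \<epsilon>0"])
          show "v \<in> tangent_space W (?\<beta> w)" using v \<beta>w by simp
          show "open (U \<inter> ball 0 \<epsilon>0)" using U(1) by blast
          show "?\<beta> w \<in> U \<inter> ball 0 \<epsilon>0" using U(2) zw(4) by blast
          show "g i z = 0" if "z \<in> W \<inter> (U \<inter> ball 0 \<epsilon>0)" for z using that WU \<open>i < k\<close> by blast
          show "(g i has_derivative frechet_derivative (g i) (at (?\<beta> w))) (at (?\<beta> w))"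
            by (rule K_smooth_on_has_derivative[OF g[OF that] U(2)])
        qed (rule \<beta>W)
        then have "?a v = 0" by simp
        then show "dotK p (fst v) + dotK b (snd v) = 0" using pb by simp
      qed
      with A pb q show ?thesis by blast
    qed
    \<comment> \<open>If the pulled-back combination vanishes, then \<open>q = 0\<close>, the
      estimate gives \<open>b = 0\<close>, and hence \<open>p = 0\<close>; what remains is
      independence of the equations of \<open>W\<close>.\<close>
    have indG: "\<forall>i<k. c i = 0" if c: "\<And>v. (\<Sum>i<k. c i * frechet_derivative (G i) (at w) v) = 0" for c
    proof -
      obtain p b q where A: "\<And>v. (\<Sum>i<k. c i * frechet_derivative (G i) (at w) v) = dotK q (fst v) + (- (snd v $ 1)) * dotK b (R x)"
        and a: "\<And>v. (\<Sum>i<k. c i * frechet_derivative (g i) (at (?\<beta> w)) v) = dotK p (fst v) + dotK b (snd v)"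
        and q: "\<And>\<xi>. dotK q \<xi> = dotK p \<xi> + dotK b (frechet_derivative h (at x) \<xi> + s *s frechet_derivative R (at x) \<xi>)"
        and le: "norm x ^ r * norm b \<le> norm q" using cov[of c] by blast
      have "dotK q \<xi> = dotK 0 \<xi>" for \<xi> using A[of "(\<xi>, 0)"] c by simp
      then have q0: "q = 0" by (rule dotK_eqI)
      have "0 < norm x ^ r" using x0 by simp
      then have b0: "b = 0" using le q0 by (simp add: mult_le_0_iff not_le[symmetric])
      have "dotK p \<xi> = dotK 0 \<xi>" for \<xi> using q[of \<xi>] q0 b0 by simp
      then have "p = 0" by (rule dotK_eqI)
      then show ?thesis using a b0 by (intro ind) simp
    qed
    obtain e where e: "\<And>i j. i < k \<Longrightarrow> j < k \<Longrightarrow> frechet_derivative (G i) (at w) (e j) = (if i = j then 1 else 0)"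
      using dual_system_exists[of k "\<lambda>i. frechet_derivative (G i) (at w)", OF linG indG] by blast
    have "submanifold_at k (M \<inter> ?Z) w"
      unfolding submanifold_at_def
    proof (intro exI[of _ V] exI[of _ G] conjI allI impI V(1,2) G)
      show "M \<inter> ?Z \<inter> V = {z\<in>V. \<forall>i<k. G i z = 0}" using MV by (auto simp: V_def)
      fix c i assume "\<forall>v. (\<Sum>i<k. c i * frechet_derivative (G i) (at w) v) = 0" "i < k"
      then show "c i = 0" using indG[of c] by blast
    qed
    moreover have "subspace_dist ({0} \<times> UNIV) (tangent_space M w) \<le> ennreal (C * norm x)"
    proof (rule subspace_dist_parameter_axis_le)
      fix y assume y: "y \<in> hperp (tangent_space M w)"
      \<comment> \<open>\<open>hinner\<close> is conjugate-linear in its second argument;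
        conjugating turns orthogonality to the tangent space into the vanishing of this linear
        functional. It then vanishes on the common kernel of the differentials, so it is one of
        their combinations and \<open>cov\<close> applies.\<close>
      let ?\<psi> = "\<lambda>v. dotK (\<chi> i. conjugate (fst y $ i)) (fst v) + dotK (\<chi> j. conjugate (snd y $ j)) (snd v)"
      have lin: "K_linear ?\<psi>"
        unfolding K_linear_def by (simp add: dotK_add_right dotK_smult_right scaleK_simps algebra_simps del: split_paired_All)
      have "?\<psi> v = 0" if "\<And>i. i < k \<Longrightarrow> frechet_derivative (G i) (at w) v = 0" for v
      proof -
        have "v \<in> tangent_space M w"
          by (rule kernel_subset_tangent_space[OF V(1,2) _ G MV e that]) (use w in blast)+
        then have "hinner y v = 0" using y by (simp add: hperp_def)
        then show ?thesis using conjugate_hinner[of y v] by simp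
      qed
      from functional_in_span[OF linG lin e this]
      have \<psi>: "?\<psi> v = (\<Sum>i<k. ?\<psi> (e i) * frechet_derivative (G i) (at w) v)" for v .
      obtain b q where A: "\<And>v. (\<Sum>i<k. ?\<psi> (e i) * frechet_derivative (G i) (at w) v) = dotK q (fst v) + (- (snd v $ 1)) * dotK b (R x)"
        and le: "norm x ^ r * norm b \<le> norm q" using cov[of "\<lambda>i. ?\<psi> (e i)"] by blast
      have "dotK (\<chi> i. conjugate (fst y $ i)) \<xi> = dotK q \<xi>" for \<xi>
        using \<psi>[of "(\<xi>, 0)"] A[of "(\<xi>, 0)"] by simp
      then have q: "(\<chi> i. conjugate (fst y $ i)) = q" by (rule dotK_eqI)
      have nq: "norm q = norm (fst y)" unfolding q[symmetric] norm_vec_def by simp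
      have "conjugate (snd y $ 1) = - dotK b (R x)"
        using \<psi>[of "(0, axis 1 1)"] A[of "(0, axis 1 1)"] by (simp add: dotK_axis)
      then have "norm (conjugate (snd y $ 1)) = norm (dotK b (R x))" by (simp only: norm_minus_cancel)
      then have "norm (snd y) = norm (dotK b (R x))" by (simp only: norm_conjugate norm_vec_1)
      also have "\<dots> \<le> real CARD('m) * (norm b * norm (R x))" by (rule norm_dotK_le)
      also have "\<dots> \<le> real CARD('m) * (norm b * (K * norm x ^ Suc r))"
        using KR[of x] zw(1) by (intro mult_left_mono) (simp_all add: x_def)
      \<comment> \<open>Of \<open>norm x ^ Suc r\<close>, the power \<open>norm x ^ r\<close> is
        absorbed by the conormal estimate, and one factor \<open>norm x\<close> remains for
        (w).\<close>
      also have "\<dots> = (real CARD('m) * K * norm x) * (norm x ^ r * norm b)" by (simp add: mult_ac)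
      also have "\<dots> \<le> (real CARD('m) * K * norm x) * norm (fst y)"
        using le nq K0 by (intro mult_left_mono) simp_all
      also have "\<dots> \<le> (C * norm x) * norm (fst y)"
        by (intro mult_right_mono) (simp_all add: C_def)
      finally show "norm (snd y) \<le> (C * norm x) * norm (fst y)" .
    qed
    ultimately show ?thesis unfolding x_def by blast
  qed
  show ?thesis
    unfolding w_regular_at_def
  proof (rule exI[of _ \<epsilon>1], rule conjI[OF \<epsilon>1(1)], rule exI[of _ C], rule conjI[OF C], intro conjI ballI)
    show "submanifold (M \<inter> ?Z)"
      unfolding submanifold_def by (intro ballI conjunct1[OF main])
    fix w assume "w \<in> M \<inter> ?Z"
    then show "subspace_dist ({0} \<times> UNIV) (tangent_space M w) \<le> ennreal (C * norm (fst w))"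
      by (rule conjunct2[OF main])
  qed
qed

section \<open>Equisingularity of the segment from a germ to its Taylor polynomial\<close>

theorem corollary2p28:
  fixes F :: "('a::{real_normed_field,euclidean_space}^'n) \<times> ('a^'k) \<Rightarrow> 'a^'p"
    and h g :: "'a^'n \<Rightarrow> 'a^'k"
    and f :: "'a^'n \<Rightarrow> 'a^1 \<Rightarrow> 'a^'k"
    and X Y W S :: "(('a^'n) \<times> ('a^'k)) set"
    and e r :: nat
  assumes F: "analytic_germ2 F" "F 0 = 0"
    and X: "X = {z. F z = 0}"
    and Y: "Y = {0} \<times> UNIV"
    and e: "e = germ_codim (X - Y)"
    and W: "W = {z \<in> X - Y. rankK F z = e}"
    and W_smooth: "\<exists>\<epsilon>>0. submanifold (W \<inter> ball 0 \<epsilon>)"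
    and W_dense: "\<exists>\<epsilon>>0. (X - Y) \<inter> ball 0 \<epsilon> \<subseteq> closure W"
    and S: "S = X - W"
    and h: "analytic_germ h" "h 0 = 0"
    and g: "g = taylor_poly r h"
    and f: "f = (\<lambda>x u. (1 - u $ 1) *s h x + (u $ 1) *s g x)"
  shows "(tr_W r W h \<longrightarrow> (\<forall>s\<in>{0..1::real}. verdier_W W f (vec (of_real s)))) \<and>
         (tr_X r W S h \<longrightarrow> (\<forall>s\<in>{0..1::real}. verdier_X W S f (vec (of_real s))))"
proof -
  obtain \<alpha> c0 \<epsilon> where \<epsilon>: "\<epsilon> > 0" and hs: "has_series \<alpha> c0 \<epsilon> h"
    by (rule analytic_germ_has_series[OF h(1)])
  obtain d R where R: "has_series \<alpha> d \<epsilon> R" "order_ge (Suc r) \<alpha> d"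
    and hgR: "\<And>x. x \<in> ball 0 \<epsilon> \<Longrightarrow> h x = taylor_poly r h x + R x"
    by (rule taylor_poly_remainder[OF hs \<epsilon>, of r]) (rule that; assumption)
  obtain \<epsilon>0 where \<epsilon>0: "\<epsilon>0 > 0" "submanifold (W \<inter> ball 0 \<epsilon>0)" using W_smooth by blast
  have WY: "W \<inter> ({0} \<times> UNIV) = {}" unfolding W Y by blast
  \<comment> \<open>Substituting \<open>g = h - R\<close> turns \<open>(1 - u) h + u g\<close> into
    \<open>h - u R\<close>; the substitution is justified on the ball where the Taylor formula was
    established.\<close>
  have fam: "family_map f z = graph_family h R z" if "norm (fst z) < \<epsilon>" for z
  proof -
    have "h (fst z) = g (fst z) + R (fst z)" using hgR[of "fst z"] that g by simp
    then show ?thesis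
      by (simp add: family_map_def graph_family_def f case_prod_unfold vec_eq_iff algebra_simps)
  qed
  have memW: "z \<in> family_map f -` W \<longleftrightarrow> graph_family h R z \<in> W" if "norm (fst z) < \<epsilon>" for z
    using fam[OF that] by simp
  \<comment> \<open>All base parameters in the unit interval are treated at once: the unit ball
    around such a parameter stays in \<open>norm u < 2\<close>, and 2 is the parameter bound in the
    estimates below.\<close>
  have small: "norm u < 2" if "s \<in> {0..1::real}" "u \<in> ball (vec (of_real s)) 1" for s and u :: "'a^1"
  proof -
    have "norm (vec (of_real s) :: 'a^1) \<le> 1" using that(1) by (simp add: norm_vec_1)
    moreover have "norm (u - vec (of_real s)) < 1" using that(2) by (simp add: dist_norm norm_minus_commute)
    ultimately show ?thesis using norm_triangle_sub[of u "vec (of_real s)"] by simp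
  qed
  have regular: "w_regular_at (family_map f -` W) (0, u)" if tr: "tr_W r W h" and u: "norm u < 2" for u
  proof -
    obtain \<delta> where \<delta>: "\<delta> > 0" and est: "\<forall>x s p b c. x \<noteq> 0 \<and> norm x < \<delta> \<and> norm s \<le> 2 \<and> (x, h x + s *s R x) \<in> W \<and>
      (\<forall>v\<in>tangent_space W (x, h x + s *s R x). dotK p (fst v) + dotK b (snd v) = 0) \<and>
      (\<forall>\<xi>. dotK c \<xi> = dotK p \<xi> + dotK b (frechet_derivative h (at x) \<xi> + s *s frechet_derivative R (at x) \<xi>))
      \<longrightarrow> norm x ^ r * norm b \<le> norm c"
      using conormal_estimate[OF hs h(2) \<epsilon> R tr, of 2] by (elim exE conjE) (rule that)
    show ?thesis
    proof (rule w_regular_of_conormal_estimate[OF hs h(2) \<epsilon> R WY \<epsilon>0(2,1) memW \<delta>])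
      show "norm (u $ 1) < 2" using u by (simp add: norm_vec_1)
      fix x s p b c
      assume "x \<noteq> 0" "norm x < \<delta>" "norm s \<le> 2" "(x, h x + s *s R x) \<in> W"
        and 1: "\<And>v. v \<in> tangent_space W (x, h x + s *s R x) \<Longrightarrow> dotK p (fst v) + dotK b (snd v) = 0"
        and 2: "\<And>\<xi>. dotK c \<xi> = dotK p \<xi> + dotK b (frechet_derivative h (at x) \<xi> + s *s frechet_derivative R (at x) \<xi>)"
      then show "norm x ^ r * norm b \<le> norm c"
        by (intro est[THEN spec, THEN spec, THEN spec, THEN spec, THEN spec, THEN mp] conjI ballI allI)
    qed
  qed
  have avoid: "\<exists>\<epsilon>'>0. (family_map f -` S) \<inter> ball (0, u) \<epsilon>' \<subseteq> {0} \<times> UNIV"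
    if tr: "tr_X r W S h" and u: "norm u < 2" for u
  proof -
    have S': "\<exists>\<epsilon>>0. graph q \<inter> S \<inter> ball 0 \<epsilon> = {0}" if "Cr_germ r q" "same_jet r h q" for q
      by (rule tr[unfolded tr_X_def, THEN conjunct2, THEN spec, THEN mp, OF conjI[OF that]])
    have "\<exists>\<delta>>0. \<forall>x s. x \<noteq> 0 \<and> norm x < \<delta> \<and> norm s \<le> 2 \<longrightarrow> (x, h x + s *s R x) \<notin> S"
      by (rule avoids_of_jet_condition[OF hs h(2) \<epsilon> R], rule S')
    then obtain \<delta> where \<delta>: "\<delta> > 0"
      and out: "\<forall>x s. x \<noteq> 0 \<and> norm x < \<delta> \<and> norm s \<le> 2 \<longrightarrow> (x, h x + s *s R x) \<notin> S"
      by (elim exE conjE) (rule that)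
    \<comment> \<open>The term \<open>2 - norm u\<close> keeps the parameters of nearby points below
      the bound 2.\<close>
    define \<epsilon>' where "\<epsilon>' = min (min \<epsilon> \<delta>) (2 - norm u)"
    have "\<epsilon>' > 0" using \<epsilon> \<delta> u by (simp add: \<epsilon>'_def)
    moreover have "fst z = 0" if z: "family_map f z \<in> S" "z \<in> ball (0, u) \<epsilon>'" for z
    proof (rule ccontr)
      assume nz: "fst z \<noteq> 0"
      have d: "dist (0, u) z < \<epsilon>'" using z(2) by simp
      have "dist 0 (fst z) < \<epsilon>'" using dist_fst_le[of "(0, u)" z] d by simp
      then have x: "norm (fst z) < \<epsilon>" "norm (fst z) < \<delta>" by (simp_all add: \<epsilon>'_def)
      have "dist u (snd z) < \<epsilon>'" using dist_snd_le[of "(0, u)" z] d by simp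
      then have "norm (snd z) < 2"
        using norm_triangle_sub[of "snd z" u] by (simp add: \<epsilon>'_def dist_norm norm_minus_commute)
      then have "norm (- (snd z $ 1)) \<le> 2" by (simp add: norm_vec_1)
      then have "graph_family h R z \<notin> S"
        unfolding graph_family_def
        by (intro out[THEN spec, THEN spec, THEN mp] conjI nz x(2))
      then show False using z(1) fam[OF x(1)] by simp
    qed
    ultimately show ?thesis by (intro exI[of _ \<epsilon>'] conjI subsetI) (auto simp: mem_Times_iff)
  qed
  show ?thesis
  proof (intro conjI impI ballI)
    fix s :: real assume tr: "tr_W r W h" and s: "s \<in> {0..1}"
    show "verdier_W W f (vec (of_real s))"
      unfolding verdier_W_def
      by (rule exI[of _ 1], intro conjI ballI regular[OF tr small[OF s]]) simp_all
  next
    fix s :: real assume tr: "tr_X r W S h" and s: "s \<in> {0..1}"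
    have trW: "tr_W r W h" by (rule tr[unfolded tr_X_def, THEN conjunct1])
    show "verdier_X W S f (vec (of_real s))"
      unfolding verdier_X_def
      by (rule exI[of _ 1], intro conjI ballI regular[OF trW small[OF s]] avoid[OF tr small[OF s]]) simp_all
  qed
qed

end
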